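(* Let $X$ be a random measure with values in $\mathcal{M}_{N_{max}}(R,M)$ for some $N_{max}\in\mathbb{N}^*$, and let $X_1,\dots,X_n$ be an i.i.d. sample drawn from $X$. Let $k\ge 2$ and assume that $\mathbb{E}(X)$ is supported by more than $k$ points and satisfies a margin condition with radius $r_0>0$. Denote $R_0=\frac{Br_0}{16\sqrt2R}$ and $\kappa_0=\frac{R_0}{R}$. Choose $T=\left\lceil\frac{\log n}{\log(4/3)}\right\rceil$ and let $\mathbf{c}^{(T)}$ denote the output of the batch (Lloyd) algorithm after $T$ iterations. There exist constants $c_1,C>0$ such that, if $\mathbf{c}^{(0)}\in\mathcal{B}(\mathcal{C}_{opt},R_0)$, then for $n$ large enough and for all $x>0$, with probability at least $1-9e^{-c_1np_{min}^2\kappa_0^2/M^2}-e^{-x}$, $$F(\mathbf{c}^{(T)})-F^*\le\mathbb{E}(X)(\mathbb{R}^d)\left(\frac{B^2r_0^2}{512R^2n}+C\frac{M^2R^2k^2d\log k}{n\,p_{min}^2}(1+x)\right).$$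
   Context: $\mathcal{M}(R,M)$ is the set of (nonnegative) Borel measures on the closed Euclidean ball $\mathcal{B}(0,R)\subset\mathbb{R}^d$ of total mass at most $M$; $\mathcal{M}_N(R,M)$ is the subset of those supported by (at most) $N$ points. The mean measure is $\mathbb{E}(X)(A)=\mathbb{E}(X(A))$, and the empirical mean measure is $\bar X_n(A)=\frac1n\sum_{i=1}^nX_i(A)$, for Borel sets $A$. For a codebook $\mathbf{c}=(c_1,\dots,c_k)\in(\mathbb{R}^d)^k$ (with Euclidean norm on $(\mathbb{R}^d)^k$), let $W_j(\mathbf{c})=\{x: \forall i<j\ \|x-c_j\|<\|x-c_i\|,\ \forall i>j\ \|x-c_j\|\le\|x-c_i\|\}$ and $N(\mathbf{c})=\{x:\exists i<j,\ x\in W_i(\mathbf{c}),\ \|x-c_i\|=\|x-c_j\|\}$. The distortion is $F(\mathbf{c})=\int\min_{1\le j\le k}\|u-c_j\|^2\,\mathbb{E}(X)(du)$; $\mathcal{C}_{opt}$ is its (nonempty) set of minimizers and $F^*$ its minimum. Put $B=\inf_{\mathbf{c}^*\in\mathcal{C}_{opt},\,i\ne j}\|c_i^*-c_j^*\|$ and $p_{min}=\inf_{\mathbf{c}^*\in\mathcal{C}_{opt},\,1\le j\le k}\mathbb{E}(X)(W_j(\mathbf{c}^* ))$ (both positive when $\mathbb{E}(X)$ is supported by more than $k$ points). For a subset $A$ of a Euclidean space, $\mathcal{B}(A,t)=\bigcup_{u\in A}\mathcal{B}(u,t)$. Margin condition: $\mathbb{E}(X)$ satisfies a margin condition with radius $r_0>0$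 if for all $0\le t\le r_0$, $\sup_{\mathbf{c}^*\in\mathcal{C}_{opt}}\mathbb{E}(X)(\mathcal{B}(N(\mathbf{c}^* ),t))\le\frac{Bp_{min}}{128R^2}t$. Batch (Lloyd) algorithm: from an initial codebook $\mathbf{c}^{(0)}$ (sampled from $\bar X_n$), iterate for $j=1,\dots,k$: $c_j^{(t+1)}=\frac{1}{\bar X_n(W_j(\mathbf{c}^{(t)}))}\int u\,\mathbf{1}_{W_j(\mathbf{c}^{(t)})}(u)\,\bar X_n(du)$ (set to $0$ if $\bar X_n(W_j(\mathbf{c}^{(t)}))=0$). *)

theory Defs
  imports "HOL-Probability.Probability"
begin

text \<open>
  The dimension \<open>d\<close> is a natural number rather than a type, since it has to be quantified inside
  the scope of constants that do not depend on it.  A point of \<open>d\<close>-dimensional space is an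
  extensional function on \<open>{1..d}\<close>, and the product sigma-algebra is the Borel sigma-algebra.
\<close>

definition Rd :: "nat \<Rightarrow> (nat \<Rightarrow> real) measure" where
  "Rd d = Pi\<^sub>M {1..d} (\<lambda>_. borel)"

definition edist :: "nat \<Rightarrow> (nat \<Rightarrow> real) \<Rightarrow> (nat \<Rightarrow> real) \<Rightarrow> real" where
  "edist d x y = L2_set (\<lambda>i. x i - y i) {1..d}"

definition zero_vec :: "nat \<Rightarrow> nat \<Rightarrow> real" where
  "zero_vec d = (\<lambda>i\<in>{1..d}. 0)"

definition closed_ball :: "nat \<Rightarrow> (nat \<Rightarrow> real) \<Rightarrow> real \<Rightarrow> (nat \<Rightarrow> real) set" where
  "closed_ball d u t = {x \<in> space (Rd d). edist d u x \<le> t}"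

definition neighbourhood :: "nat \<Rightarrow> (nat \<Rightarrow> real) set \<Rightarrow> real \<Rightarrow> (nat \<Rightarrow> real) set" where
  "neighbourhood d A t = (\<Union>u\<in>A. closed_ball d u t)"


section \<open>Random measures\<close>

text \<open>Measures on the ball are represented as measures on the whole space that vanish off it.\<close>

definition ball_measures :: "nat \<Rightarrow> real \<Rightarrow> real \<Rightarrow> (nat \<Rightarrow> real) measure set" where
  "ball_measures d R M = {\<mu>. sets \<mu> = sets (Rd d) \<and>
     emeasure \<mu> (space (Rd d) - closed_ball d (zero_vec d) R) = 0 \<and>
     emeasure \<mu> (space (Rd d)) \<le> ennreal M}"

definition supported_by_at_most :: "nat \<Rightarrow> 'a measure \<Rightarrow> bool" where
  "supported_by_at_most N \<mu> \<longleftrightarrow>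
     (\<exists>S \<subseteq> space \<mu>. finite S \<and> card S \<le> N \<and> emeasure \<mu> (space \<mu> - S) = 0)"

definition discrete_ball_measures ::
    "nat \<Rightarrow> nat \<Rightarrow> real \<Rightarrow> real \<Rightarrow> (nat \<Rightarrow> real) measure set" where
  "discrete_ball_measures d N R M = {\<mu> \<in> ball_measures d R M. supported_by_at_most N \<mu>}"

text \<open>
  The sigma-algebra on a set \<open>S\<close> of measures generated by the evaluations at the sets of \<open>K\<close>;
  compare \<^const>\<open>subprob_algebra\<close>.
\<close>

definition evaluation_algebra :: "'a measure \<Rightarrow> 'a measure set \<Rightarrow> 'a measure measure" where
  "evaluation_algebra K S = (SUP A\<in>sets K. vimage_algebra S (\<lambda>\<mu>. emeasure \<mu> A) borel)"

definition measure_space_of :: "nat \<Rightarrow> nat \<Rightarrow> real \<Rightarrow> real \<Rightarrow> (nat \<Rightarrow> real) measure measure" where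
  "measure_space_of d N R M = evaluation_algebra (Rd d) (discrete_ball_measures d N R M)"

definition mean_measure :: "'b measure \<Rightarrow> 'a measure \<Rightarrow> ('b \<Rightarrow> 'a measure) \<Rightarrow> 'a measure" where
  "mean_measure \<Omega> K X =
     measure_of (space K) (sets K) (\<lambda>A. \<integral>\<^sup>+\<omega>. emeasure (X \<omega>) A \<partial>\<Omega>)"

definition empirical_mean :: "'a measure \<Rightarrow> nat \<Rightarrow> (nat \<Rightarrow> 'a measure) \<Rightarrow> 'a measure" where
  "empirical_mean K n \<mu> =
     measure_of (space K) (sets K) (\<lambda>A. ennreal (1 / real n) * (\<Sum>i=1..n. emeasure (\<mu> i) A))"

lemma space_evaluation_algebra: "space (evaluation_algebra K S) = S"
  by (auto simp: evaluation_algebra_def space_Sup_eq_UN)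

lemma measurable_emeasure_evaluation_algebra:
  "A \<in> sets K \<Longrightarrow> (\<lambda>\<mu>. emeasure \<mu> A) \<in> borel_measurable (evaluation_algebra K S)"
  unfolding evaluation_algebra_def
  by (rule measurable_Sup1) (auto intro!: measurable_vimage_algebra1)

lemma emeasure_mean_measure:
  assumes X: "X \<in> measurable \<Omega> (evaluation_algebra K S)"
    and S: "\<And>\<mu>. \<mu> \<in> S \<Longrightarrow> sets \<mu> = sets K"
    and A: "A \<in> sets K"
  shows "emeasure (mean_measure \<Omega> K X) A = (\<integral>\<^sup>+\<omega>. emeasure (X \<omega>) A \<partial>\<Omega>)"
  unfolding mean_measure_def
proof (rule emeasure_measure_of_sigma)
  have meas: "(\<lambda>\<omega>. emeasure (X \<omega>) B) \<in> borel_measurable \<Omega>" if "B \<in> sets K" for B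
    using measurable_compose[OF X measurable_emeasure_evaluation_algebra[OF that]] .
  have setsX: "sets (X \<omega>) = sets K" if "\<omega> \<in> space \<Omega>" for \<omega>
    using measurable_space[OF X that] S by (auto simp: space_evaluation_algebra)
  show "countably_additive (sets K) (\<lambda>A. \<integral>\<^sup>+\<omega>. emeasure (X \<omega>) A \<partial>\<Omega>)"
  proof (rule countably_additiveI)
    fix F :: "nat \<Rightarrow> _" assume F: "range F \<subseteq> sets K" "disjoint_family F"
    have "(\<Sum>i. \<integral>\<^sup>+\<omega>. emeasure (X \<omega>) (F i) \<partial>\<Omega>) = (\<integral>\<^sup>+\<omega>. (\<Sum>i. emeasure (X \<omega>) (F i)) \<partial>\<Omega>)"
      using F by (intro nn_integral_suminf[symmetric] meas) auto
    also have "\<dots> = (\<integral>\<^sup>+\<omega>. emeasure (X \<omega>) (\<Union>i. F i) \<partial>\<Omega>)"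
      using F setsX by (intro nn_integral_cong suminf_emeasure) auto
    finally show "(\<Sum>i. \<integral>\<^sup>+\<omega>. emeasure (X \<omega>) (F i) \<partial>\<Omega>)
        = (\<integral>\<^sup>+\<omega>. emeasure (X \<omega>) (\<Union>i. F i) \<partial>\<Omega>)" .
  qed
qed (use A in \<open>auto simp: positive_def sets.sigma_algebra_axioms\<close>)

lemma emeasure_empirical_mean:
  assumes S: "\<And>i. i \<in> {1..n} \<Longrightarrow> sets (\<mu> i) = sets K"
    and A: "A \<in> sets K"
  shows "emeasure (empirical_mean K n \<mu>) A = ennreal (1 / real n) * (\<Sum>i=1..n. emeasure (\<mu> i) A)"
  unfolding empirical_mean_def
proof (rule emeasure_measure_of_sigma)
  show "countably_additive (sets K)
      (\<lambda>A. ennreal (1 / real n) * (\<Sum>i=1..n. emeasure (\<mu> i) A))"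
  proof (rule countably_additiveI)
    fix F :: "nat \<Rightarrow> _" assume F: "range F \<subseteq> sets K" "disjoint_family F"
    have "(\<Sum>j. \<Sum>i=1..n. emeasure (\<mu> i) (F j)) = (\<Sum>i=1..n. \<Sum>j. emeasure (\<mu> i) (F j))"
      by (rule suminf_sum) auto
    also have "\<dots> = (\<Sum>i=1..n. emeasure (\<mu> i) (\<Union>j. F j))"
      using F S by (intro sum.cong refl suminf_emeasure) auto
    finally show "(\<Sum>j. ennreal (1 / real n) * (\<Sum>i=1..n. emeasure (\<mu> i) (F j)))
        = ennreal (1 / real n) * (\<Sum>i=1..n. emeasure (\<mu> i) (\<Union>j. F j))"
      by (simp add: ennreal_suminf_cmult)
  qed
qed (use A in \<open>auto simp: positive_def sets.sigma_algebra_axioms\<close>)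


section \<open>Codebooks and quantization\<close>

definition codebook_space :: "nat \<Rightarrow> nat \<Rightarrow> (nat \<Rightarrow> nat \<Rightarrow> real) measure" where
  "codebook_space d k = Pi\<^sub>M {1..k} (\<lambda>_. Rd d)"

abbreviation codebooks :: "nat \<Rightarrow> nat \<Rightarrow> (nat \<Rightarrow> nat \<Rightarrow> real) set" where
  "codebooks d k \<equiv> space (codebook_space d k)"

definition codebook_dist ::
    "nat \<Rightarrow> nat \<Rightarrow> (nat \<Rightarrow> nat \<Rightarrow> real) \<Rightarrow> (nat \<Rightarrow> nat \<Rightarrow> real) \<Rightarrow> real" where
  "codebook_dist d k c c' = L2_set (\<lambda>j. edist d (c j) (c' j)) {1..k}"

definition codebook_neighbourhood ::
    "nat \<Rightarrow> nat \<Rightarrow> (nat \<Rightarrow> nat \<Rightarrow> real) set \<Rightarrow> real \<Rightarrow> (nat \<Rightarrow> nat \<Rightarrow> real) set" where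
  "codebook_neighbourhood d k A t =
     (\<Union>c'\<in>A. {c \<in> codebooks d k. codebook_dist d k c' c \<le> t})"

definition cell :: "nat \<Rightarrow> nat \<Rightarrow> (nat \<Rightarrow> nat \<Rightarrow> real) \<Rightarrow> nat \<Rightarrow> (nat \<Rightarrow> real) set" where
  "cell d k c j = {x \<in> space (Rd d).
     (\<forall>i\<in>{1..k}. i < j \<longrightarrow> edist d x (c j) < edist d x (c i)) \<and>
     (\<forall>i\<in>{1..k}. i > j \<longrightarrow> edist d x (c j) \<le> edist d x (c i))}"

definition cell_boundary :: "nat \<Rightarrow> nat \<Rightarrow> (nat \<Rightarrow> nat \<Rightarrow> real) \<Rightarrow> (nat \<Rightarrow> real) set" where
  "cell_boundary d k c = {x \<in> space (Rd d). \<exists>i\<in>{1..k}. \<exists>j\<in>{1..k}. i < j \<and>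
     x \<in> cell d k c i \<and> edist d x (c i) = edist d x (c j)}"

definition distortion ::
    "nat \<Rightarrow> nat \<Rightarrow> (nat \<Rightarrow> real) measure \<Rightarrow> (nat \<Rightarrow> nat \<Rightarrow> real) \<Rightarrow> real" where
  "distortion d k \<mu> c = (\<integral>u. (MIN j\<in>{1..k}. (edist d u (c j))\<^sup>2) \<partial>\<mu>)"

definition min_distortion :: "nat \<Rightarrow> nat \<Rightarrow> (nat \<Rightarrow> real) measure \<Rightarrow> real" where
  "min_distortion d k \<mu> = (INF c\<in>codebooks d k. distortion d k \<mu> c)"

definition C_opt ::
    "nat \<Rightarrow> nat \<Rightarrow> (nat \<Rightarrow> real) measure \<Rightarrow> (nat \<Rightarrow> nat \<Rightarrow> real) set" where
  "C_opt d k \<mu> = {c \<in> codebooks d k.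
     \<forall>c'\<in>codebooks d k. distortion d k \<mu> c \<le> distortion d k \<mu> c'}"

definition B_sep :: "nat \<Rightarrow> nat \<Rightarrow> (nat \<Rightarrow> real) measure \<Rightarrow> real" where
  "B_sep d k \<mu> = Inf {edist d (c i) (c j) | c i j.
     c \<in> C_opt d k \<mu> \<and> i \<in> {1..k} \<and> j \<in> {1..k} \<and> i \<noteq> j}"

definition p_min :: "nat \<Rightarrow> nat \<Rightarrow> (nat \<Rightarrow> real) measure \<Rightarrow> real" where
  "p_min d k \<mu> = Inf {measure \<mu> (cell d k c j) | c j. c \<in> C_opt d k \<mu> \<and> j \<in> {1..k}}"

definition margin_condition ::
    "nat \<Rightarrow> nat \<Rightarrow> real \<Rightarrow> (nat \<Rightarrow> real) measure \<Rightarrow> real \<Rightarrow> bool" where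
  "margin_condition d k R \<mu> r0 \<longleftrightarrow> (\<forall>t. 0 \<le> t \<and> t \<le> r0 \<longrightarrow>
     (SUP c\<in>C_opt d k \<mu>. measure \<mu> (neighbourhood d (cell_boundary d k c) t))
       \<le> B_sep d k \<mu> * p_min d k \<mu> / (128 * R\<^sup>2) * t)"

definition lloyd_step :: "nat \<Rightarrow> nat \<Rightarrow> (nat \<Rightarrow> real) measure \<Rightarrow>
    (nat \<Rightarrow> nat \<Rightarrow> real) \<Rightarrow> (nat \<Rightarrow> nat \<Rightarrow> real)" where
  "lloyd_step d k \<mu> c = (\<lambda>j\<in>{1..k}.
     if measure \<mu> (cell d k c j) = 0 then zero_vec d
     else (\<lambda>l\<in>{1..d}. (1 / measure \<mu> (cell d k c j)) *
            (\<integral>u. u l * indicator (cell d k c j) u \<partial>\<mu>)))"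

end

theory Submission
  imports Defs "HOL-Real_Asymp.Real_Asymp"
begin

text \<open>
  Let \<open>a\<close> be an optimal codebook. A codebook at distance \<open>\<delta>\<close> from \<open>a\<close> assigns a point of the ball to
  another cell than \<open>a\<close> only if the point lies in a strip of width \<open>O(R \<delta> / B)\<close> around the cell
  boundary of \<open>a\<close>, and by the margin condition the mean measure of this strip is a small multiple of
  \<open>p \<delta> / R\<close>. As the codepoints of \<open>a\<close> are the centroids of their cells, a Lloyd step under the mean
  measure contracts the distance to \<open>a\<close>. Under the empirical mean the same computation applies
  (\<open>lloyd_step_contraction\<close>), except for two fluctuations: that of the masses and first moments of the
  cells of \<open>a\<close>, and that of the masses of strips around the boundary of \<open>a\<close>. Both refer to the fixed
  codebook \<open>a\<close> and not to the current iterate. Each step therefore halves the distance to \<open>a\<close> up to an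
  additive error \<open>\<nu>\<close> (\<open>lloyd_iterates_dist_le\<close>), and the excess distortion is at most the total mass
  times the squared distance (\<open>distortion_excess_le\<close>).

  The initial codebook may depend on the sample, so the fluctuations have to be controlled for all
  optimal codebooks at once. There are finitely many of them: the contraction makes them isolated
  (\<open>C_opt_isolated\<close>), and they lie in a ball (\<open>finite_C_opt\<close>). Their number is not bounded in terms of
  \<open>k\<close> and \<open>d\<close>, however, so that a union bound would be too weak for small \<open>x\<close>. Instead, the deviation of
  the cell moments is bounded by chaining (\<open>prob_ex_deviation_gt_le\<close>). The entropy comes from the
  Sauer-Shelah lemma: partitions into \<open>k\<close> Voronoi cells that are \<open>\<epsilon>\<close>-separated number at most
  \<open>exp (O(k\<^sup>2 d ln (k / \<epsilon>)))\<close> (\<open>ln_card_separated_codebooks\<close>). Since the set of optimal codebooks is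
  finite and the size of the sample may be required to be large in terms of it, one can chain in
  the metric of the mean measure itself, with Bernstein's inequality for sums of random vectors
  (\<open>prob_deviation_gt_le\<close>) for each link. For the strips a union bound over a grid of widths is
  precise enough, as the margin condition leaves room to compare their masses with twice the means.

  Finiteness also makes the event in question measurable, and the measure of a neighbourhood of the
  cell boundary is meaningful because the neighbourhood is described by finitely many polynomial
  inequalities (\<open>neighbourhood_cell_boundary_eq_strip\<close>).
\<close>

section \<open>Voronoi cells and the strips around their boundary\<close>

lemma edist_nonneg [simp]: "0 \<le> edist d x y"
  by (simp add: edist_def)

lemma edist_sq: "(edist d x y)\<^sup>2 = (\<Sum>l=1..d. (x l - y l)\<^sup>2)"
  by (simp add: edist_def L2_set_def sum_nonneg)

lemma edist_commute: "edist d x y = edist d y x"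
  by (simp add: edist_def L2_set_def power2_commute)

lemma edist_triangle: "edist d x z \<le> edist d x y + edist d y z"
  using L2_set_triangle_ineq[of "\<lambda>l. x l - y l" "\<lambda>l. y l - z l" "{1..d}"]
  by (simp add: edist_def)

lemma abs_sum_mult_le_L2_set: "\<bar>\<Sum>i\<in>A. f i * g i\<bar> \<le> L2_set f A * L2_set g A"
proof -
  have "\<bar>\<Sum>i\<in>A. f i * g i\<bar> \<le> (\<Sum>i\<in>A. \<bar>f i\<bar> * \<bar>g i\<bar>)"
    by (rule order_trans[OF sum_abs]) (simp add: abs_mult)
  then show ?thesis using L2_set_mult_ineq[of f g A] by linarith
qed

lemma edist_sq_diff:
  "(edist d u a)\<^sup>2 - (edist d u b)\<^sup>2 = (\<Sum>l=1..d. (b l - a l) * (2 * u l - a l - b l))"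
  unfolding edist_sq sum_subtractf[symmetric]
  by (intro sum.cong refl) (simp add: power2_eq_square algebra_simps)

text \<open>
  The difference of the squared distances to two points is affine in the moving point, with
  gradient twice the difference of these points.
\<close>

lemma edist_sq_shift:
  "(edist d y a)\<^sup>2 - (edist d y b)\<^sup>2
     = (edist d x a)\<^sup>2 - (edist d x b)\<^sup>2 + 2 * (\<Sum>l=1..d. (b l - a l) * (y l - x l))"
  unfolding edist_sq_diff sum_distrib_left sum.distrib[symmetric]
  by (intro sum.cong refl) (simp add: algebra_simps)

lemma cell_nearest:
  assumes "u \<in> cell d k c j" "i \<in> {1..k}"
  shows "edist d u (c j) \<le> edist d u (c i)"
  using assms by (cases i j rule: linorder_cases) (auto simp: cell_def intro: less_imp_le)

text \<open>
  The tie-breaking rule of the cells assigns a point to the least index among its nearest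
  codepoints.
\<close>

lemma ex_cell:
  assumes "u \<in> space (Rd d)" "1 \<le> k"
  shows "\<exists>j\<in>{1..k}. u \<in> cell d k c j"
proof -
  define m where "m = (MIN i\<in>{1..k}. edist d u (c i))"
  define P where "P = (\<lambda>j. j \<in> {1..k} \<and> edist d u (c j) = m)"
  have ne: "{1..k} \<noteq> {}" using assms by auto
  have "m \<in> (\<lambda>i. edist d u (c i)) ` {1..k}"
    unfolding m_def using ne by (intro Min_in) auto
  then have "\<exists>j. P j" by (auto simp: P_def)
  then have Pj: "P (LEAST j. P j)" by (rule LeastI_ex)
  define j where "j = (LEAST j. P j)"
  have le: "m \<le> edist d u (c i)" if "i \<in> {1..k}" for i
    unfolding m_def using that by (intro Min_le) auto
  have "edist d u (c j) < edist d u (c i)" if "i \<in> {1..k}" "i < j" for i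
  proof -
    have "\<not> P i" using not_less_Least[of i P] that(2) by (simp add: j_def)
    then show ?thesis using that Pj le[OF that(1)] by (auto simp: P_def j_def)
  qed
  moreover have "edist d u (c j) \<le> edist d u (c i)" if "i \<in> {1..k}" for i
    using le[OF that] Pj by (simp add: P_def j_def)
  ultimately have "u \<in> cell d k c j" using assms by (auto simp: cell_def)
  then show ?thesis using Pj by (auto simp: P_def j_def)
qed

lemma cell_unique:
  assumes "u \<in> cell d k c i" "u \<in> cell d k c j" "i \<in> {1..k}" "j \<in> {1..k}"
  shows "i = j"
  using assms by (cases i j rule: linorder_cases) (force simp: cell_def)+

lemma cell_subset_space: "cell d k c j \<subseteq> space (Rd d)"
  by (auto simp: cell_def)

lemma MIN_edist_cell:
  assumes "u \<in> cell d k c j" "j \<in> {1..k}"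
  shows "(MIN i\<in>{1..k}. (edist d u (c i))\<^sup>2) = (edist d u (c j))\<^sup>2"
  using assms cell_nearest[OF assms(1)] by (intro Min_eqI) (auto intro!: power_mono)

lemma borel_measurable_component:
  assumes "f \<in> measurable M (Rd d)" "l \<in> {1..d}"
  shows "(\<lambda>x. f x l) \<in> borel_measurable M"
  using measurable_compose[OF assms(1)[unfolded Rd_def] measurable_component_singleton[OF assms(2)]] .

lemma borel_measurable_edist:
  assumes "f \<in> measurable M (Rd d)" "g \<in> measurable M (Rd d)"
  shows "(\<lambda>x. edist d (f x) (g x)) \<in> borel_measurable M"
proof -
  have "(\<lambda>x. (\<Sum>l=1..d. (f x l - g x l)\<^sup>2)) \<in> borel_measurable M"
    using assms by (intro borel_measurable_sum borel_measurable_power borel_measurable_diff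
        borel_measurable_component)
  then show ?thesis unfolding edist_def L2_set_def by measurable
qed

lemma borel_measurable_edist_const [measurable]: "(\<lambda>x. edist d x a) \<in> borel_measurable (Rd d)"
proof -
  have "(\<lambda>x. (\<Sum>l=1..d. (x l - a l)\<^sup>2)) \<in> borel_measurable (Rd d)"
    by (intro borel_measurable_sum borel_measurable_power borel_measurable_diff
        borel_measurable_component measurable_ident_sets borel_measurable_const) auto
  then show ?thesis unfolding edist_def L2_set_def by measurable
qed

lemma sets_Collect_nearest:
  fixes D :: "'a \<Rightarrow> nat \<Rightarrow> real"
  assumes D: "\<And>i. i \<in> {1..k} \<Longrightarrow> (\<lambda>x. D x i) \<in> borel_measurable M" and j: "j \<in> {1..k}"
  shows "{x \<in> space M. (\<forall>i\<in>{1..k}. i < j \<longrightarrow> D x j < D x i) \<and> (\<forall>i\<in>{1..k}. i > j \<longrightarrow> D x j \<le> D x i)} \<in> sets M"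
proof (intro sets.sets_Collect_conj sets.sets_Collect_finite_All)
  fix i assume i: "i \<in> {1..k}"
  show "{x \<in> space M. i < j \<longrightarrow> D x j < D x i} \<in> sets M"
    using borel_measurable_less[OF D[OF j] D[OF i]] by (cases "i < j") auto
  show "{x \<in> space M. i > j \<longrightarrow> D x j \<le> D x i} \<in> sets M"
    using borel_measurable_le[OF D[OF j] D[OF i]] by (cases "i > j") auto
qed auto

lemma sets_cell: "j \<in> {1..k} \<Longrightarrow> cell d k c j \<in> sets (Rd d)"
  unfolding cell_def using borel_measurable_edist_const by (rule sets_Collect_nearest)

lemma sets_closed_ball [measurable]: "closed_ball d a t \<in> sets (Rd d)"
proof -
  have "closed_ball d a t = {x \<in> space (Rd d). edist d x a \<le> t}"
    by (simp add: closed_ball_def edist_commute)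
  then show ?thesis by simp
qed

definition strip :: "nat \<Rightarrow> nat \<Rightarrow> (nat \<Rightarrow> nat \<Rightarrow> real) \<Rightarrow> real \<Rightarrow> (nat \<Rightarrow> real) set" where
  "strip d k c t = {x \<in> space (Rd d). \<exists>i\<in>{1..k}. x \<in> cell d k c i \<and>
     (\<exists>j\<in>{1..k}. j \<noteq> i \<and> (edist d x (c j))\<^sup>2 - (edist d x (c i))\<^sup>2 \<le> 2 * t * edist d (c i) (c j))}"

lemma stripI:
  assumes "x \<in> space (Rd d)" "i \<in> {1..k}" "j \<in> {1..k}" "i \<noteq> j" "x \<in> cell d k c i"
    and "(edist d x (c j))\<^sup>2 - (edist d x (c i))\<^sup>2 \<le> 2 * t * edist d (c i) (c j)"
  shows "x \<in> strip d k c t"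
  unfolding strip_def mem_Collect_eq using assms(4)
  by (intro conjI assms(1) bexI[OF _ assms(2)] bexI[OF _ assms(3)] assms(5,6)) simp

lemma cell_boundaryI:
  assumes y: "y \<in> space (Rd d)" and i: "i \<in> {1..k}" and j: "j \<in> {1..k}" and ne: "i \<noteq> j"
    and eq: "edist d y (c i) = edist d y (c j)"
    and near: "\<And>m. m \<in> {1..k} \<Longrightarrow> edist d y (c i) \<le> edist d y (c m)"
  shows "y \<in> cell_boundary d k c"
proof -
  have "1 \<le> k" using i by auto
  then obtain a where a: "a \<in> {1..k}" "y \<in> cell d k c a" using ex_cell[OF y] by blast
  have ea: "edist d y (c a) = edist d y (c i)"
    using cell_nearest[OF a(2) i] near[OF a(1)] by linarith
  obtain b where b: "b \<in> {1..k}" "b \<noteq> a" "edist d y (c b) = edist d y (c a)"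
    using i j ne eq ea by metis
  have "a < b"
  proof (rule ccontr)
    assume "\<not> a < b"
    then have "b < a" using b by simp
    then show False using a b by (auto simp: cell_def)
  qed
  then show ?thesis unfolding cell_boundary_def using y a b by force
qed

text \<open>
  The distance of a point to the cell boundary is attained on the nearest of the bisecting
  hyperplanes that separate its own cell from the others: up to the nearest one, the segment
  orthogonal to it stays in the cell.  This replaces a neighbourhood, whose measurability is not
  evident, by finitely many polynomial inequalities.
\<close>

lemma neighbourhood_cell_boundary_eq_strip:
  assumes dist: "\<And>i j. i \<in> {1..k} \<Longrightarrow> j \<in> {1..k} \<Longrightarrow> i \<noteq> j \<Longrightarrow> 0 < edist d (c i) (c j)"
    and t: "0 \<le> t" and c: "c \<in> codebooks d k"
  shows "neighbourhood d (cell_boundary d k c) t = strip d k c t"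
proof (intro equalityI subsetI)
  fix x assume "x \<in> neighbourhood d (cell_boundary d k c) t"
  then obtain y where y: "y \<in> cell_boundary d k c" and x: "x \<in> space (Rd d)"
    and yx: "edist d y x \<le> t"
    by (auto simp: neighbourhood_def closed_ball_def)
  obtain a b where ab: "a \<in> {1..k}" "b \<in> {1..k}" "a < b" "y \<in> cell d k c a"
    "edist d y (c a) = edist d y (c b)" using y by (auto simp: cell_boundary_def)
  then obtain i where i: "i \<in> {1..k}" "x \<in> cell d k c i" using ex_cell[OF x, of k c] by auto
  obtain j where j: "j \<in> {1..k}" "j \<noteq> i" "edist d y (c j) \<le> edist d y (c i)"
    using ab cell_nearest[OF ab(4) i(1)] by (metis nat_neq_iff)
  have "(edist d x (c j))\<^sup>2 - (edist d x (c i))\<^sup>2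
      = (edist d y (c j))\<^sup>2 - (edist d y (c i))\<^sup>2 + 2 * (\<Sum>l=1..d. (c i l - c j l) * (x l - y l))"
    by (rule edist_sq_shift)
  moreover have "(edist d y (c j))\<^sup>2 \<le> (edist d y (c i))\<^sup>2" using j by (intro power_mono) auto
  moreover have "(\<Sum>l=1..d. (c i l - c j l) * (x l - y l)) \<le> edist d (c i) (c j) * edist d x y"
    unfolding edist_def by (rule abs_le_D1[OF abs_sum_mult_le_L2_set])
  moreover have "edist d (c i) (c j) * edist d x y \<le> edist d (c i) (c j) * t"
    using yx edist_commute[of d x y] by (intro mult_left_mono) simp_all
  ultimately have "(edist d x (c j))\<^sup>2 - (edist d x (c i))\<^sup>2 \<le> 2 * (edist d (c i) (c j) * t)"
    by linarith
  also have "\<dots> = 2 * t * edist d (c i) (c j)" by simp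
  finally have "(edist d x (c j))\<^sup>2 - (edist d x (c i))\<^sup>2 \<le> 2 * t * edist d (c i) (c j)" .
  then show "x \<in> strip d k c t" using j(2) by (intro stripI[OF x i(1) j(1) _ i(2)]) simp_all
next
  fix x assume "x \<in> strip d k c t"
  then obtain i j0 where x: "x \<in> space (Rd d)" and i: "i \<in> {1..k}" "x \<in> cell d k c i"
    and j0: "j0 \<in> {1..k}" "j0 \<noteq> i"
      "(edist d x (c j0))\<^sup>2 - (edist d x (c i))\<^sup>2 \<le> 2 * t * edist d (c i) (c j0)"
    unfolding strip_def by blast
  \<comment> \<open>\<open>\<tau> j\<close> is the distance of \<open>x\<close> from the bisecting hyperplane of \<open>c i\<close> and \<open>c j\<close>.\<close>
  define \<tau> where "\<tau> = (\<lambda>j. ((edist d x (c j))\<^sup>2 - (edist d x (c i))\<^sup>2) / (2 * edist d (c i) (c j)))"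
  define J where "J = {1..k} - {i}"
  have J: "finite J" "j0 \<in> J" using j0 by (auto simp: J_def)
  obtain j where jJ: "j \<in> J" and jmin: "\<And>m. m \<in> J \<Longrightarrow> \<tau> j \<le> \<tau> m"
    using ex_min_if_finite[of "\<tau> ` J"] J by (metis (no_types, lifting) empty_iff finite_imageI image_iff linorder_not_less)
  have j: "j \<in> {1..k}" "j \<noteq> i" using jJ by (auto simp: J_def)
  have pos: "0 < edist d (c i) (c m)" if "m \<in> J" for m using dist[OF i(1), of m] that by (auto simp: J_def)
  have num: "(edist d x (c m))\<^sup>2 - (edist d x (c i))\<^sup>2 = 2 * \<tau> m * edist d (c i) (c m)" if "m \<in> J" for m
    using pos[OF that] by (simp add: \<tau>_def)
  have \<tau>0: "0 \<le> \<tau> j"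
    unfolding \<tau>_def using cell_nearest[OF i(2) j(1)] by (intro divide_nonneg_nonneg) (auto intro: power_mono)
  have "2 * \<tau> j0 * edist d (c i) (c j0) \<le> 2 * t * edist d (c i) (c j0)"
    using j0 num[OF J(2)] by simp
  then have "\<tau> j0 \<le> t" using pos[OF J(2)] by simp
  then have \<tau>t: "\<tau> j \<le> t" using jmin[OF J(2)] by linarith
  define D where "D = edist d (c i) (c j)"
  have D: "0 < D" using pos[OF jJ] by (simp add: D_def)
  have D2: "D * D = (\<Sum>l=1..d. (c i l - c j l)\<^sup>2)" using edist_sq[of d "c i" "c j"] by (simp add: D_def power2_eq_square)
  define y where "y = (\<lambda>l\<in>{1..d}. x l + \<tau> j / D * (c j l - c i l))"
  have ys: "y \<in> space (Rd d)" by (auto simp: y_def Rd_def space_PiM)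
  have "(edist d y x)\<^sup>2 = (\<Sum>l=1..d. (\<tau> j / D)\<^sup>2 * (c i l - c j l)\<^sup>2)"
    unfolding edist_sq by (intro sum.cong refl) (auto simp: y_def power_mult_distrib power_divide power2_commute[of "c j _"])
  also have "\<dots> = (\<tau> j)\<^sup>2" unfolding sum_distrib_left[symmetric] D2[symmetric] using D
    by (simp add: power2_eq_square)
  finally have yx: "edist d y x = \<tau> j" using \<tau>0 by (simp add: power2_eq_iff_nonneg)
  have shift: "(edist d y (c m))\<^sup>2 - (edist d y (c i))\<^sup>2 =
    2 * \<tau> m * edist d (c i) (c m) + 2 * (\<Sum>l=1..d. (c i l - c m l) * (y l - x l))" if "m \<in> J" for m
    using edist_sq_shift[of d y "c m" "c i" x] num[OF that] by simp
  have "(\<Sum>l=1..d. (c i l - c j l) * (y l - x l)) = (\<Sum>l=1..d. - (\<tau> j / D) * (c i l - c j l)\<^sup>2)"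
    by (intro sum.cong refl) (auto simp: y_def power2_eq_square algebra_simps diff_divide_distrib)
  also have "\<dots> = - (\<tau> j * D)" unfolding sum_distrib_left[symmetric] D2[symmetric] using D by simp
  finally have "(edist d y (c j))\<^sup>2 - (edist d y (c i))\<^sup>2 = 0"
    using shift[OF jJ] by (simp add: D_def)
  then have eq: "edist d y (c i) = edist d y (c j)" by (simp add: power2_eq_iff_nonneg)
  have near: "edist d y (c i) \<le> edist d y (c m)" if m: "m \<in> {1..k}" for m
  proof (cases "m = i")
    case False
    then have mJ: "m \<in> J" using m by (simp add: J_def)
    have "- (\<Sum>l=1..d. (c i l - c m l) * (y l - x l)) \<le> edist d (c i) (c m) * edist d y x"
      unfolding edist_def by (rule abs_le_D2[OF abs_sum_mult_le_L2_set])
    also have "\<dots> \<le> edist d (c i) (c m) * \<tau> m"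
      unfolding yx using jmin[OF mJ] by (intro mult_left_mono) auto
    also have "\<dots> = (2 * \<tau> m * edist d (c i) (c m)) / 2" by simp
    finally have "0 \<le> (edist d y (c m))\<^sup>2 - (edist d y (c i))\<^sup>2"
      unfolding shift[OF mJ] by linarith
    then have "(edist d y (c i))\<^sup>2 \<le> (edist d y (c m))\<^sup>2" by linarith
    then show ?thesis by (rule power2_le_imp_le) (rule edist_nonneg)
  qed simp
  have "y \<in> cell_boundary d k c"
    using cell_boundaryI[OF ys i(1) j(1) _ eq near] j by auto
  then show "x \<in> neighbourhood d (cell_boundary d k c) t"
    using x yx \<tau>t by (auto simp: neighbourhood_def closed_ball_def intro!: bexI[of _ y])
qed

lemma sets_strip [measurable]: "strip d k c t \<in> sets (Rd d)"
proof -
  have "{x \<in> space (Rd d). (edist d x (c j))\<^sup>2 - (edist d x (c i))\<^sup>2 \<le> 2 * t * edist d (c i) (c j)}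
      \<in> sets (Rd d)" for i j
    by measurable
  moreover have "{x \<in> space (Rd d). x \<in> cell d k c i} \<in> sets (Rd d)" if "i \<in> {1..k}" for i
    using sets_cell[OF that, of d c] by (simp add: sets.Int_space_eq1 Collect_conj_eq)
  ultimately show ?thesis unfolding strip_def
    by (intro sets.sets_Collect_finite_Ex sets.sets_Collect_conj sets.sets_Collect_const) auto
qed

text \<open>
  The points to which two codebooks assign different labels. Every point of the space lies in
  exactly one cell of each codebook, so the one-sided differences already contain all of them.
\<close>

definition mismatch where
  "mismatch d k c c' = (\<Union>j\<in>{1..k}. cell d k c' j - cell d k c j)"

lemma sets_mismatch [measurable]: "mismatch d k c c' \<in> sets (Rd d)"
  unfolding mismatch_def by (intro sets.finite_UN sets.Diff sets_cell) auto

lemma mismatchE: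
  assumes "u \<in> mismatch d k c c'"
  obtains i j where "i \<in> {1..k}" "j \<in> {1..k}" "i \<noteq> j" "u \<in> cell d k c i" "u \<in> cell d k c' j"
proof -
  obtain j where j: "j \<in> {1..k}" "u \<in> cell d k c' j" "u \<notin> cell d k c j"
    using assms by (auto simp: mismatch_def)
  have "u \<in> space (Rd d)" using j cell_subset_space by blast
  then obtain i where "i \<in> {1..k}" "u \<in> cell d k c i" using ex_cell[of u d k c] j by auto
  then show ?thesis using that j by metis
qed

lemma mismatch_commute: "mismatch d k c c' = mismatch d k c' c"
proof -
  have *: "mismatch d k a b \<subseteq> mismatch d k b a" for a b
  proof
    fix u assume "u \<in> mismatch d k a b"
    then obtain i j where "i \<in> {1..k}" "j \<in> {1..k}" "i \<noteq> j" "u \<in> cell d k a i" "u \<in> cell d k b j"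
      by (rule mismatchE)
    moreover from this have "u \<notin> cell d k b i" using cell_unique[of u d k b i j] by blast
    ultimately show "u \<in> mismatch d k b a" unfolding mismatch_def by blast
  qed
  show ?thesis using *[of c c'] *[of c' c] by blast
qed

lemma edist_sq_perturb:
  "\<bar>(edist d u a)\<^sup>2 - (edist d u b)\<^sup>2\<bar> \<le> edist d a b * (edist d u a + edist d u b)"
proof -
  have "(edist d u a)\<^sup>2 - (edist d u b)\<^sup>2 = (edist d u a - edist d u b) * (edist d u a + edist d u b)"
    by (simp add: power2_eq_square algebra_simps)
  moreover have "\<bar>edist d u a - edist d u b\<bar> \<le> edist d a b"
    using edist_triangle[of d u a b] edist_triangle[of d u b a] by (simp add: edist_commute)
  ultimately show ?thesis by (simp add: abs_mult mult_right_mono)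
qed

lemma edist_le_codebook_dist: "j \<in> {1..k} \<Longrightarrow> edist d (c j) (c' j) \<le> codebook_dist d k c c'"
  unfolding codebook_dist_def by (rule member_le_L2_set) auto

text \<open>
  Moving the codepoints by \<open>\<delta>\<close> moves each bisecting hyperplane, within the ball, by a multiple of
  \<open>R \<delta> / B\<close> only.
\<close>

lemma mismatch_subset_strip:
  assumes u: "u \<in> mismatch d k c c'" "u \<in> closed_ball d (zero_vec d) R"
    and c: "\<And>j. j \<in> {1..k} \<Longrightarrow> c j \<in> closed_ball d (zero_vec d) R"
    and B: "0 < B" "\<And>i j. i \<in> {1..k} \<Longrightarrow> j \<in> {1..k} \<Longrightarrow> i \<noteq> j \<Longrightarrow> B \<le> edist d (c i) (c j)"
    and \<delta>: "codebook_dist d k c c' \<le> \<delta>" "\<delta> \<le> R / 2"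
  shows "u \<in> strip d k c (4 * R * \<delta> / B)"
proof -
  obtain i j where ij: "i \<in> {1..k}" "j \<in> {1..k}" "i \<noteq> j" "u \<in> cell d k c i" "u \<in> cell d k c' j"
    using u(1) by (rule mismatchE)
  have R: "0 \<le> R" and us: "u \<in> space (Rd d)"
    using u(2) order_trans[OF edist_nonneg[of d "zero_vec d" u]] by (auto simp: closed_ball_def)
  define a where "a = (\<lambda>m. edist d (c m) (c' m))"
  have uc: "edist d u (c m) \<le> 2 * R" if "m \<in> {1..k}" for m
    using edist_triangle[of d u "c m" "zero_vec d"] u(2) c[OF that]
    by (auto simp: closed_ball_def edist_commute)
  have am: "a m \<le> \<delta>" "0 \<le> a m" if "m \<in> {1..k}" for m
    using edist_le_codebook_dist[OF that, of d c c'] \<delta> by (auto simp: a_def)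
  have pert: "\<bar>(edist d u (c m))\<^sup>2 - (edist d u (c' m))\<^sup>2\<bar> \<le> a m * (9 / 2 * R)" if m: "m \<in> {1..k}" for m
  proof -
    have "edist d u (c' m) \<le> edist d u (c m) + a m"
      using edist_triangle[of d u "c' m" "c m"] by (simp add: a_def)
    then have "edist d u (c m) + edist d u (c' m) \<le> 9 / 2 * R"
      using uc[OF m] am[OF m] \<delta> by linarith
    then have "a m * (edist d u (c m) + edist d u (c' m)) \<le> a m * (9 / 2 * R)"
      using am[OF m] by (intro mult_left_mono)
    then show ?thesis using edist_sq_perturb[of d u "c m" "c' m"] by (simp add: a_def)
  qed
  have "(edist d u (c' j))\<^sup>2 \<le> (edist d u (c' i))\<^sup>2"
    by (intro power_mono cell_nearest[OF ij(5,1)] edist_nonneg)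
  then have main: "(edist d u (c j))\<^sup>2 - (edist d u (c i))\<^sup>2 \<le> (a i + a j) * (9 / 2 * R)"
    using abs_le_D1[OF pert[OF ij(2)]] abs_le_D2[OF pert[OF ij(1)]] unfolding distrib_right by linarith
  have "(a i + a j)\<^sup>2 \<le> 2 * \<delta>\<^sup>2"
  proof -
    have "(a i)\<^sup>2 + (a j)\<^sup>2 = (\<Sum>m\<in>{i, j}. (a m)\<^sup>2)" using ij by simp
    also have "\<dots> \<le> (\<Sum>m\<in>{1..k}. (a m)\<^sup>2)" using ij by (intro sum_mono2) auto
    also have "\<dots> = (codebook_dist d k c c')\<^sup>2" by (simp add: codebook_dist_def L2_set_def a_def sum_nonneg)
    also have "\<dots> \<le> \<delta>\<^sup>2" using \<delta> by (intro power_mono) (auto simp: codebook_dist_def)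
    finally show ?thesis using sum_squares_bound[of "a i" "a j"] by (simp add: power2_sum)
  qed
  moreover have "2 * \<delta>\<^sup>2 \<le> 256 / 81 * \<delta>\<^sup>2" by (intro mult_right_mono) auto
  moreover have "(16 / 9 * \<delta>)\<^sup>2 = 256 / 81 * \<delta>\<^sup>2" by (simp add: power_mult_distrib power_divide)
  ultimately have "(a i + a j)\<^sup>2 \<le> (16 / 9 * \<delta>)\<^sup>2" by linarith
  then have "a i + a j \<le> 16 / 9 * \<delta>"
    by (rule power2_le_imp_le) (use am[OF ij(1)] in simp)
  then have "(a i + a j) * (9 / 2 * R) \<le> 16 / 9 * \<delta> * (9 / 2 * R)"
    using R by (intro mult_right_mono) auto
  moreover have "16 / 9 * \<delta> * (9 / 2 * R) \<le> 2 * (4 * R * \<delta> / B) * edist d (c i) (c j)"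
  proof -
    have "8 * R * \<delta> * B \<le> 8 * R * \<delta> * edist d (c i) (c j)"
      using R am[OF ij(1)] B(2)[OF ij(1,2,3)] by (intro mult_left_mono) auto
    then show ?thesis using B(1) by (simp add: field_simps)
  qed
  ultimately have "(edist d u (c j))\<^sup>2 - (edist d u (c i))\<^sup>2 \<le> 2 * (4 * R * \<delta> / B) * edist d (c i) (c j)"
    using main by linarith
  then show ?thesis by (rule stripI[OF us ij(1-4)])
qed

lemma strip_mono:
  assumes "s \<le> t"
  shows "strip d k c s \<subseteq> strip d k c t"
proof -
  have "2 * s * edist d a b \<le> 2 * t * edist d a b" for a b
    using assms by (intro mult_right_mono) auto
  then show ?thesis unfolding strip_def by (blast intro: order_trans)
qed

lemma ball_subset_strip:
  assumes k: "2 \<le> k" and c: "\<And>j. j \<in> {1..k} \<Longrightarrow> c j \<in> closed_ball d (zero_vec d) R"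
  shows "closed_ball d (zero_vec d) R \<subseteq> strip d k c (2 * R)"
proof
  fix u assume u: "u \<in> closed_ball d (zero_vec d) R"
  then have us: "u \<in> space (Rd d)" by (simp add: closed_ball_def)
  obtain i where i: "i \<in> {1..k}" "u \<in> cell d k c i" using ex_cell[OF us, of k c] k by auto
  define j where "j = (if i = 1 then 2 else 1 :: nat)"
  have j: "j \<in> {1..k}" "j \<noteq> i" using k by (auto simp: j_def)
  have uc: "edist d u (c m) \<le> 2 * R" if "m \<in> {1..k}" for m
    using edist_triangle[of d u "c m" "zero_vec d"] u c[OF that]
    by (auto simp: closed_ball_def edist_commute)
  have "(edist d u (c j))\<^sup>2 - (edist d u (c i))\<^sup>2 \<le> edist d (c j) (c i) * (edist d u (c j) + edist d u (c i))"
    by (rule abs_le_D1[OF edist_sq_perturb])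
  also have "\<dots> \<le> edist d (c j) (c i) * (4 * R)"
    using uc[OF i(1)] uc[OF j(1)] by (intro mult_left_mono) auto
  also have "\<dots> = 2 * (2 * R) * edist d (c i) (c j)" by (simp add: edist_commute)
  finally show "u \<in> strip d k c (2 * R)" using j(2) by (intro stripI[OF us i(1) j(1) _ i(2)]) simp_all
qed


section \<open>Counting partitions into Voronoi cells\<close>

definition shatters :: "'a set set \<Rightarrow> 'a set \<Rightarrow> bool" where
  "shatters \<F> S \<longleftrightarrow> (\<forall>T\<subseteq>S. \<exists>A\<in>\<F>. A \<inter> S = T)"

lemma shattersD: "shatters \<F> S \<Longrightarrow> T \<subseteq> S \<Longrightarrow> \<exists>A\<in>\<F>. A \<inter> S = T"
  by (simp add: shatters_def)

lemma shatters_mono: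
  assumes "shatters \<F> S" "\<F> \<subseteq> \<G>"
  shows "shatters \<G> S"
  unfolding shatters_def
proof (intro allI impI)
  fix T assume "T \<subseteq> S"
  from shattersD[OF assms(1) this] obtain A where "A \<in> \<F>" "A \<inter> S = T" by blast
  then show "\<exists>A\<in>\<G>. A \<inter> S = T" using assms(2) by (intro bexI[of _ A]) auto
qed

text \<open>
  Pajor's form of the Sauer-Shelah lemma. Split the family according to membership of a point
  \<open>x\<close>. A set that is shattered by both halves is shattered by the family with and without \<open>x\<close>, so
  the shattered sets of the two halves can be counted disjointly.
\<close>

lemma card_le_card_shattered:
  assumes "finite U" "\<F> \<subseteq> Pow U"
  shows "card \<F> \<le> card {S. S \<subseteq> U \<and> shatters \<F> S}"
  using assms
proof (induction U arbitrary: \<F> rule: finite_induct)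
  case empty
  then have "\<F> = {} \<or> \<F> = {{}}" by auto
  moreover have "{S. S \<subseteq> {} \<and> shatters \<F> S} = {{}}" if "\<F> = {{}}"
    using that by (auto simp: shatters_def)
  ultimately show ?case by fastforce
next
  case (insert x U)
  define \<F>0 where "\<F>0 = {A \<in> \<F>. x \<notin> A}"
  define \<F>1 where "\<F>1 = (\<lambda>A. A - {x}) ` {A \<in> \<F>. x \<in> A}"
  define sh where "sh = (\<lambda>\<G>. {S. S \<subseteq> U \<and> shatters \<G> S})"
  have fin\<F>: "finite \<F>" using insert by (meson finite.insertI finite_Pow_iff finite_subset)
  have inj: "inj_on (\<lambda>A. A - {x}) {A \<in> \<F>. x \<in> A}" by (auto simp: inj_on_def)
  have "card \<F> = card ({A \<in> \<F>. x \<notin> A} \<union> {A \<in> \<F>. x \<in> A})" by (rule arg_cong[of _ _ card]) auto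
  also have "\<dots> = card \<F>0 + card \<F>1"
    unfolding \<F>0_def \<F>1_def card_image[OF inj] using fin\<F> by (intro card_Un_disjoint) auto
  also have "\<dots> \<le> card (sh \<F>0) + card (sh \<F>1)"
    unfolding sh_def using insert by (intro add_mono insert.IH) (auto simp: \<F>0_def \<F>1_def)
  also have "\<dots> = card (sh \<F>0 \<union> sh \<F>1) + card (sh \<F>0 \<inter> sh \<F>1)"
    using insert by (intro card_Un_Int) (auto simp: sh_def)
  also have "card (sh \<F>0 \<inter> sh \<F>1) = card (insert x ` (sh \<F>0 \<inter> sh \<F>1))"
  proof (intro card_image[symmetric] inj_onI)
    fix A B assume "A \<in> sh \<F>0 \<inter> sh \<F>1" "B \<in> sh \<F>0 \<inter> sh \<F>1" and eq: "insert x A = insert x B"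
    then have "x \<notin> A" "x \<notin> B" using insert by (auto simp: sh_def)
    then show "A = B" using eq insert_ident by metis
  qed
  also have "card (sh \<F>0 \<union> sh \<F>1) + \<dots> = card ((sh \<F>0 \<union> sh \<F>1) \<union> insert x ` (sh \<F>0 \<inter> sh \<F>1))"
    using insert by (intro card_Un_disjoint[symmetric]) (auto simp: sh_def)
  also have "\<dots> \<le> card {S. S \<subseteq> insert x U \<and> shatters \<F> S}"
  proof (intro card_mono subsetI)
    fix S assume "S \<in> (sh \<F>0 \<union> sh \<F>1) \<union> insert x ` (sh \<F>0 \<inter> sh \<F>1)"
    then consider "S \<in> sh \<F>0" | "S \<in> sh \<F>1" | S' where "S = insert x S'" "S' \<in> sh \<F>0" "S' \<in> sh \<F>1"
      by auto
    then show "S \<in> {S. S \<subseteq> insert x U \<and> shatters \<F> S}"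
    proof cases
      case 1
      then have "shatters \<F>0 S" "S \<subseteq> U" by (auto simp: sh_def)
      then show ?thesis using shatters_mono[of \<F>0 S \<F>] by (auto simp: \<F>0_def)
    next
      case 2
      have "\<exists>A\<in>\<F>. A \<inter> S = T" if T: "T \<subseteq> S" for T
      proof -
        have "shatters \<F>1 S" using 2 by (simp add: sh_def)
        from shattersD[OF this T] obtain A where "A \<in> \<F>" "(A - {x}) \<inter> S = T"
          by (auto simp: \<F>1_def)
        moreover have "x \<notin> S" using 2 insert by (auto simp: sh_def)
        ultimately show ?thesis by (intro bexI[of _ A]) auto
      qed
      then have "shatters \<F> S" by (simp add: shatters_def)
      then show ?thesis using 2 by (auto simp: sh_def)
    next
      case 3
      have xS': "x \<notin> S'" using 3 insert by (auto simp: sh_def)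
      have "\<exists>A\<in>\<F>. A \<inter> S = T" if T: "T \<subseteq> S" for T
      proof (cases "x \<in> T")
        case True
        have "shatters \<F>1 S'" "T - {x} \<subseteq> S'" using 3 T by (auto simp: sh_def)
        from shattersD[OF this] obtain A where "A \<in> \<F>" "x \<in> A" "(A - {x}) \<inter> S' = T - {x}"
          by (auto simp: \<F>1_def)
        then show ?thesis using True 3 xS' by (intro bexI[of _ A]) auto
      next
        case False
        have "shatters \<F>0 S'" "T \<subseteq> S'" using 3 T False by (auto simp: sh_def)
        from shattersD[OF this] obtain A where "A \<in> \<F>" "x \<notin> A" "A \<inter> S' = T"
          by (auto simp: \<F>0_def)
        then show ?thesis using False 3 xS' by (intro bexI[of _ A]) auto
      qed
      then have "shatters \<F> S" by (simp add: shatters_def)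
      then show ?thesis using 3 by (auto simp: sh_def)
    qed
  qed (use insert in auto)
  finally show ?case .
qed

text \<open>
  Gaussian elimination: a point \<open>v\<close> with \<open>\<phi> D v \<noteq> 0\<close> serves to eliminate the function \<open>\<phi> D\<close>.
\<close>

lemma ex_linear_dependency:
  fixes \<phi> :: "nat \<Rightarrow> 'a \<Rightarrow> real"
  assumes "finite S" "D < card S"
  shows "\<exists>a. (\<exists>u\<in>S. a u \<noteq> 0) \<and> (\<forall>l<D. (\<Sum>u\<in>S. a u * \<phi> l u) = 0)"
  using assms
proof (induction D arbitrary: S \<phi>)
  case 0
  then obtain u where "u \<in> S" by fastforce
  then show ?case by (intro exI[of _ "\<lambda>_. 1"]) auto
next
  case (Suc D)
  show ?case
  proof (cases "\<forall>u\<in>S. \<phi> D u = 0")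
    case True
    obtain a where a: "\<exists>u\<in>S. a u \<noteq> 0" "\<forall>l<D. (\<Sum>u\<in>S. a u * \<phi> l u) = 0"
      using Suc.IH[of S \<phi>] Suc.prems by auto
    have "(\<Sum>u\<in>S. a u * \<phi> l u) = 0" if "l < Suc D" for l
      using that a(2) True by (cases "l = D") auto
    then show ?thesis using a(1) by blast
  next
    case False
    then obtain v where v: "v \<in> S" "\<phi> D v \<noteq> 0" by blast
    define \<psi> where "\<psi> = (\<lambda>l u. \<phi> l u - \<phi> D u / \<phi> D v * \<phi> l v)"
    have fin: "finite (S - {v})" "D < card (S - {v})" using Suc.prems v by auto
    obtain a where a: "\<exists>u\<in>S - {v}. a u \<noteq> 0" "\<And>l. l < D \<Longrightarrow> (\<Sum>u\<in>S - {v}. a u * \<psi> l u) = 0"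
      using Suc.IH[OF fin, of \<psi>] by auto
    define s where "s = (\<Sum>u\<in>S - {v}. a u * \<phi> D u)"
    define b where "b = a(v := - s / \<phi> D v)"
    have split: "(\<Sum>u\<in>S. b u * \<phi> l u) = (\<Sum>u\<in>S - {v}. a u * \<phi> l u) - s / \<phi> D v * \<phi> l v" for l
    proof -
      have "(\<Sum>u\<in>S. b u * \<phi> l u) = b v * \<phi> l v + (\<Sum>u\<in>S - {v}. b u * \<phi> l u)"
        using Suc.prems v by (intro sum.remove) auto
      also have "(\<Sum>u\<in>S - {v}. b u * \<phi> l u) = (\<Sum>u\<in>S - {v}. a u * \<phi> l u)"
        by (intro sum.cong) (auto simp: b_def)
      finally show ?thesis by (simp add: b_def)
    qed
    have "(\<Sum>u\<in>S. b u * \<phi> l u) = 0" if "l < Suc D" for l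
    proof (cases "l = D")
      case True
      then show ?thesis using split[of D] v by (simp add: s_def)
    next
      case False
      then have "0 = (\<Sum>u\<in>S - {v}. a u * \<psi> l u)" using a(2)[of l] that by simp
      also have "\<dots> = (\<Sum>u\<in>S - {v}. a u * \<phi> l u) - (\<Sum>u\<in>S - {v}. a u * \<phi> D u * (\<phi> l v / \<phi> D v))"
        unfolding sum_subtractf[symmetric] by (intro sum.cong) (auto simp: \<psi>_def algebra_simps)
      also have "\<dots> = (\<Sum>u\<in>S - {v}. a u * \<phi> l u) - s / \<phi> D v * \<phi> l v"
        unfolding s_def sum_distrib_right[symmetric] by simp
      finally show ?thesis using split[of l] by simp
    qed
    moreover have "\<exists>u\<in>S. b u \<noteq> 0" using a(1) by (auto simp: b_def)
    ultimately show ?thesis by blast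
  qed
qed

text \<open>
  More than \<open>D\<close> points carry a linear dependency \<open>a\<close> of the values of the \<open>D\<close> functions. A
  halfspace that cuts out exactly the points with \<open>a u \<le> 0\<close> would have a functional with the sign of
  \<open>a\<close> wherever \<open>a\<close> is positive, and then its pairing with \<open>a\<close> could not vanish.
\<close>

lemma card_le_of_shatters_halfspaces:
  fixes \<phi> :: "nat \<Rightarrow> 'a \<Rightarrow> real"
  assumes S: "finite S" "S \<subseteq> U" and sh: "shatters (range (\<lambda>w. {u\<in>U. (\<Sum>l<D. w l * \<phi> l u) \<le> 0})) S"
  shows "card S \<le> D"
proof (rule ccontr)
  assume "\<not> card S \<le> D"
  then obtain a0 where a0: "\<exists>u\<in>S. a0 u \<noteq> 0" "\<And>l. l < D \<Longrightarrow> (\<Sum>u\<in>S. a0 u * \<phi> l u) = 0"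
    using ex_linear_dependency[of S D \<phi>] S by auto
  obtain a where a: "\<exists>u\<in>S. 0 < a u" "\<And>l. l < D \<Longrightarrow> (\<Sum>u\<in>S. a u * \<phi> l u) = 0"
  proof (cases "\<exists>u\<in>S. 0 < a0 u")
    case True
    then show ?thesis using that a0 by blast
  next
    case False
    then have "\<exists>u\<in>S. 0 < - a0 u" using a0(1) by force
    moreover have "(\<Sum>u\<in>S. - a0 u * \<phi> l u) = 0" if "l < D" for l
      using a0(2)[OF that] by (simp add: sum_negf)
    ultimately show ?thesis using that[of "\<lambda>u. - a0 u"] by blast
  qed
  obtain w where w: "{u\<in>U. (\<Sum>l<D. w l * \<phi> l u) \<le> 0} \<inter> S = {u\<in>S. a u \<le> 0}"
    using sh unfolding shatters_def by (metis (mono_tags, lifting) image_iff mem_Collect_eq subsetI)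
  define f where "f = (\<lambda>u. \<Sum>l<D. w l * \<phi> l u)"
  have sgn: "f u \<le> 0 \<longleftrightarrow> a u \<le> 0" if "u \<in> S" for u
    using w that S(2) unfolding f_def by blast
  have "(\<Sum>u\<in>S. a u * f u) = (\<Sum>l<D. w l * (\<Sum>u\<in>S. a u * \<phi> l u))"
    unfolding f_def sum_distrib_left by (subst sum.swap) (simp add: mult_ac)
  also have "\<dots> = 0" using a(2) by simp
  finally have "(\<Sum>u\<in>S. a u * f u) = 0" .
  moreover have "0 < (\<Sum>u\<in>S. a u * f u)"
  proof -
    obtain v where v: "v \<in> S" "0 < a v" using a(1) by blast
    have nn: "0 \<le> a u * f u" if "u \<in> S" for u
      using sgn[OF that] by (cases "a u \<le> 0") (auto intro: mult_nonpos_nonpos)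
    have "0 < a v * f v" using v sgn[OF v(1)] by auto
    then show ?thesis using S(1) v nn by (intro sum_pos2[of _ v]) auto
  qed
  ultimately show False by simp
qed

lemma card_halfspace_traces:
  fixes \<phi> :: "nat \<Rightarrow> 'a \<Rightarrow> real"
  assumes "finite U"
  shows "card (range (\<lambda>w. {u\<in>U. (\<Sum>l<D. w l * \<phi> l u) \<le> 0})) \<le> (\<Sum>i\<le>D. card U choose i)"
proof -
  define \<F> where "\<F> = range (\<lambda>w. {u\<in>U. (\<Sum>l<D. w l * \<phi> l u) \<le> 0})"
  have "card \<F> \<le> card {S. S \<subseteq> U \<and> shatters \<F> S}"
    using assms by (intro card_le_card_shattered) (auto simp: \<F>_def)
  also have "\<dots> \<le> card (\<Union>i\<in>{..D}. {S. S \<subseteq> U \<and> card S = i})"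
  proof (intro card_mono subsetI)
    fix S assume S: "S \<in> {S. S \<subseteq> U \<and> shatters \<F> S}"
    then have "card S \<le> D"
      using card_le_of_shatters_halfspaces[of S U \<phi> D] assms finite_subset by (auto simp: \<F>_def)
    then show "S \<in> (\<Union>i\<in>{..D}. {S. S \<subseteq> U \<and> card S = i})" using S by auto
  qed (use assms in auto)
  also have "\<dots> \<le> (\<Sum>i\<le>D. card {S. S \<subseteq> U \<and> card S = i})" by (rule card_UN_le) auto
  also have "\<dots> = (\<Sum>i\<le>D. card U choose i)" using assms by (simp add: n_subsets)
  finally show ?thesis by (simp add: \<F>_def)
qed

text \<open>
  The factor \<open>1 / D\<close> under the power matters: without it the entropy bound for codebooks would
  contain an extra \<open>ln d\<close>.
\<close>

lemma sum_binomial_le: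
  assumes "1 \<le> D" "D \<le> m"
  shows "real (\<Sum>i\<le>D. m choose i) \<le> (exp 1 * real m / real D) ^ D"
proof -
  define q where "q = real D / real m"
  have q: "0 < q" "q \<le> 1" using assms by (auto simp: q_def)
  have "real (\<Sum>i\<le>D. m choose i) * q ^ D \<le> (\<Sum>i\<le>D. real (m choose i) * q ^ i)"
    unfolding of_nat_sum sum_distrib_right
    using q by (intro sum_mono mult_left_mono power_decreasing) auto
  also have "\<dots> \<le> (\<Sum>i\<le>m. real (m choose i) * q ^ i)"
    using assms q by (intro sum_mono2) auto
  also have "\<dots> = (q + 1) ^ m" by (simp add: binomial_ring)
  also have "\<dots> \<le> exp q ^ m" using q exp_ge_add_one_self[of q] by (intro power_mono) (auto simp: add.commute)
  also have "\<dots> = exp 1 ^ D" using assms by (simp add: q_def exp_of_nat_mult[symmetric])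
  finally have "real (\<Sum>i\<le>D. m choose i) \<le> exp 1 ^ D / q ^ D" using q by (simp add: field_simps)
  then show ?thesis by (simp add: q_def power_divide power_mult_distrib)
qed

text \<open>
  Averaging over the position of a point shows that some point hits at least the fraction
  \<open>\<epsilon>\<close> of the sets that have not been hit yet.
\<close>

lemma ex_hitting_set:
  assumes Q: "finite_measure Q" "0 < measure Q (space Q)"
    and fin: "finite P" and D: "\<And>p. p \<in> P \<Longrightarrow> D p \<in> sets Q"
    and big: "\<And>p. p \<in> P \<Longrightarrow> \<epsilon> * measure Q (space Q) \<le> measure Q (D p)" and \<epsilon>: "\<epsilon> \<le> 1"
  shows "\<exists>U\<subseteq>space Q. finite U \<and> card U \<le> K \<and>
    real (card {p\<in>P. U \<inter> D p = {}}) \<le> (1 - \<epsilon>) ^ K * real (card P)"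
proof (induction K)
  case 0
  then show ?case by (intro exI[of _ "{}"]) auto
next
  case (Suc K)
  interpret finite_measure Q by (rule Q(1))
  obtain U where U: "U \<subseteq> space Q" "finite U" "card U \<le> K"
    "real (card {p\<in>P. U \<inter> D p = {}}) \<le> (1 - \<epsilon>) ^ K * real (card P)" using Suc by blast
  define P' where "P' = {p\<in>P. U \<inter> D p = {}}"
  have P': "finite P'" "P' \<subseteq> P" using fin by (auto simp: P'_def)
  have "\<exists>u\<in>space Q. \<epsilon> * real (card P') \<le> (\<Sum>p\<in>P'. indicator (D p) u)"
  proof (rule ccontr)
    assume "\<not> ?thesis"
    then have less: "(\<Sum>p\<in>P'. indicat_real (D p) u) < \<epsilon> * real (card P')" if "u \<in> space Q" for u
      using that by force
    have "integrable Q (\<lambda>u. \<Sum>p\<in>P'. indicat_real (D p) u)"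
      using P' D by (intro Bochner_Integration.integrable_sum integrable_real_indicator)
        (auto simp: emeasure_eq_measure)
    then have "(\<integral>u. (\<Sum>p\<in>P'. indicator (D p) u) \<partial>Q) < (\<integral>u. \<epsilon> * real (card P') \<partial>Q)"
      using Q(2) less by (intro integral_less_AE_space AE_I2) (auto simp: emeasure_eq_measure)
    moreover have "(\<integral>u. (\<Sum>p\<in>P'. indicator (D p) u) \<partial>Q) = (\<Sum>p\<in>P'. measure Q (D p))"
      using P' D by (subst Bochner_Integration.integral_sum)
        (auto simp: subset_iff emeasure_eq_measure intro!: sum.cong)
    moreover have "real (card P') * (\<epsilon> * measure Q (space Q)) \<le> (\<Sum>p\<in>P'. measure Q (D p))"
      using P' big by (intro sum_bounded_below) auto
    ultimately show False by (simp add: mult_ac)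
  qed
  then obtain u where u: "u \<in> space Q" "\<epsilon> * real (card P') \<le> (\<Sum>p\<in>P'. indicator (D p) u)" by blast
  have hit: "(\<Sum>p\<in>P'. indicator (D p) u) = real (card {p\<in>P'. u \<in> D p})"
    using P'(1) by (simp add: indicator_def sum.If_cases Int_def)
  have "card P' = card ({p\<in>P'. u \<in> D p} \<union> {p\<in>P'. u \<notin> D p})" by (rule arg_cong[of _ _ card]) auto
  also have "\<dots> = card {p\<in>P'. u \<in> D p} + card {p\<in>P'. u \<notin> D p}"
    using P'(1) by (intro card_Un_disjoint) auto
  finally have "real (card {p\<in>P'. u \<notin> D p}) \<le> (1 - \<epsilon>) * real (card P')"
    using u(2) hit by (simp add: algebra_simps)
  also have "\<dots> \<le> (1 - \<epsilon>) * ((1 - \<epsilon>) ^ K * real (card P))"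
    using U(4) \<epsilon> by (intro mult_left_mono) (auto simp: P'_def)
  also have "{p\<in>P'. u \<notin> D p} = {p\<in>P. insert u U \<inter> D p = {}}" by (auto simp: P'_def)
  finally show ?case using U u(1) by (intro exI[of _ "insert u U"]) (auto simp: card_insert_if)
qed

lemma closer_set_is_halfspace:
  "\<exists>w. \<forall>u. edist d u a \<le> edist d u b \<longleftrightarrow> (\<Sum>l<Suc d. w l * (if l = 0 then 1 else u l)) \<le> 0"
proof -
  define w where "w = (\<lambda>l. if l = 0 then (\<Sum>l=1..d. (a l - b l) * (a l + b l)) else 2 * (b l - a l))"
  have "edist d u a \<le> edist d u b \<longleftrightarrow> (\<Sum>l<Suc d. w l * (if l = 0 then 1 else u l)) \<le> 0" for u
  proof -
    have "(\<Sum>l<Suc d. w l * (if l = 0 then 1 else u l)) = w 0 + (\<Sum>l=1..d. 2 * (b l - a l) * u l)"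
      unfolding sum.lessThan_Suc_shift by (simp add: w_def sum.atLeast1_atMost_eq)
    also have "\<dots> = (edist d u a)\<^sup>2 - (edist d u b)\<^sup>2"
      unfolding edist_sq_diff w_def if_P[OF refl] sum.distrib[symmetric]
      by (intro sum.cong refl) (simp add: algebra_simps)
    finally show ?thesis by (simp add: power2_le_iff_abs_le)
  qed
  then show ?thesis by blast
qed

text \<open>
  The \<open>k\<^sup>2\<close> comparisons between distances to two codepoints determine the label of a point, and
  each of them is decided by a halfspace in the \<open>d + 1\<close> functions \<open>1, u 1, \<dots>, u d\<close>.
\<close>

lemma card_codebooks_separated_on:
  assumes G: "finite G" and U: "finite U" "U \<subseteq> space (Rd d)"
    and sep: "\<And>c c'. c \<in> G \<Longrightarrow> c' \<in> G \<Longrightarrow> c \<noteq> c' \<Longrightarrow> U \<inter> mismatch d k c c' \<noteq> {}"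
  shows "card G \<le> (\<Sum>i\<le>Suc d. card U choose i) ^ k\<^sup>2"
proof -
  define \<F> where "\<F> = range (\<lambda>w. {u\<in>U. (\<Sum>l<Suc d. w l * (if l = 0 then 1 else u l)) \<le> 0})"
  define tr where "tr = (\<lambda>c. \<lambda>(i,j)\<in>{1..k} \<times> {1..k}. {u\<in>U. edist d u (c i) \<le> edist d u (c j)})"
  have fin: "finite \<F>" by (rule finite_subset[of _ "Pow U"]) (use U in \<open>auto simp: \<F>_def\<close>)
  have "inj_on tr G"
  proof (rule inj_onI, rule ccontr)
    fix c c' assume c: "c \<in> G" "c' \<in> G" "tr c = tr c'" "c \<noteq> c'"
    then obtain u where u: "u \<in> U" "u \<in> mismatch d k c c'" using sep by blast
    have eq: "edist d u (c i) \<le> edist d u (c j) \<longleftrightarrow> edist d u (c' i) \<le> edist d u (c' j)"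
      if "i \<in> {1..k}" "j \<in> {1..k}" for i j
    proof -
      have "u \<in> tr c (i, j) \<longleftrightarrow> u \<in> tr c' (i, j)" using c by simp
      then show ?thesis using that u(1) by (simp add: tr_def)
    qed
    obtain j where j: "j \<in> {1..k}" "u \<in> cell d k c' j" "u \<notin> cell d k c j"
      using u(2) by (auto simp: mismatch_def)
    then show False using eq[OF j(1)] eq[OF _ j(1)] by (fastforce simp: cell_def not_le[symmetric])
  qed
  moreover have "tr ` G \<subseteq> PiE ({1..k} \<times> {1..k}) (\<lambda>_. \<F>)"
  proof (intro image_subsetI PiE_I)
    fix c p assume p: "p \<in> {1..k} \<times> {1..k}"
    obtain w where "\<forall>u. edist d u (c (fst p)) \<le> edist d u (c (snd p)) \<longleftrightarrow>
        (\<Sum>l<Suc d. w l * (if l = 0 then 1 else u l)) \<le> 0"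
      using closer_set_is_halfspace by blast
    then show "tr c p \<in> \<F>" using p unfolding \<F>_def tr_def by (auto simp: case_prod_beta)
  qed (auto simp: tr_def)
  ultimately have "card G \<le> card (PiE ({1..k} \<times> {1..k}) (\<lambda>_. \<F>))"
    using fin by (intro card_inj_on_le[of tr]) (auto intro!: finite_PiE)
  also have "\<dots> = card \<F> ^ k\<^sup>2" by (simp add: card_PiE power2_eq_square)
  also have "\<dots> \<le> (\<Sum>i\<le>Suc d. card U choose i) ^ k\<^sup>2"
    unfolding \<F>_def using card_halfspace_traces[OF U(1), of "\<lambda>l u. if l = 0 then 1 else u l" "Suc d"]
    by (intro power_mono) auto
  finally show ?thesis .
qed

text \<open>
  Packing numbers of partitions into \<open>k\<close> Voronoi cells, in the \<open>L\<^sup>1\<close> metric of a measure. A packing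
  with \<open>N\<close> elements is separated by about \<open>2 ln N / \<epsilon>\<close> points, hence \<open>N\<close> is at most the number of
  partitions of so many points. This bounds \<open>N\<close> by a power of \<open>ln N\<close>; in terms of
  \<open>z = ln N / (k\<^sup>2 (d + 1))\<close> the inequality reads \<open>z \<le> 1 + ln (2 k\<^sup>2 (1 + z) / \<epsilon>)\<close>, where the
  dimension has cancelled.
\<close>

lemma ln_card_separated_codebooks:
  assumes Q: "finite_measure Q" "sets Q = sets (Rd d)" "0 < measure Q (space Q)"
    and G: "finite G" and d: "1 \<le> d" and k: "1 \<le> k" and \<epsilon>: "0 < \<epsilon>" "\<epsilon> \<le> 1"
    and sep: "\<And>c c'. c \<in> G \<Longrightarrow> c' \<in> G \<Longrightarrow> c \<noteq> c' \<Longrightarrow>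
      \<epsilon> * measure Q (space Q) \<le> measure Q (mismatch d k c c')"
  shows "ln (real (card G)) \<le> (real k)\<^sup>2 * real (Suc d) * (3 + 2 * ln (2 * (real k)\<^sup>2 / \<epsilon>))"
proof (cases "card G = 0")
  case True
  have "1 \<le> (real k)\<^sup>2" using k by simp
  then have "1 \<le> 2 * (real k)\<^sup>2 / \<epsilon>" using \<epsilon> by (simp add: field_simps)
  then have "0 \<le> ln (2 * (real k)\<^sup>2 / \<epsilon>)" by simp
  then show ?thesis using True by simp
next
  case False
  define D where "D = Suc d"
  define N where "N = card G"
  define z where "z = ln (real N) / ((real k)\<^sup>2 * real D)"
  \<comment> \<open>The summand \<open>D\<close> makes the bound on the sum of binomial coefficients applicable.\<close>
  define K where "K = D + nat \<lceil>2 * ln (real N) / \<epsilon>\<rceil> + 1"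
  define P where "P = {p \<in> G \<times> G. fst p \<noteq> snd p}"
  have N: "1 \<le> N" using False by (simp add: N_def)
  have kD: "0 < (real k)\<^sup>2 * real D" using k by (simp add: D_def)
  have spQ: "space Q = space (Rd d)" using Q(2) by (rule sets_eq_imp_space_eq)
  have z0: "0 \<le> z" unfolding z_def using N kD by simp
  have lnN: "ln (real N) = (real k)\<^sup>2 * real D * z" using k by (simp add: z_def D_def)
  obtain U where U: "U \<subseteq> space Q" "finite U" "card U \<le> K"
    "real (card {p\<in>P. U \<inter> mismatch d k (fst p) (snd p) = {}}) \<le> (1 - \<epsilon>) ^ K * real (card P)"
    using ex_hitting_set[OF Q(1,3), of P "\<lambda>p. mismatch d k (fst p) (snd p)" \<epsilon> K] G sep \<epsilon> Q(2)
    by (auto simp: P_def)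
  have "card P \<le> card (G \<times> G)" using G by (intro card_mono) (auto simp: P_def)
  then have cP: "real (card P) \<le> (real N)\<^sup>2"
    unfolding card_cartesian_product by (simp add: N_def power2_eq_square flip: of_nat_mult)
  have "(1 - \<epsilon>) ^ K \<le> exp (- \<epsilon>) ^ K"
    using \<epsilon> exp_ge_add_one_self[of "- \<epsilon>"] by (intro power_mono) auto
  also have "\<dots> = exp (- (\<epsilon> * real K))" by (simp add: exp_of_nat_mult[symmetric] mult.commute)
  also have "\<dots> < exp (- (2 * ln (real N)))"
  proof -
    have "2 * ln (real N) / \<epsilon> < real K" unfolding K_def by linarith
    then show ?thesis using \<epsilon> by (simp add: field_simps)
  qed
  also have "\<dots> = 1 / (real N)\<^sup>2" using N by (simp add: exp_minus exp_double field_simps)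
  finally have "(1 - \<epsilon>) ^ K * (real N)\<^sup>2 < 1" using N by (simp add: field_simps)
  moreover have "(1 - \<epsilon>) ^ K * real (card P) \<le> (1 - \<epsilon>) ^ K * (real N)\<^sup>2"
    using cP \<epsilon> by (intro mult_left_mono) auto
  ultimately have "card {p\<in>P. U \<inter> mismatch d k (fst p) (snd p) = {}} = 0" using U(4) by linarith
  then have sepU: "U \<inter> mismatch d k c c' \<noteq> {}" if "c \<in> G" "c' \<in> G" "c \<noteq> c'" for c c'
    using that G by (auto simp: P_def)
  have "N \<le> (\<Sum>i\<le>D. card U choose i) ^ k\<^sup>2"
    unfolding N_def D_def using card_codebooks_separated_on[OF G U(2) _ sepU] U(1) spQ by simp
  also have "\<dots> \<le> (\<Sum>i\<le>D. K choose i) ^ k\<^sup>2"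
    using U(3) by (intro power_mono sum_mono binomial_right_mono) auto
  finally have "real N \<le> real (\<Sum>i\<le>D. K choose i) ^ k\<^sup>2" by (metis of_nat_mono of_nat_power)
  also have "\<dots> \<le> ((exp 1 * real K / real D) ^ D) ^ k\<^sup>2"
    by (intro power_mono sum_binomial_le of_nat_0_le_iff) (simp_all add: D_def K_def)
  also have "\<dots> = (exp 1 * real K / real D) ^ (D * k\<^sup>2)" by (simp add: power_mult)
  finally have "ln (real N) \<le> ln ((exp 1 * real K / real D) ^ (D * k\<^sup>2))"
    using N by (intro ln_mono) auto
  also have "\<dots> = real (D * k\<^sup>2) * ln (exp 1 * real K / real D)" by (rule ln_realpow)
  also have "ln (exp 1 * real K / real D) = 1 + ln (real K / real D)"
    by (simp add: ln_mult ln_div K_def D_def)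
  finally have "(real k)\<^sup>2 * real D * z \<le> (real k)\<^sup>2 * real D * (1 + ln (real K / real D))"
    unfolding lnN by (simp add: mult_ac)
  then have z1: "z \<le> 1 + ln (real K / real D)" using kD by (rule mult_left_le_imp_le)
  have "real K \<le> real D + (2 * ln (real N) / \<epsilon> + 2)" 
    using N \<epsilon> unfolding K_def by (simp add: of_nat_nat) linarith
  then have "real K / real D \<le> (real D + (2 * ln (real N) / \<epsilon> + 2)) / real D"
    by (intro divide_right_mono) auto
  also have "\<dots> = 1 + 2 * (real k)\<^sup>2 * z / \<epsilon> + 2 / real D"
    unfolding lnN add_divide_distrib by (simp add: D_def)
  also have "2 / real D \<le> 1" using d by (simp add: D_def)
  finally have KD: "real K / real D \<le> 2 + 2 * (real k)\<^sup>2 / \<epsilon> * z" by (simp add: mult_ac)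
  have "2 \<le> 2 * (real k)\<^sup>2 / \<epsilon>"
  proof -
    have "1 \<le> (real k)\<^sup>2" using k by simp
    then show ?thesis using \<epsilon> by (simp add: field_simps)
  qed
  then have "real K / real D \<le> (2 * (real k)\<^sup>2 / \<epsilon>) * (1 + z)"
    using KD unfolding distrib_left by linarith
  then have "ln (real K / real D) \<le> ln ((2 * (real k)\<^sup>2 / \<epsilon>) * (1 + z))"
    by (intro ln_mono) (auto simp: K_def D_def)
  also have "\<dots> = ln (2 * (real k)\<^sup>2 / \<epsilon>) + ln (1 + z)"
    using k \<epsilon> z0 by (intro ln_mult_pos) auto
  also have "ln (1 + z) \<le> z / 2 + 1 / 2"
  proof -
    have "ln (1 + z) = ln 2 + ln ((1 + z) / 2)" using z0 by (simp add: ln_div)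
    also have "ln 2 \<le> (1 :: real)" using ln_le_minus_one[of "2 :: real"] by simp
    also have "ln ((1 + z) / 2) \<le> (1 + z) / 2 - 1" using z0 by (intro ln_le_minus_one) auto
    finally show ?thesis by (simp add: field_simps)
  qed
  finally have "z \<le> 3 + 2 * ln (2 * (real k)\<^sup>2 / \<epsilon>)" using z1 by linarith
  then show ?thesis using lnN kD unfolding N_def D_def by (simp add: mult_left_mono)
qed


section \<open>Concentration of vector valued sums\<close>

lemma power_chord_le:
  fixes a b t :: real
  assumes "0 \<le> a" "0 \<le> b" "0 \<le> t" "t \<le> 1"
  shows "((1 - t) * a + t * b) ^ n \<le> (1 - t) * a ^ n + t * b ^ n"
proof (induction n)
  case (Suc n)
  define c where "c = (1 - t) * a + t * b"
  have "c ^ Suc n \<le> c * ((1 - t) * a ^ n + t * b ^ n)"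
    using Suc assms by (auto simp: c_def intro!: mult_left_mono)
  also have "\<dots> = (1 - t) * a ^ Suc n + t * b ^ Suc n - t * (1 - t) * ((a - b) * (a ^ n - b ^ n))"
    unfolding c_def power_Suc by (simp add: algebra_simps)
  also have "\<dots> \<le> (1 - t) * a ^ Suc n + t * b ^ Suc n"
  proof -
    have "0 \<le> (a - b) * (a ^ n - b ^ n)"
    proof (cases "a \<le> b")
      case True
      then show ?thesis using assms power_mono[of a b n] by (intro mult_nonpos_nonpos) auto
    next
      case False
      then show ?thesis using assms power_mono[of b a n] by (intro mult_nonneg_nonneg) auto
    qed
    then have "0 \<le> t * (1 - t) * ((a - b) * (a ^ n - b ^ n))"
      using assms by (intro mult_nonneg_nonneg[OF mult_nonneg_nonneg]) auto
    then show ?thesis by linarith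
  qed
  finally show ?case by (simp add: c_def)
qed simp

lemma cosh_sqrt_sums: "0 \<le> s \<Longrightarrow> (\<lambda>n. s ^ n / fact (2 * n)) sums cosh (sqrt s)"
proof -
  assume s: "0 \<le> s"
  have "(\<lambda>n. if even (2 * n) then sqrt s ^ (2 * n) /\<^sub>R fact (2 * n) else 0) sums cosh (sqrt s)"
    by (subst sums_mono_reindex[of "\<lambda>n. 2 * n" "\<lambda>n. if even n then sqrt s ^ n /\<^sub>R fact n else 0"])
      (auto intro: strict_monoI cosh_converges elim!: evenE)
  moreover have "sqrt s ^ (2 * n) = s ^ n" for n using s by (simp add: power_mult)
  ultimately show ?thesis by (simp add: divide_inverse mult.commute)
qed

text \<open>
  The function \<open>\<lambda>s. cosh (sqrt s)\<close> is convex on the half-line, because its power series has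
  nonnegative coefficients.
\<close>

lemma cosh_sqrt_chord_le:
  assumes "0 \<le> a" "0 \<le> b" "0 \<le> t" "t \<le> 1"
  shows "cosh (sqrt ((1 - t) * a + t * b)) \<le> (1 - t) * cosh (sqrt a) + t * cosh (sqrt b)"
proof (rule sums_le)
  show "(\<lambda>n. ((1 - t) * a + t * b) ^ n / fact (2 * n)) sums cosh (sqrt ((1 - t) * a + t * b))"
    using assms by (intro cosh_sqrt_sums) auto
  show "(\<lambda>n. (1 - t) * (a ^ n / fact (2 * n)) + t * (b ^ n / fact (2 * n)))
      sums ((1 - t) * cosh (sqrt a) + t * cosh (sqrt b))"
    using assms by (intro sums_add sums_mult cosh_sqrt_sums) auto
  show "((1 - t) * a + t * b) ^ n / fact (2 * n)
      \<le> (1 - t) * (a ^ n / fact (2 * n)) + t * (b ^ n / fact (2 * n))" for n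
    using divide_right_mono[OF power_chord_le[OF assms, of n], of "fact (2 * n)"]
    by (simp add: add_divide_distrib)
qed

lemma sinh_ge_self: "0 \<le> s \<Longrightarrow> s \<le> sinh (s :: real)"
  using real_le_x_sinh[of s] by (simp add: sinh_field_def exp_minus)

text \<open>
  When the norms of \<open>x\<close> and \<open>v\<close> are fixed, the left-hand side is a convex function of their inner
  product \<open>w\<close> and the right-hand side is affine in \<open>w\<close>. It therefore suffices to compare both sides
  for collinear vectors, where the left-hand side is \<open>cosh (r \<plusminus> s)\<close>.
\<close>

lemma cosh_L2_set_add_le:
  fixes x v :: "'i \<Rightarrow> real"
  assumes I: "finite I"
  defines "r \<equiv> L2_set x I" and "s \<equiv> L2_set v I"
  shows "cosh (L2_set (\<lambda>i. x i + v i) I)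
    \<le> cosh r * (exp s - s) + sinh r / r * (\<Sum>i\<in>I. x i * v i)"
proof -
  define w where "w = (\<Sum>i\<in>I. x i * v i)"
  have rs: "0 \<le> r" "0 \<le> s" by (auto simp: r_def s_def)
  have w: "\<bar>w\<bar> \<le> r * s" unfolding w_def r_def s_def by (rule abs_sum_mult_le_L2_set)
  have es: "exp s = cosh s + sinh s" by (simp add: cosh_plus_sinh)
  have sq: "L2_set (\<lambda>i. x i + v i) I = sqrt (r\<^sup>2 + 2 * w + s\<^sup>2)"
    unfolding L2_set_def r_def s_def w_def
    by (simp add: sum_nonneg power2_sum sum.distrib sum_distrib_left algebra_simps)
  show ?thesis
  proof (cases "r * s = 0")
    case True
    then have w0: "w = 0" using w by (metis abs_le_zero_iff)
    have sh: "0 \<le> sinh s - s" using sinh_ge_self[OF rs(2)] by simp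
    have "cosh (sqrt (r\<^sup>2 + s\<^sup>2)) = cosh r * cosh s"
      using True rs by auto
    also have "\<dots> \<le> cosh r * (exp s - s)"
      using sh unfolding es by (intro mult_left_mono) auto
    finally show ?thesis unfolding sq using w0 by (simp add: w_def)
  next
    case False
    then have pos: "0 < r" "0 < s" using rs by auto
    define c where "c = w / (r * s)"
    have c: "\<bar>c\<bar> \<le> 1" using w pos by (simp add: c_def abs_mult)
    have wc: "w = c * (r * s)" using pos by (simp add: c_def)
    have "r\<^sup>2 + 2 * w + s\<^sup>2 = (1 - (1 + c) / 2) * (r - s)\<^sup>2 + (1 + c) / 2 * (r + s)\<^sup>2"
      unfolding wc by (simp add: field_simps power2_eq_square)
    then have "cosh (L2_set (\<lambda>i. x i + v i) I)
        \<le> (1 - (1 + c) / 2) * cosh (sqrt ((r - s)\<^sup>2)) + (1 + c) / 2 * cosh (sqrt ((r + s)\<^sup>2))"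
      unfolding sq using c by (simp only:) (intro cosh_sqrt_chord_le, auto simp: abs_le_iff)
    also have "cosh (sqrt ((r - s)\<^sup>2)) = cosh (r - s)"
      by (simp add: cosh_real_abs)
    also have "cosh (sqrt ((r + s)\<^sup>2)) = cosh (r + s)" using pos by simp
    also have "(1 - (1 + c) / 2) * cosh (r - s) + (1 + c) / 2 * cosh (r + s)
        = cosh r * cosh s + c * (sinh r * sinh s)"
      unfolding cosh_add cosh_diff by (simp add: field_simps)
    also have "\<dots> = cosh r * (exp s - s) + sinh r / r * w - (sinh s - s) * (cosh r - c * sinh r)"
      unfolding es wc using pos by (simp add: field_simps)
    also have "\<dots> \<le> cosh r * (exp s - s) + sinh r / r * w"
    proof -
      have "\<bar>c * sinh r\<bar> \<le> 1 * sinh r" using c pos unfolding abs_mult by (intro mult_mono) auto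
      moreover have "sinh r \<le> cosh r" using cosh_minus_sinh[of r] exp_ge_zero[of "- r"] by linarith
      ultimately have "0 \<le> cosh r - c * sinh r" by linarith
      moreover have "0 \<le> sinh s - s" using sinh_ge_self[OF rs(2)] by simp
      ultimately have "0 \<le> (sinh s - s) * (cosh r - c * sinh r)" by (intro mult_nonneg_nonneg)
      then show ?thesis by linarith
    qed
    finally show ?thesis by (simp add: w_def)
  qed
qed

text \<open>
  The norm of an integral is at most the integral of the norm: pair the integrand with the value
  of the integral and apply the inequality of Cauchy and Schwarz pointwise.
\<close>

lemma L2_set_integral_le:
  fixes f :: "'a \<Rightarrow> 'i \<Rightarrow> real"
  assumes I: "finite I" and f: "\<And>l. l \<in> I \<Longrightarrow> integrable Q (\<lambda>u. f u l)" and h: "integrable Q h"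
    and le: "AE u in Q. L2_set (f u) I \<le> h u"
  shows "L2_set (\<lambda>l. \<integral>u. f u l \<partial>Q) I \<le> (\<integral>u. h u \<partial>Q)"
proof -
  define a where "a = (\<lambda>l. \<integral>u. f u l \<partial>Q)"
  define N where "N = L2_set a I"
  have N0: "0 \<le> N" by (simp add: N_def)
  have "N * N = (\<Sum>l\<in>I. a l * a l)"
    using N0 by (simp add: N_def L2_set_def sum_nonneg power2_eq_square)
  also have "\<dots> = (\<integral>u. (\<Sum>l\<in>I. a l * f u l) \<partial>Q)"
    using f by (subst Bochner_Integration.integral_sum) (auto simp: a_def)
  also have "\<dots> \<le> (\<integral>u. N * h u \<partial>Q)"
  proof (rule integral_mono_AE)
    show "AE u in Q. (\<Sum>l\<in>I. a l * f u l) \<le> N * h u"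
      using le
    proof eventually_elim
      case (elim u)
      have "(\<Sum>l\<in>I. a l * f u l) \<le> N * L2_set (f u) I"
        unfolding N_def by (rule abs_le_D1[OF abs_sum_mult_le_L2_set])
      also have "\<dots> \<le> N * h u" using elim N0 by (rule mult_left_mono)
      finally show ?case .
    qed
  qed (use f h in auto)
  finally have "N * N \<le> N * (\<integral>u. h u \<partial>Q)" by simp
  moreover have "0 \<le> (\<integral>u. h u \<partial>Q)"
    using le by (intro integral_nonneg_AE) (auto elim!: eventually_mono intro: order_trans[OF L2_set_nonneg])
  ultimately show ?thesis using N0 unfolding N_def[symmetric] a_def[symmetric]
    by (cases "N = 0") auto
qed

lemma L2_set_sum_le:
  assumes "finite J" "\<And>i. i \<in> J \<Longrightarrow> L2_set (f i) I \<le> b"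
  shows "L2_set (\<lambda>l. \<Sum>i\<in>J. f i l) I \<le> real (card J) * b"
  using assms
proof (induction J rule: finite_induct)
  case (insert i J)
  have "L2_set (\<lambda>l. \<Sum>i\<in>insert i J. f i l) I \<le> L2_set (f i) I + L2_set (\<lambda>l. \<Sum>i\<in>J. f i l) I"
    using insert L2_set_triangle_ineq[of "f i" "\<lambda>l. \<Sum>i\<in>J. f i l" I] by simp
  also have "\<dots> \<le> b + real (card J) * b" using insert by (intro add_mono) auto
  finally show ?case using insert by (simp add: algebra_simps)
qed (simp add: L2_set_def)

lemma ex_maximal_separated:
  fixes \<rho> :: "'c \<Rightarrow> 'c \<Rightarrow> real"
  assumes F: "finite F" and sym: "\<And>c c'. \<rho> c c' = \<rho> c' c"
  shows "\<exists>G\<subseteq>F. (\<forall>c\<in>G. \<forall>c'\<in>G. c \<noteq> c' \<longrightarrow> \<epsilon> \<le> \<rho> c c') \<and> (\<forall>a\<in>F. \<exists>b\<in>G. a = b \<or> \<rho> a b < \<epsilon>)"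
proof -
  define sep where "sep = (\<lambda>G. G \<subseteq> F \<and> (\<forall>c\<in>G. \<forall>c'\<in>G. c \<noteq> c' \<longrightarrow> \<epsilon> \<le> \<rho> c c'))"
  have "sep {}" by (simp add: sep_def)
  moreover have "\<forall>G. sep G \<longrightarrow> card G < Suc (card F)"
    using F by (auto simp: sep_def less_Suc_eq_le intro: card_mono)
  ultimately have "\<exists>G. sep G \<and> (\<forall>G'. sep G' \<longrightarrow> card G' \<le> card G)"
    by (rule ex_has_greatest_nat)
  then obtain G where G: "sep G" "\<And>G'. sep G' \<Longrightarrow> card G' \<le> card G" by blast
  have "\<exists>b\<in>G. a = b \<or> \<rho> a b < \<epsilon>" if a: "a \<in> F" for a
  proof (rule ccontr)
    assume none: "\<not> ?thesis"
    then have "sep (insert a G)" using G(1) a sym by (auto simp: sep_def not_less)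
    moreover have "a \<notin> G" "finite G" using none G(1) F finite_subset by (auto simp: sep_def)
    ultimately show False using G(2)[of "insert a G"] by simp
  qed
  then show ?thesis using G(1) by (intro exI[of _ G]) (simp add: sep_def)
qed

locale iid_sample = prob_space +
  fixes K :: "'b measure" and \<nu> :: "'b measure" and Y :: "nat \<Rightarrow> 'a \<Rightarrow> 'b" and n :: nat
  assumes indep: "indep_vars (\<lambda>_. K) Y {1..n}"
    and distr_Y: "\<And>i. i \<in> {1..n} \<Longrightarrow> distr M K (Y i) = \<nu>"
    and prob_\<nu>: "prob_space \<nu>" and sets_\<nu> [measurable_cong]: "sets \<nu> = sets K" and n: "1 \<le> n"
begin

lemma Y_measurable: "i \<in> {1..n} \<Longrightarrow> Y i \<in> measurable M K"
  using indep by (simp add: indep_vars_def)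

lemma space_\<nu>: "space \<nu> = space K"
  using sets_\<nu> by (rule sets_eq_imp_space_eq)

lemma expectation_Y:
  fixes f :: "'b \<Rightarrow> real"
  assumes "f \<in> borel_measurable K" "i \<in> {1..n}"
  shows "(\<integral>\<omega>. f (Y i \<omega>) \<partial>M) = (\<integral>y. f y \<partial>\<nu>)"
  using distr_Y[OF assms(2)] integral_distr[OF Y_measurable[OF assms(2)] assms(1)] by simp

lemma integrable_\<nu>_bounded:
  fixes f :: "'b \<Rightarrow> real"
  assumes "f \<in> borel_measurable K" "\<And>y. y \<in> space K \<Longrightarrow> \<bar>f y\<bar> \<le> C"
  shows "integrable \<nu> f"
proof -
  interpret \<nu>: prob_space \<nu> by (rule prob_\<nu>)
  show ?thesis using assms space_\<nu> sets_\<nu>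
    by (intro \<nu>.integrable_const_bound[of _ C]) (auto cong: measurable_cong_sets)
qed

lemma integrable_component:
  fixes g :: "'b \<Rightarrow> 'i \<Rightarrow> real"
  assumes I: "finite I" and g: "\<And>l. l \<in> I \<Longrightarrow> (\<lambda>y. g y l) \<in> borel_measurable K"
    and bound: "\<And>y. y \<in> space K \<Longrightarrow> L2_set (g y) I \<le> b" and l: "l \<in> I"
  shows "integrable \<nu> (\<lambda>y. g y l)"
proof (rule integrable_\<nu>_bounded[OF g[OF l]])
  fix y assume "y \<in> space K"
  moreover have "\<bar>g y l\<bar> \<le> L2_set (g y) I"
    using member_le_L2_set[OF I l, of "\<lambda>l. \<bar>g y l\<bar>"] by (simp add: L2_set_def)
  ultimately show "\<bar>g y l\<bar> \<le> b" using bound by force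
qed

text \<open>
  Pinelis' argument: multiplying out \<open>cosh\<close> of the norm one summand at a time, the term that is
  linear in the new summand has mean zero.
\<close>

lemma expectation_cosh_norm_sum_le:
  fixes g :: "'b \<Rightarrow> 'i \<Rightarrow> real"
  assumes I: "finite I" and g: "\<And>l. l \<in> I \<Longrightarrow> (\<lambda>y. g y l) \<in> borel_measurable K"
    and mean: "\<And>l. l \<in> I \<Longrightarrow> (\<integral>y. g y l \<partial>\<nu>) = 0"
    and bound: "\<And>y. y \<in> space K \<Longrightarrow> L2_set (g y) I \<le> \<beta>"
    and var: "(\<integral>y. (L2_set (g y) I)\<^sup>2 \<partial>\<nu>) \<le> \<sigma>2"
    and t: "0 \<le> t" "t * \<beta> \<le> 1" and J: "J \<subseteq> {1..n}"
  shows "(\<integral>\<omega>. cosh (t * L2_set (\<lambda>l. \<Sum>i\<in>J. g (Y i \<omega>) l) I) \<partial>M) \<le> (1 + t\<^sup>2 * \<sigma>2) ^ card J"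
  using finite_subset[OF J finite_atLeastAtMost] J
proof (induction J rule: finite_induct)
  case empty
  then show ?case by (simp add: prob_space L2_set_def)
next
  case (insert i J)
  have iJ: "i \<in> {1..n}" "J \<subseteq> {1..n}" "finite J" "i \<notin> J" using insert by auto
  define S where "S = (\<lambda>y l. \<Sum>j\<in>J. g (y j) l)"
  define F where "F = (\<lambda>y. cosh (t * L2_set (S y) I))"
  define H where "H = (\<lambda>y. exp (t * L2_set (g y) I) - t * L2_set (g y) I)"
  define A where "A = (\<lambda>l y. sinh (t * L2_set (S y) I) / (t * L2_set (S y) I) * (t * S y l))"
  define YJ where "YJ = (\<lambda>\<omega>. restrict (\<lambda>j. Y j \<omega>) J)"
  have YJ: "YJ \<in> measurable M (PiM J (\<lambda>_. K))"
    unfolding YJ_def using iJ Y_measurable by (intro measurable_restrict) auto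
  have Yi: "Y i \<in> measurable M K" using Y_measurable iJ by auto
  have Smeas: "(\<lambda>y. S y l) \<in> borel_measurable (PiM J (\<lambda>_. K))" if "l \<in> I" for l
    unfolding S_def using g[OF that]
    by (intro borel_measurable_sum measurable_compose[OF measurable_component_singleton]) auto
  have normS: "(\<lambda>y. L2_set (S y) I) \<in> borel_measurable (PiM J (\<lambda>_. K))"
    unfolding L2_set_def using Smeas by measurable
  have normg: "(\<lambda>y. L2_set (g y) I) \<in> borel_measurable K"
    unfolding L2_set_def using g by measurable
  have Fm: "F \<in> borel_measurable (PiM J (\<lambda>_. K))"
    unfolding F_def cosh_field_def using normS by measurable
  have Hm: "H \<in> borel_measurable K" unfolding H_def using normg by measurable
  have Am: "A l \<in> borel_measurable (PiM J (\<lambda>_. K))" if "l \<in> I" for l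
    unfolding A_def sinh_field_def using normS Smeas[OF that] by measurable
  define m where "m = t * (real (card J) * \<beta>)"
  have YK: "Y j \<omega> \<in> space K" if "j \<in> {1..n}" "\<omega> \<in> space M" for j \<omega>
    using measurable_space[OF Y_measurable] that by auto
  have \<beta>0: "0 \<le> \<beta>"
  proof -
    obtain \<omega> where "\<omega> \<in> space M" using not_empty by auto
    then show ?thesis using order_trans[OF L2_set_nonneg bound[OF YK[OF iJ(1)]]] by blast
  qed
  have SYJ: "S (YJ \<omega>) l = (\<Sum>j\<in>J. g (Y j \<omega>) l)" for \<omega> l
    unfolding S_def YJ_def by (intro sum.cong) auto
  have normS_le: "t * L2_set (S (YJ \<omega>)) I \<le> m" if \<omega>: "\<omega> \<in> space M" for \<omega>
  proof -
    have "L2_set (\<lambda>l. \<Sum>j\<in>J. g (Y j \<omega>) l) I \<le> real (card J) * \<beta>"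
      using iJ bound YK[OF _ \<omega>] by (intro L2_set_sum_le) auto
    then show ?thesis
      unfolding m_def SYJ using t by (intro mult_left_mono) auto
  qed
  have sinh_le_cosh: "sinh t \<le> cosh t" for t :: real
    using cosh_minus_sinh[of t] exp_ge_zero[of "- t"] by linarith
  have Fb: "\<bar>F (YJ \<omega>)\<bar> \<le> cosh m" if "\<omega> \<in> space M" for \<omega>
    unfolding F_def using normS_le[OF that] t \<beta>0 by (simp add: cosh_real_nonneg_le_iff m_def)
  have Ab: "\<bar>A l (YJ \<omega>)\<bar> \<le> cosh m" if "\<omega> \<in> space M" "l \<in> I" for \<omega> l
  proof -
    define r where "r = t * L2_set (S (YJ \<omega>)) I"
    have r: "0 \<le> r" "r \<le> m" using t normS_le[OF that(1)] by (auto simp: r_def)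
    have "\<bar>S (YJ \<omega>) l\<bar> \<le> L2_set (S (YJ \<omega>)) I"
      using member_le_L2_set[OF I that(2), of "\<lambda>l. \<bar>S (YJ \<omega>) l\<bar>"] by (simp add: L2_set_def)
    then have "\<bar>t * S (YJ \<omega>) l\<bar> \<le> r"
      using t unfolding r_def abs_mult by (simp add: mult_left_mono)
    then have "\<bar>A l (YJ \<omega>)\<bar> \<le> sinh r / r * r"
      unfolding A_def r_def[symmetric] abs_mult using r by (intro mult_mono) auto
    also have "\<dots> \<le> cosh r" using sinh_le_cosh[of r] by (cases "r = 0") auto
    also have "\<dots> \<le> cosh m" using r order_trans[OF r] by (simp add: cosh_real_nonneg_le_iff)
    finally show ?thesis .
  qed
  have Hb: "\<bar>H y\<bar> \<le> exp 1 + 1" if "y \<in> space K" for y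
  proof -
    have "t * L2_set (g y) I \<le> t * \<beta>" using bound[OF that] t by (intro mult_left_mono)
    then have "t * L2_set (g y) I \<le> 1" "0 \<le> t * L2_set (g y) I" using t by auto
    then show ?thesis unfolding H_def using exp_le_cancel_iff[of "t * L2_set (g y) I" 1] exp_gt_zero
      by (smt (verit))
  qed
  have gb: "\<bar>g y l\<bar> \<le> \<beta>" if "y \<in> space K" "l \<in> I" for y l
  proof -
    have "\<bar>g y l\<bar> \<le> L2_set (g y) I"
      using member_le_L2_set[OF I that(2), of "\<lambda>l. \<bar>g y l\<bar>"] by (simp add: L2_set_def)
    then show ?thesis using bound[OF that(1)] by linarith
  qed
  have ind: "indep_var borel (\<lambda>\<omega>. f1 (YJ \<omega>)) borel (\<lambda>\<omega>. f2 (Y i \<omega>))"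
    if "f1 \<in> borel_measurable (PiM J (\<lambda>_. K))" "f2 \<in> borel_measurable K"
    for f1 :: "(nat \<Rightarrow> 'b) \<Rightarrow> real" and f2 :: "'b \<Rightarrow> real"
  proof -
    have pair: "indep_var (PiM J (\<lambda>_. K)) YJ (PiM {i} (\<lambda>_. K)) (\<lambda>\<omega>. restrict (\<lambda>j. Y j \<omega>) {i})"
      unfolding YJ_def using iJ by (intro indep_var_restrict[OF indep]) auto
    have f2: "(\<lambda>y. f2 (y i)) \<in> borel_measurable (PiM {i} (\<lambda>_. K))"
      using that(2) by (intro measurable_compose[OF measurable_component_singleton]) auto
    show ?thesis using indep_var_compose[OF pair that(1) f2] by (simp add: comp_def)
  qed
  have int: "integrable M (\<lambda>\<omega>. f1 (YJ \<omega>))"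
    if "f1 \<in> borel_measurable (PiM J (\<lambda>_. K))" "\<And>\<omega>. \<omega> \<in> space M \<Longrightarrow> \<bar>f1 (YJ \<omega>)\<bar> \<le> C"
    for f1 :: "(nat \<Rightarrow> 'b) \<Rightarrow> real" and C
    using that measurable_compose[OF YJ that(1)] by (intro integrable_const_bound[of _ C]) auto
  have int2: "integrable M (\<lambda>\<omega>. f2 (Y i \<omega>))"
    if "f2 \<in> borel_measurable K" "\<And>y. y \<in> space K \<Longrightarrow> \<bar>f2 y\<bar> \<le> C"
    for f2 :: "'b \<Rightarrow> real" and C
    using that measurable_compose[OF Yi that(1)] measurable_space[OF Yi]
    by (intro integrable_const_bound[of _ C]) auto
  have FH: "integrable M (\<lambda>\<omega>. F (YJ \<omega>) * H (Y i \<omega>))"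
    "(\<integral>\<omega>. F (YJ \<omega>) * H (Y i \<omega>) \<partial>M) = (\<integral>\<omega>. F (YJ \<omega>) \<partial>M) * (\<integral>\<omega>. H (Y i \<omega>) \<partial>M)"
    using indep_var_integrable[OF ind[OF Fm Hm] int[OF Fm Fb] int2[OF Hm Hb]]
      indep_var_lebesgue_integral[OF ind[OF Fm Hm] int[OF Fm Fb] int2[OF Hm Hb]] by auto
  have Ag: "integrable M (\<lambda>\<omega>. A l (YJ \<omega>) * g (Y i \<omega>) l)"
    "(\<integral>\<omega>. A l (YJ \<omega>) * g (Y i \<omega>) l \<partial>M) = 0" if l: "l \<in> I" for l
  proof -
    note hyps = ind[OF Am[OF l] g[OF l]] int[OF Am[OF l] Ab[OF _ l]] int2[OF g[OF l] gb[OF _ l]]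
    show "integrable M (\<lambda>\<omega>. A l (YJ \<omega>) * g (Y i \<omega>) l)" using indep_var_integrable[OF hyps] by auto
    show "(\<integral>\<omega>. A l (YJ \<omega>) * g (Y i \<omega>) l \<partial>M) = 0"
      using indep_var_lebesgue_integral[OF hyps] expectation_Y[OF g[OF l] iJ(1)] mean[OF l] by simp
  qed
  have pw: "cosh (t * L2_set (\<lambda>l. \<Sum>j\<in>insert i J. g (Y j \<omega>) l) I)
      \<le> F (YJ \<omega>) * H (Y i \<omega>) + t * (\<Sum>l\<in>I. A l (YJ \<omega>) * g (Y i \<omega>) l)" for \<omega>
  proof -
    have "t * L2_set (\<lambda>l. \<Sum>j\<in>insert i J. g (Y j \<omega>) l) I
        = L2_set (\<lambda>l. t * S (YJ \<omega>) l + t * g (Y i \<omega>) l) I"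
      using iJ t by (simp add: L2_set_right_distrib SYJ algebra_simps)
    moreover have "L2_set (\<lambda>l. t * f l) I = t * L2_set f I" for f
      using t by (simp add: L2_set_right_distrib)
    moreover have "sinh r / r * (\<Sum>l\<in>I. t * S (YJ \<omega>) l * (t * g (Y i \<omega>) l))
        = t * (\<Sum>l\<in>I. sinh r / r * (t * S (YJ \<omega>) l) * g (Y i \<omega>) l)" for r
      unfolding sum_distrib_left by (intro sum.cong refl) (simp only: mult_ac)
    ultimately show ?thesis
      using cosh_L2_set_add_le[OF I, of "\<lambda>l. t * S (YJ \<omega>) l" "\<lambda>l. t * g (Y i \<omega>) l"]
      unfolding F_def H_def A_def by (simp only:)
  qed
  have intR: "integrable M (\<lambda>\<omega>. F (YJ \<omega>) * H (Y i \<omega>) + t * (\<Sum>l\<in>I. A l (YJ \<omega>) * g (Y i \<omega>) l))"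
    using FH Ag by auto
  have "(\<integral>\<omega>. cosh (t * L2_set (\<lambda>l. \<Sum>j\<in>insert i J. g (Y j \<omega>) l) I) \<partial>M)
      \<le> (\<integral>\<omega>. F (YJ \<omega>) * H (Y i \<omega>) + t * (\<Sum>l\<in>I. A l (YJ \<omega>) * g (Y i \<omega>) l) \<partial>M)"
    by (intro integral_mono' intR pw order_trans[OF _ pw] cosh_real_nonneg)
  also have "\<dots> = (\<integral>\<omega>. F (YJ \<omega>) \<partial>M) * (\<integral>\<omega>. H (Y i \<omega>) \<partial>M)"
    using FH Ag by (subst Bochner_Integration.integral_add) auto
  also have "\<dots> \<le> (1 + t\<^sup>2 * \<sigma>2) ^ card J * (1 + t\<^sup>2 * \<sigma>2)"
  proof (intro mult_mono)
    show "(\<integral>\<omega>. F (YJ \<omega>) \<partial>M) \<le> (1 + t\<^sup>2 * \<sigma>2) ^ card J"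
      using insert.IH iJ unfolding F_def SYJ by simp
    have "(\<integral>\<omega>. H (Y i \<omega>) \<partial>M) = (\<integral>y. H y \<partial>\<nu>)" by (rule expectation_Y[OF Hm iJ(1)])
    also have "\<dots> \<le> (\<integral>y. 1 + t\<^sup>2 * (L2_set (g y) I)\<^sup>2 \<partial>\<nu>)"
    proof (rule integral_mono)
      show "integrable \<nu> H" using Hm Hb by (rule integrable_\<nu>_bounded)
      show "integrable \<nu> (\<lambda>y. 1 + t\<^sup>2 * (L2_set (g y) I)\<^sup>2)"
      proof (rule integrable_\<nu>_bounded)
        show "(\<lambda>y. 1 + t\<^sup>2 * (L2_set (g y) I)\<^sup>2) \<in> borel_measurable K" using normg by measurable
        fix y assume "y \<in> space K"
        then have "(L2_set (g y) I)\<^sup>2 \<le> \<beta>\<^sup>2" using bound by (intro power_mono) auto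
        then have "t\<^sup>2 * (L2_set (g y) I)\<^sup>2 \<le> t\<^sup>2 * \<beta>\<^sup>2" by (intro mult_left_mono) auto
        then show "\<bar>1 + t\<^sup>2 * (L2_set (g y) I)\<^sup>2\<bar> \<le> 1 + t\<^sup>2 * \<beta>\<^sup>2" by simp
      qed
      fix y assume "y \<in> space \<nu>"
      then have y: "y \<in> space K" by (simp add: space_\<nu>)
      have "t * L2_set (g y) I \<le> t * \<beta>" using bound[OF y] t by (intro mult_left_mono)
      then show "H y \<le> 1 + t\<^sup>2 * (L2_set (g y) I)\<^sup>2"
        unfolding H_def using t exp_bound[of "t * L2_set (g y) I"] by (simp add: power_mult_distrib)
    qed
    also have "\<dots> \<le> 1 + t\<^sup>2 * \<sigma>2"
    proof -
      interpret \<nu>: prob_space \<nu> by (rule prob_\<nu>)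
      have "integrable \<nu> (\<lambda>y. (L2_set (g y) I)\<^sup>2)"
      proof (rule integrable_\<nu>_bounded)
        fix y assume "y \<in> space K"
        then show "\<bar>(L2_set (g y) I)\<^sup>2\<bar> \<le> \<beta>\<^sup>2" using bound by (auto intro: power_mono)
      qed (use normg in measurable)
      then show ?thesis using var by (simp add: \<nu>.prob_space mult_left_mono)
    qed
    finally show "(\<integral>\<omega>. H (Y i \<omega>) \<partial>M) \<le> 1 + t\<^sup>2 * \<sigma>2" .
    have "0 \<le> (\<integral>y. (L2_set (g y) I)\<^sup>2 \<partial>\<nu>)" by (intro integral_nonneg_AE) auto
    then have "0 \<le> \<sigma>2" using var by linarith
    then show "0 \<le> (1 + t\<^sup>2 * \<sigma>2) ^ card J" by simp
    show "0 \<le> (\<integral>\<omega>. H (Y i \<omega>) \<partial>M)"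
      unfolding H_def using exp_ge_add_one_self
      by (intro integral_nonneg_AE AE_I2) (smt (verit))
  qed
  finally show ?case using iJ by (simp add: mult.commute)
qed

definition deviation :: "'i set \<Rightarrow> ('b \<Rightarrow> 'i \<Rightarrow> real) \<Rightarrow> 'a \<Rightarrow> real" where
  "deviation I g \<omega> = L2_set (\<lambda>l. (\<Sum>i=1..n. g (Y i \<omega>) l) - real n * (\<integral>y. g y l \<partial>\<nu>)) I"

lemma deviation_measurable:
  assumes "\<And>l. l \<in> I \<Longrightarrow> (\<lambda>y. g y l) \<in> borel_measurable K"
  shows "deviation I g \<in> borel_measurable M"
proof -
  have "(\<lambda>\<omega>. \<Sum>l\<in>I. ((\<Sum>i=1..n. g (Y i \<omega>) l) - real n * (\<integral>y. g y l \<partial>\<nu>))\<^sup>2) \<in> borel_measurable M"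
    using measurable_compose[OF Y_measurable assms]
    by (intro borel_measurable_sum borel_measurable_power borel_measurable_diff borel_measurable_const)
  then show ?thesis unfolding deviation_def[abs_def] L2_set_def by measurable
qed

lemma L2_set_integral_le_bound:
  assumes I: "finite I" and g: "\<And>l. l \<in> I \<Longrightarrow> (\<lambda>y. g y l) \<in> borel_measurable K"
    and bound: "\<And>y. y \<in> space K \<Longrightarrow> L2_set (g y) I \<le> b"
  shows "L2_set (\<lambda>l. \<integral>y. g y l \<partial>\<nu>) I \<le> b"
proof -
  interpret \<nu>: prob_space \<nu> by (rule prob_\<nu>)
  have "L2_set (\<lambda>l. \<integral>y. g y l \<partial>\<nu>) I \<le> (\<integral>y. b \<partial>\<nu>)"
    using bound integrable_component[OF I g bound]
    by (intro L2_set_integral_le I AE_I2) (auto simp: space_\<nu>)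
  then show ?thesis by (simp add: \<nu>.prob_space)
qed

lemma deviation_le:
  fixes g :: "'b \<Rightarrow> 'i \<Rightarrow> real"
  assumes I: "finite I" and g: "\<And>l. l \<in> I \<Longrightarrow> (\<lambda>y. g y l) \<in> borel_measurable K"
    and bound: "\<And>y. y \<in> space K \<Longrightarrow> L2_set (g y) I \<le> b" and \<omega>: "\<omega> \<in> space M"
  shows "deviation I g \<omega> \<le> 2 * real n * b"
proof -
  have "L2_set (\<lambda>l. \<Sum>i=1..n. g (Y i \<omega>) l) I \<le> real (card {1..n}) * b"
    using bound measurable_space[OF Y_measurable \<omega>] by (intro L2_set_sum_le) auto
  then have "L2_set (\<lambda>l. \<Sum>i=1..n. g (Y i \<omega>) l) I \<le> real n * b" by simp
  moreover have "L2_set (\<lambda>l. - (real n * (\<integral>y. g y l \<partial>\<nu>))) I = real n * L2_set (\<lambda>l. \<integral>y. g y l \<partial>\<nu>) I"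
    by (simp add: L2_set_right_distrib L2_set_def power_mult_distrib real_sqrt_mult sum_distrib_left[symmetric])
  moreover have "\<dots> \<le> real n * b"
    using L2_set_integral_le_bound[OF I g bound] by (intro mult_left_mono) auto
  ultimately show ?thesis unfolding deviation_def
    using L2_set_triangle_ineq[of "\<lambda>l. \<Sum>i=1..n. g (Y i \<omega>) l" "\<lambda>l. - (real n * (\<integral>y. g y l \<partial>\<nu>))" I]
    by simp
qed

text \<open>
  Markov's inequality for the hyperbolic cosine of the deviation. Centring may double the norm of
  the statistic, hence the factor \<open>2\<close> in the condition on \<open>t\<close>, but does not increase its second
  moment.
\<close>

lemma prob_deviation_gt_le:
  fixes g :: "'b \<Rightarrow> 'i \<Rightarrow> real"
  assumes I: "finite I" and g: "\<And>l. l \<in> I \<Longrightarrow> (\<lambda>y. g y l) \<in> borel_measurable K"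
    and bound: "\<And>y. y \<in> space K \<Longrightarrow> L2_set (g y) I \<le> b"
    and var: "(\<integral>y. (L2_set (g y) I)\<^sup>2 \<partial>\<nu>) \<le> \<sigma>2"
    and t: "0 \<le> t" "2 * b * t \<le> 1"
  shows "prob {\<omega> \<in> space M. \<tau> < deviation I g \<omega>} \<le> 2 * exp (real n * t\<^sup>2 * \<sigma>2 - t * \<tau>)"
proof -
  interpret \<nu>: prob_space \<nu> by (rule prob_\<nu>)
  define e where "e = (\<lambda>l. \<integral>y. g y l \<partial>\<nu>)"
  define h where "h = (\<lambda>y l. g y l - e l)"
  have gint: "integrable \<nu> (\<lambda>y. g y l)" if "l \<in> I" for l
    using integrable_component[OF I g bound that] .
  have normg: "(\<lambda>y. L2_set (g y) I) \<in> borel_measurable K"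
    unfolding L2_set_def using g by measurable
  have sqint: "integrable \<nu> (\<lambda>y. (L2_set (g y) I)\<^sup>2)"
  proof (rule integrable_\<nu>_bounded)
    fix y assume "y \<in> space K"
    then show "\<bar>(L2_set (g y) I)\<^sup>2\<bar> \<le> b\<^sup>2" using bound by (auto intro: power_mono)
  qed (use normg in measurable)
  have hm: "(\<lambda>y. h y l) \<in> borel_measurable K" if "l \<in> I" for l
    unfolding h_def using g[OF that] by measurable
  have hmean: "(\<integral>y. h y l \<partial>\<nu>) = 0" if "l \<in> I" for l
    unfolding h_def using gint[OF that] by (simp add: e_def \<nu>.prob_space)
  have hbound: "L2_set (h y) I \<le> 2 * b" if "y \<in> space K" for y
  proof -
    have "L2_set (h y) I \<le> L2_set (g y) I + L2_set (\<lambda>l. - e l) I"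
      using L2_set_triangle_ineq[of "g y" "\<lambda>l. - e l" I] by (simp add: h_def)
    also have "L2_set (\<lambda>l. - e l) I = L2_set e I" by (simp add: L2_set_def)
    finally show ?thesis
      using bound[OF that] L2_set_integral_le_bound[OF I g bound] by (simp add: e_def)
  qed
  have hvar: "(\<integral>y. (L2_set (h y) I)\<^sup>2 \<partial>\<nu>) \<le> \<sigma>2"
  proof -
    have "(L2_set (h y) I)\<^sup>2 = (L2_set (g y) I)\<^sup>2 - (\<Sum>l\<in>I. 2 * e l * g y l) + (\<Sum>l\<in>I. (e l)\<^sup>2)" for y
    proof -
      have sq: "(L2_set f I)\<^sup>2 = (\<Sum>l\<in>I. (f l)\<^sup>2)" for f by (simp add: L2_set_def sum_nonneg)
      have "(L2_set (h y) I)\<^sup>2 = (\<Sum>l\<in>I. (g y l)\<^sup>2 - 2 * e l * g y l + (e l)\<^sup>2)"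
        unfolding sq by (simp add: h_def power2_diff algebra_simps)
      then show ?thesis unfolding sq[of "g y"] by (simp only: sum.distrib sum_subtractf)
    qed
    then have "(\<integral>y. (L2_set (h y) I)\<^sup>2 \<partial>\<nu>)
        = (\<integral>y. (L2_set (g y) I)\<^sup>2 - (\<Sum>l\<in>I. 2 * e l * g y l) + (\<Sum>l\<in>I. (e l)\<^sup>2) \<partial>\<nu>)" by simp
    also have "\<dots> = (\<integral>y. (L2_set (g y) I)\<^sup>2 \<partial>\<nu>) - (\<Sum>l\<in>I. 2 * e l * e l) + (\<Sum>l\<in>I. (e l)\<^sup>2)"
    proof -
      have "integrable \<nu> (\<lambda>y. \<Sum>l\<in>I. 2 * e l * g y l)" using gint by auto
      moreover have "(\<integral>y. (\<Sum>l\<in>I. 2 * e l * g y l) \<partial>\<nu>) = (\<Sum>l\<in>I. 2 * e l * e l)"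
        using gint by (subst Bochner_Integration.integral_sum) (auto simp: e_def)
      ultimately show ?thesis using sqint by (simp add: \<nu>.prob_space)
    qed
    also have "\<dots> = (\<integral>y. (L2_set (g y) I)\<^sup>2 \<partial>\<nu>) - (\<Sum>l\<in>I. (e l)\<^sup>2)"
      by (simp add: power2_eq_square sum_subtractf[symmetric] mult.assoc sum_distrib_left[symmetric])
    finally show ?thesis using var sum_nonneg[of I "\<lambda>l. (e l)\<^sup>2"] by simp
  qed
  have dev: "deviation I g \<omega> = L2_set (\<lambda>l. \<Sum>i\<in>{1..n}. h (Y i \<omega>) l) I" for \<omega>
    by (simp add: deviation_def h_def sum_subtractf e_def)
  define f where "f = (\<lambda>\<omega>. cosh (t * deviation I g \<omega>))"
  have fm: "f \<in> borel_measurable M"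
    unfolding f_def cosh_field_def using deviation_measurable[OF g] by measurable
  have "(\<integral>\<omega>. f \<omega> \<partial>M) \<le> (1 + t\<^sup>2 * \<sigma>2) ^ n"
    unfolding f_def dev
    using expectation_cosh_norm_sum_le[OF I hm hmean hbound hvar t(1) _ subset_refl] t(2)
    by (simp add: mult_ac)
  also have "\<dots> \<le> exp (t\<^sup>2 * \<sigma>2) ^ n"
  proof (intro power_mono)
    show "1 + t\<^sup>2 * \<sigma>2 \<le> exp (t\<^sup>2 * \<sigma>2)" by (rule exp_ge_add_one_self)
    have "0 \<le> (\<integral>y. (L2_set (g y) I)\<^sup>2 \<partial>\<nu>)" by (intro integral_nonneg_AE) auto
    then have "0 \<le> \<sigma>2" using var by linarith
    then show "0 \<le> 1 + t\<^sup>2 * \<sigma>2" by simp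
  qed
  finally have Ef: "(\<integral>\<omega>. f \<omega> \<partial>M) \<le> exp (real n * (t\<^sup>2 * \<sigma>2))" by (simp add: exp_of_nat_mult)
  have devb: "deviation I g \<omega> \<le> real n * (2 * b)" if "\<omega> \<in> space M" for \<omega>
    using deviation_le[OF I g bound that] by simp
  have fint: "integrable M f"
  proof (intro integrable_const_bound[of _ "cosh (t * (real n * (2 * b)))"] AE_I2 fm)
    fix \<omega> assume \<omega>: "\<omega> \<in> space M"
    have "0 \<le> t * deviation I g \<omega>" "t * deviation I g \<omega> \<le> t * (real n * (2 * b))"
      using t devb[OF \<omega>] by (auto simp: deviation_def intro: mult_left_mono)
    moreover from order_trans[OF this] have "0 \<le> t * (real n * (2 * b))" .
    ultimately show "norm (f \<omega>) \<le> cosh (t * (real n * (2 * b)))"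
      unfolding f_def real_norm_def abs_of_nonneg[OF cosh_real_nonneg] by (subst cosh_real_nonneg_le_iff)
  qed
  have "prob {\<omega> \<in> space M. \<tau> < deviation I g \<omega>} \<le> prob {\<omega> \<in> space M. exp (t * \<tau>) / 2 \<le> f \<omega>}"
  proof (intro finite_measure_mono subsetI)
    fix \<omega> assume "\<omega> \<in> {\<omega> \<in> space M. \<tau> < deviation I g \<omega>}"
    then have \<omega>: "\<omega> \<in> space M" "\<tau> \<le> deviation I g \<omega>" by auto
    have "exp (t * \<tau>) \<le> exp (t * deviation I g \<omega>)" using \<omega> t by (auto intro: mult_left_mono)
    also have "\<dots> \<le> 2 * f \<omega>" by (simp add: f_def cosh_field_def)
    finally show "\<omega> \<in> {\<omega> \<in> space M. exp (t * \<tau>) / 2 \<le> f \<omega>}" using \<omega> by simp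
  qed (use fm in measurable)
  also have "\<dots> \<le> (\<integral>\<omega>. f \<omega> \<partial>M) / (exp (t * \<tau>) / 2)"
    using fint by (intro integral_Markov_inequality_measure[of _ _ "{}"]) (auto simp: f_def)
  also have "\<dots> \<le> exp (real n * (t\<^sup>2 * \<sigma>2)) / (exp (t * \<tau>) / 2)"
    using Ef by (intro divide_right_mono) auto
  also have "\<dots> = 2 * exp (real n * t\<^sup>2 * \<sigma>2 - t * \<tau>)" by (simp add: exp_diff mult_ac)
  finally show ?thesis .
qed

text \<open>
  Hoeffding's regime of the previous bound, with the variance estimated by \<open>b\<^sup>2\<close>. The optimal
  parameter \<open>t\<close> is admissible for \<open>\<tau> < 2 n b\<close>, and larger deviations are impossible.
\<close>

lemma prob_deviation_gt_le_subgaussian: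
  fixes g :: "'b \<Rightarrow> 'i \<Rightarrow> real"
  assumes I: "finite I" and g: "\<And>l. l \<in> I \<Longrightarrow> (\<lambda>y. g y l) \<in> borel_measurable K"
    and bound: "\<And>y. y \<in> space K \<Longrightarrow> L2_set (g y) I \<le> b" and b: "0 < b" and \<tau>: "0 \<le> \<tau>"
  shows "prob {\<omega> \<in> space M. \<tau> < deviation I g \<omega>} \<le> 2 * exp (- (3 * \<tau>\<^sup>2 / (16 * real n * b\<^sup>2)))"
proof (cases "\<tau> < 2 * real n * b")
  case False
  then have empty: "{\<omega> \<in> space M. \<tau> < deviation I g \<omega>} = {}"
    using deviation_le[OF I g bound] by fastforce
  show ?thesis unfolding empty by simp
next
  case True
  interpret \<nu>: prob_space \<nu> by (rule prob_\<nu>)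
  have normg: "(\<lambda>y. L2_set (g y) I) \<in> borel_measurable K"
    unfolding L2_set_def using g by measurable
  have sq: "(L2_set (g y) I)\<^sup>2 \<le> b\<^sup>2" if "y \<in> space K" for y
    using bound[OF that] by (intro power_mono) auto
  have "integrable \<nu> (\<lambda>y. (L2_set (g y) I)\<^sup>2)"
    using sq normg by (intro integrable_\<nu>_bounded[of _ "b\<^sup>2"]) auto
  then have "(\<integral>y. (L2_set (g y) I)\<^sup>2 \<partial>\<nu>) \<le> (\<integral>y. b\<^sup>2 \<partial>\<nu>)"
    using sq by (intro integral_mono) (auto simp: space_\<nu>)
  then have var: "(\<integral>y. (L2_set (g y) I)\<^sup>2 \<partial>\<nu>) \<le> b\<^sup>2" by (simp add: \<nu>.prob_space)
  define t where "t = \<tau> / (4 * real n * b\<^sup>2)"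
  have nb: "0 < real n" "b \<noteq> 0" using n b by auto
  have "2 * b * t = \<tau> / (2 * real n * b)" using nb by (simp add: t_def power2_eq_square)
  also have "\<dots> \<le> 1" using True nb b by simp
  finally have "2 * b * t \<le> 1" .
  moreover have "0 \<le> t" using \<tau> by (simp add: t_def)
  ultimately have "prob {\<omega> \<in> space M. \<tau> < deviation I g \<omega>} \<le> 2 * exp (real n * t\<^sup>2 * b\<^sup>2 - t * \<tau>)"
    using prob_deviation_gt_le[OF I g bound var] by blast
  also have "real n * t\<^sup>2 * b\<^sup>2 - t * \<tau> = - (3 * \<tau>\<^sup>2 / (16 * real n * b\<^sup>2))"
    using nb by (simp add: t_def field_simps power2_eq_square)
  finally show ?thesis .
qed

lemma deviation_diff_le:
  fixes g h :: "'b \<Rightarrow> 'i \<Rightarrow> real"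
  assumes g: "\<And>l. l \<in> I \<Longrightarrow> integrable \<nu> (\<lambda>y. g y l)" and h: "\<And>l. l \<in> I \<Longrightarrow> integrable \<nu> (\<lambda>y. h y l)"
  shows "deviation I g \<omega> \<le> deviation I h \<omega> + deviation I (\<lambda>y l. g y l - h y l) \<omega>"
proof -
  have "deviation I g \<omega> = L2_set (\<lambda>l. ((\<Sum>i=1..n. h (Y i \<omega>) l) - real n * (\<integral>y. h y l \<partial>\<nu>))
     + ((\<Sum>i=1..n. g (Y i \<omega>) l - h (Y i \<omega>) l) - real n * (\<integral>y. g y l - h y l \<partial>\<nu>))) I"
    unfolding deviation_def using g h
    by (intro L2_set_cong refl) (simp add: sum_subtractf algebra_simps)
  also have "\<dots> \<le> deviation I h \<omega> + deviation I (\<lambda>y l. g y l - h y l) \<omega>"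
    unfolding deviation_def by (rule L2_set_triangle_ineq)
  finally show ?thesis .
qed

text \<open>
  Comparing with twice the mean, instead of the mean, improves the deviation from the order
  \<open>sqrt n\<close> to a constant.
\<close>

lemma prob_sum_gt_twice_mean_le:
  fixes f :: "'b \<Rightarrow> real"
  assumes f: "f \<in> borel_measurable K" "\<And>y. y \<in> space K \<Longrightarrow> 0 \<le> f y" "\<And>y. y \<in> space K \<Longrightarrow> f y \<le> b"
    and b: "0 < b"
  shows "prob {\<omega> \<in> space M. 2 * real n * (\<integral>y. f y \<partial>\<nu>) + z < (\<Sum>i=1..n. f (Y i \<omega>))} \<le> exp (- (z / b))"
proof -
  interpret \<nu>: prob_space \<nu> by (rule prob_\<nu>)
  define m where "m = (\<integral>y. f y \<partial>\<nu>)"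
  define h where "h = (\<lambda>y. exp (f y / b))"
  have hm: "h \<in> borel_measurable K" unfolding h_def using f by measurable
  have hb: "\<bar>h y\<bar> \<le> exp 1" if "y \<in> space K" for y
    using f(3)[OF that] b by (simp add: h_def)
  have fint: "integrable \<nu> f" using f by (intro integrable_\<nu>_bounded[of _ b]) auto
  have Eh: "(\<integral>y. h y \<partial>\<nu>) \<le> exp (2 * m / b)"
  proof -
    have "(\<integral>y. h y \<partial>\<nu>) \<le> (\<integral>y. 1 + 2 * (f y / b) \<partial>\<nu>)"
    proof (rule integral_mono)
      show "integrable \<nu> h" using hm hb by (rule integrable_\<nu>_bounded)
      show "integrable \<nu> (\<lambda>y. 1 + 2 * (f y / b))" using fint by auto
      fix y assume "y \<in> space \<nu>"
      then have y: "0 \<le> f y / b" "f y / b \<le> 1" using f b by (auto simp: space_\<nu>)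
      have "(f y / b)\<^sup>2 \<le> f y / b" using power_decreasing[of 1 2 "f y / b"] y by simp
      then show "h y \<le> 1 + 2 * (f y / b)" using exp_bound[OF y] by (simp add: h_def)
    qed
    also have "\<dots> = 1 + 2 * m / b" using fint by (simp add: m_def \<nu>.prob_space)
    also have "\<dots> \<le> exp (2 * m / b)" by (rule exp_ge_add_one_self)
    finally show ?thesis .
  qed
  define u where "u = (\<lambda>\<omega>. \<Prod>i\<in>{1..n}. h (Y i \<omega>))"
  have ind: "indep_vars (\<lambda>_. borel) (\<lambda>i \<omega>. h (Y i \<omega>)) {1..n}"
    using hm by (intro indep_vars_compose2[OF indep]) auto
  have hint: "integrable M (\<lambda>\<omega>. h (Y i \<omega>))" if "i \<in> {1..n}" for i
    using measurable_compose[OF Y_measurable[OF that] hm] hb measurable_space[OF Y_measurable[OF that]]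
    by (intro integrable_const_bound[of _ "exp 1"]) auto
  have uint: "integrable M u" unfolding u_def by (intro indep_vars_integrable ind hint) auto
  have u: "u \<omega> = exp ((\<Sum>i=1..n. f (Y i \<omega>)) / b)" for \<omega>
    unfolding u_def h_def sum_divide_distrib by (rule exp_sum[symmetric]) simp
  have "(\<integral>\<omega>. u \<omega> \<partial>M) = (\<Prod>i\<in>{1..n}. \<integral>\<omega>. h (Y i \<omega>) \<partial>M)"
    unfolding u_def by (intro indep_vars_lebesgue_integral ind hint) auto
  also have "\<dots> = (\<integral>y. h y \<partial>\<nu>) ^ n" using expectation_Y[OF hm] by simp
  also have "\<dots> \<le> exp (2 * m / b) ^ n"
    using Eh by (intro power_mono integral_nonneg_AE) (auto simp: h_def)
  finally have Eu: "(\<integral>\<omega>. u \<omega> \<partial>M) \<le> exp (real n * (2 * m / b))"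
    by (simp only: exp_of_nat_mult)
  define C where "C = exp ((2 * real n * m + z) / b)"
  have "prob {\<omega> \<in> space M. 2 * real n * m + z < (\<Sum>i=1..n. f (Y i \<omega>))} \<le> prob {\<omega> \<in> space M. C \<le> u \<omega>}"
  proof (intro finite_measure_mono subsetI)
    show "{\<omega> \<in> space M. C \<le> u \<omega>} \<in> events" using uint by measurable
  qed (use b in \<open>auto simp: u C_def divide_right_mono\<close>)
  also have "\<dots> \<le> (\<integral>\<omega>. u \<omega> \<partial>M) / C"
    by (intro integral_Markov_inequality_measure[of _ _ "{}"] uint AE_I2) (auto simp: C_def u)
  also have "\<dots> \<le> exp (real n * (2 * m / b)) / C" using Eu by (intro divide_right_mono) (auto simp: C_def)
  also have "\<dots> = exp (- (z / b))" unfolding C_def exp_diff[symmetric] using b by (simp add: field_simps)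
  finally show ?thesis by (simp add: m_def)
qed

end


section \<open>Chaining over a finite class\<close>

context iid_sample
begin

text \<open>
  Chaining along a fixed finite set of statistics, in a metric that comes from the law itself.
  Once \<open>n\<close> is large, all links are in the Gaussian regime of Bernstein's inequality.
\<close>

lemma prob_ex_deviation_gt_le_chaining:
  fixes g :: "'c \<Rightarrow> 'b \<Rightarrow> 'i \<Rightarrow> real" and \<rho> :: "'c \<Rightarrow> 'c \<Rightarrow> real"
  assumes I: "finite I" and F: "finite F"
    and g: "\<And>c l. c \<in> F \<Longrightarrow> l \<in> I \<Longrightarrow> (\<lambda>y. g c y l) \<in> borel_measurable K"
    and bound: "\<And>c y. c \<in> F \<Longrightarrow> y \<in> space K \<Longrightarrow> L2_set (g c y) I \<le> b" and b: "0 < b"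
    and var: "\<And>c c'. c \<in> F \<Longrightarrow> c' \<in> F \<Longrightarrow>
      (\<integral>y. (L2_set (\<lambda>l. g c y l - g c' y l) I)\<^sup>2 \<partial>\<nu>) \<le> b\<^sup>2 * \<rho> c c'"
    and sym: "\<And>c c'. \<rho> c c' = \<rho> c' c"
    and pack: "\<And>s G. G \<subseteq> F \<Longrightarrow> (\<And>c c'. c \<in> G \<Longrightarrow> c' \<in> G \<Longrightarrow> c \<noteq> c' \<Longrightarrow> 1 / 4 ^ s \<le> \<rho> c c') \<Longrightarrow>
      ln (real (card G)) \<le> V * real (Suc s)"
    and sep: "\<And>c c'. c \<in> F \<Longrightarrow> c' \<in> F \<Longrightarrow> c \<noteq> c' \<Longrightarrow> 1 / 4 ^ S \<le> \<rho> c c'"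
    and V: "1 \<le> V" and x: "0 \<le> x" and n_ge: "4 * 4 ^ S * ((V + 2) * real (Suc S) + x) \<le> real n"
  shows "prob {\<omega> \<in> space M. \<exists>c\<in>F. 16 * b * sqrt (real n * (3 * V + x)) < deviation I (g c) \<omega>} \<le> exp (- x) / 2"
proof -
  have "\<forall>s. \<exists>G. G \<subseteq> F \<and> (\<forall>c\<in>G. \<forall>c'\<in>G. c \<noteq> c' \<longrightarrow> 1 / 4 ^ s \<le> \<rho> c c') \<and>
      (\<forall>a\<in>F. \<exists>b\<in>G. a = b \<or> \<rho> a b < 1 / 4 ^ s)"
    by (intro allI ex_maximal_separated[OF F sym])
  from choice[OF this] obtain G where
    Gs: "\<forall>s. G s \<subseteq> F \<and> (\<forall>c\<in>G s. \<forall>c'\<in>G s. c \<noteq> c' \<longrightarrow> 1 / 4 ^ s \<le> \<rho> c c') \<and>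
      (\<forall>a\<in>F. \<exists>b\<in>G s. a = b \<or> \<rho> a b < 1 / 4 ^ s)" by (rule exE)
  have G: "G s \<subseteq> F" "c \<in> G s \<Longrightarrow> c' \<in> G s \<Longrightarrow> c \<noteq> c' \<Longrightarrow> 1 / 4 ^ s \<le> \<rho> c c'"
    "a \<in> F \<Longrightarrow> \<exists>b. b \<in> G s \<and> (a = b \<or> \<rho> a b < 1 / 4 ^ s)" for s c c' a
    using spec[OF Gs, of s] by auto
  define \<pi> where "\<pi> = (\<lambda>s a. SOME b. b \<in> G s \<and> (a = b \<or> \<rho> a b < 1 / 4 ^ s))"
  have \<pi>: "\<pi> s a \<in> G s" "a = \<pi> s a \<or> \<rho> a (\<pi> s a) < 1 / 4 ^ s" if "a \<in> F" for s a
    using someI_ex[OF G(3)[OF that, of s]] by (auto simp: \<pi>_def)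
  have finG: "finite (G s)" for s using G(1) F by (rule finite_subset)
  \<comment> \<open>\<open>y s\<close> pays for the entropy at level \<open>s\<close>, for the sum over the levels and for \<open>x\<close>.
      \<open>\<sigma> s\<close> bounds the standard deviation of the links of level \<open>s\<close>, \<open>\<tau> s\<close> is the deviation granted to them.\<close>
  define y where "y = (\<lambda>s. (V + 2) * real (Suc s) + x)"
  define \<sigma> where "\<sigma> = (\<lambda>s. 2 * b / 2 ^ s)"
  define \<tau> where "\<tau> = (\<lambda>s. 2 * \<sigma> s * sqrt (real n * y s))"
  define link where "link = (\<lambda>s a. case s of 0 \<Rightarrow> g a | Suc s' \<Rightarrow> (\<lambda>y l. g a y l - g (\<pi> s' a) y l))"
  define Bad where "Bad = (\<lambda>s. {\<omega> \<in> space M. \<exists>a\<in>G s. \<tau> s < deviation I (link s a) \<omega>})"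
  have n0: "0 < real n" using n by simp
  have \<sigma>0: "0 < \<sigma> s" for s using b by (simp add: \<sigma>_def)
  have y0: "0 < y s" for s using V x by (simp add: y_def add_pos_nonneg)
  have aF: "a \<in> F" if "a \<in> G s" for a s using G(1) that by blast
  have \<pi>F: "\<pi> s a \<in> F" if "a \<in> F" for a s using G(1) \<pi>(1)[OF that] by blast
  have gint: "integrable \<nu> (\<lambda>y. g c y l)" if "c \<in> F" "l \<in> I" for c l
    using that by (intro integrable_component[OF I g bound]) auto
  have lmeas: "(\<lambda>y. link s a y l) \<in> borel_measurable K" if "a \<in> G s" "l \<in> I" for s a l
    using g aF \<pi>F that by (cases s) (auto simp: link_def intro!: borel_measurable_diff)
  have lbound: "L2_set (link s a y) I \<le> 2 * b" if "a \<in> G s" "y \<in> space K" for s a y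
  proof (cases s)
    case 0
    then show ?thesis using bound[OF aF[OF that(1)] that(2)] b by (simp add: link_def)
  next
    case (Suc s')
    have "L2_set (link s a y) I \<le> L2_set (g a y) I + L2_set (\<lambda>l. - g (\<pi> s' a) y l) I"
      using L2_set_triangle_ineq[of "g a y" "\<lambda>l. - g (\<pi> s' a) y l" I] Suc by (simp add: link_def)
    also have "L2_set (\<lambda>l. - g (\<pi> s' a) y l) I = L2_set (g (\<pi> s' a) y) I" by (simp add: L2_set_def)
    finally show ?thesis
      using bound[OF aF[OF that(1)] that(2)] bound[OF \<pi>F[OF aF[OF that(1)]] that(2)] by (metis add_mono mult_2 order_trans)
  qed
  have lvar: "(\<integral>y. (L2_set (link s a y) I)\<^sup>2 \<partial>\<nu>) \<le> (\<sigma> s)\<^sup>2" if a: "a \<in> G s" for s a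
  proof (cases s)
    case 0
    interpret \<nu>: prob_space \<nu> by (rule prob_\<nu>)
    have sq: "(L2_set (g a y) I)\<^sup>2 \<le> b\<^sup>2" if "y \<in> space K" for y
      using bound[OF aF[OF a] that] by (intro power_mono) auto
    have "(\<lambda>y. L2_set (g a y) I) \<in> borel_measurable K"
      unfolding L2_set_def using g[OF aF[OF a]] by measurable
    then have "integrable \<nu> (\<lambda>y. (L2_set (g a y) I)\<^sup>2)"
      using sq by (intro integrable_\<nu>_bounded[of _ "b\<^sup>2"]) auto
    then have "(\<integral>y. (L2_set (g a y) I)\<^sup>2 \<partial>\<nu>) \<le> (\<integral>y. b\<^sup>2 \<partial>\<nu>)"
      using sq by (intro integral_mono) (auto simp: space_\<nu>)
    then have "(\<integral>y. (L2_set (g a y) I)\<^sup>2 \<partial>\<nu>) \<le> b\<^sup>2" by (simp add: \<nu>.prob_space)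
    also have "\<dots> \<le> (\<sigma> s)\<^sup>2" using b 0 by (intro power_mono) (auto simp: \<sigma>_def)
    finally show ?thesis using 0 by (simp add: link_def)
  next
    case (Suc s')
    have \<sigma>2: "(\<sigma> s)\<^sup>2 = b\<^sup>2 * (1 / 4 ^ s')"
      using Suc by (simp add: \<sigma>_def power_divide power_mult_distrib power2_eq_square flip: power_mult_distrib)
    show ?thesis
    proof (cases "a = \<pi> s' a")
      case True
      have "link s a y l = 0" for y l
        unfolding link_def Suc nat.case True[symmetric] by simp
      then have "L2_set (link s a y) I = 0" for y by (simp add: L2_set_def)
      then show ?thesis by simp
    next
      case False
      then have "\<rho> a (\<pi> s' a) \<le> 1 / 4 ^ s'" using \<pi>(2)[OF aF[OF a], of s'] by simp
      then have "b\<^sup>2 * \<rho> a (\<pi> s' a) \<le> b\<^sup>2 * (1 / 4 ^ s')" by (intro mult_left_mono) auto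
      then show ?thesis using var[OF aF[OF a] \<pi>F[OF aF[OF a]], of s'] \<sigma>2 by (simp add: link_def Suc)
    qed
  qed
  have devm: "deviation I (link s a) \<in> borel_measurable M" if "a \<in> G s" for s a
    using lmeas[OF that] by (rule deviation_measurable)
  have Badm: "Bad s \<in> events" for s
    unfolding Bad_def using devm finG by (intro sets.sets_Collect_finite_Ex) auto
  have Bad: "prob (Bad s) \<le> exp (- x) * (2 * (1 / 5) ^ Suc s)" if "s \<le> S" for s
  proof -
    define t where "t = sqrt (y s / real n) / \<sigma> s"
    have t0: "0 \<le> t" using \<sigma>0 y0 n0 by (simp add: t_def less_imp_le)
    have "4 * 4 ^ s * y s \<le> 4 * 4 ^ S * y S"
      using that V x y0[of s] unfolding y_def
      by (intro mult_mono add_mono power_increasing) auto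
    then have "4 * 4 ^ s * y s \<le> real n" using n_ge by (simp add: y_def)
    then have "(2 * b * 2)\<^sup>2 * (y s / real n) \<le> (\<sigma> s)\<^sup>2 * 1"
      using n0 b by (simp add: \<sigma>_def field_simps power2_eq_square flip: power_mult_distrib)
    moreover have "((2 * b * 2) * sqrt (y s / real n))\<^sup>2 = (2 * b * 2)\<^sup>2 * (y s / real n)"
      unfolding power_mult_distrib using y0[of s] by simp
    ultimately have "((2 * b * 2) * sqrt (y s / real n))\<^sup>2 \<le> (\<sigma> s)\<^sup>2" by linarith
    then have "(2 * b * 2) * sqrt (y s / real n) \<le> \<sigma> s"
      by (rule power2_le_imp_le) (use \<sigma>0[of s] in simp)
    then have tb: "2 * (2 * b) * t \<le> 1" using \<sigma>0[of s] by (simp add: t_def field_simps)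
    have t2: "real n * t\<^sup>2 * (\<sigma> s)\<^sup>2 = y s"
      using \<sigma>0[of s] y0[of s] n0 by (simp add: t_def power_divide field_simps)
    have t1: "t * \<tau> s = 2 * y s"
    proof -
      have "sqrt (y s / real n) * sqrt (real n * y s) = y s"
        using y0[of s] n0 by (simp add: real_sqrt_mult[symmetric] del: real_sqrt_mult)
      then show ?thesis using \<sigma>0[of s] by (simp add: t_def \<tau>_def)
    qed
    have "prob (Bad s) = prob (\<Union>a\<in>G s. {\<omega> \<in> space M. \<tau> s < deviation I (link s a) \<omega>})"
      by (intro arg_cong[of _ _ prob]) (auto simp: Bad_def)
    also have "\<dots> \<le> (\<Sum>a\<in>G s. prob {\<omega> \<in> space M. \<tau> s < deviation I (link s a) \<omega>})"
    proof (rule finite_measure_subadditive_finite[OF finG], safe)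
      fix a assume "a \<in> G s"
      then show "{\<omega> \<in> space M. \<tau> s < deviation I (link s a) \<omega>} \<in> events" using devm by measurable
    qed
    also have "\<dots> \<le> (\<Sum>a\<in>G s. 2 * exp (- y s))"
    proof (rule sum_mono)
      fix a assume a: "a \<in> G s"
      show "prob {\<omega> \<in> space M. \<tau> s < deviation I (link s a) \<omega>} \<le> 2 * exp (- y s)"
        using prob_deviation_gt_le[OF I lmeas[OF a] lbound[OF a] lvar[OF a] t0 tb, of "\<tau> s"]
        unfolding t1 t2 by simp
    qed
    also have "\<dots> = real (card (G s)) * (2 * exp (- y s))" by simp
    also have "\<dots> \<le> exp (V * real (Suc s)) * (2 * exp (- y s))"
    proof (intro mult_right_mono)
      show "real (card (G s)) \<le> exp (V * real (Suc s))"
      proof (cases "card (G s) = 0")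
        case False
        have "ln (real (card (G s))) \<le> V * real (Suc s)" by (rule pack[OF G(1) G(2)])
        then show ?thesis using False by (metis exp_le_cancel_iff exp_ln of_nat_0_less_iff neq0_conv)
      qed simp
    qed simp
    also have "\<dots> = exp (- x) * (2 * exp (- 2) ^ Suc s)"
    proof -
      have "exp (- 2) ^ Suc s = exp (real (Suc s) * (- 2))" by (rule exp_of_nat_mult[symmetric])
      moreover have "V * real (Suc s) - y s = - x + real (Suc s) * (- 2)" by (simp add: y_def algebra_simps)
      ultimately show ?thesis by (simp add: exp_add[symmetric] mult.left_commute[of _ 2])
    qed
    also have "\<dots> \<le> exp (- x) * (2 * (1 / 5) ^ Suc s)"
    proof -
      have "5 \<le> exp (2 :: real)" using exp_lower_Taylor_quadratic[of 2] by simp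
      then have "exp (- 2) \<le> (1 / 5 :: real)" by (simp add: exp_minus field_simps)
      then have "exp (- 2) ^ Suc s \<le> (1 / 5 :: real) ^ Suc s" by (intro power_mono) auto
      then show ?thesis by (intro mult_left_mono) auto
    qed
    finally show ?thesis .
  qed
  have sum_\<tau>: "(\<Sum>s\<le>S. \<tau> s) \<le> 16 * b * sqrt (real n * (3 * V + x))"
  proof -
    define w where "w = sqrt (real n * (3 * V + x))"
    have w0: "0 \<le> w" using V x by (simp add: w_def)
    have "\<tau> s \<le> 4 * b * w * (real (Suc s) / 2 ^ s)" for s
    proof -
      have "y s \<le> (3 * V + x) * real (Suc s)"
        using mult_right_mono[of "V + 2" "3 * V" "real (Suc s)"] V x mult_left_mono[of 1 "real (Suc s)" x]
        unfolding y_def distrib_right by simp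
      also have "\<dots> \<le> (3 * V + x) * (real (Suc s))\<^sup>2"
        using V x by (intro mult_left_mono) (auto simp: power2_eq_square)
      finally have "real n * y s \<le> (real n * (3 * V + x)) * (real (Suc s))\<^sup>2"
        using n0 by (simp add: mult.assoc)
      then have "sqrt (real n * y s) \<le> sqrt ((real n * (3 * V + x)) * (real (Suc s))\<^sup>2)" by simp
      also have "\<dots> = w * real (Suc s)" by (simp add: real_sqrt_mult w_def)
      finally have "2 * \<sigma> s * sqrt (real n * y s) \<le> 2 * \<sigma> s * (w * real (Suc s))"
        using \<sigma>0[of s] by (intro mult_left_mono) auto
      then show ?thesis by (simp add: \<tau>_def \<sigma>_def mult_ac)
    qed
    then have "(\<Sum>s\<le>S. \<tau> s) \<le> (\<Sum>s\<le>S. 4 * b * w * (real (Suc s) / 2 ^ s))" by (rule sum_mono)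
    also have "\<dots> = 4 * b * w * (\<Sum>s\<le>S. real (Suc s) / 2 ^ s)" by (rule sum_distrib_left[symmetric])
    also have "(\<Sum>s\<le>S. real (Suc s) / 2 ^ s) = 4 - (real S + 3) / 2 ^ S"
      by (induction S) (auto simp: field_simps)
    also have "4 * b * w * (4 - (real S + 3) / 2 ^ S) \<le> 4 * b * w * 4"
      using b w0 by (intro mult_left_mono) auto
    finally show ?thesis by (simp add: w_def)
  qed
  have chain: "deviation I (g a) \<omega> \<le> (\<Sum>s\<le>m. \<tau> s)"
    if \<omega>: "\<omega> \<in> space M" "\<And>s. s \<le> m \<Longrightarrow> \<omega> \<notin> Bad s" and "a \<in> G m" for m a \<omega>
    using that
  proof (induction m arbitrary: a)
    case 0
    then show ?case by (auto simp: Bad_def link_def not_less)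
  next
    case (Suc m)
    have p: "\<pi> m a \<in> G m" using \<pi>(1)[OF aF[OF Suc.prems(3)]] .
    have "deviation I (link (Suc m) a) \<omega> \<le> \<tau> (Suc m)"
      using Suc.prems(1) Suc.prems(2)[of "Suc m"] Suc.prems(3) by (auto simp: Bad_def not_less)
    moreover have "deviation I (g (\<pi> m a)) \<omega> \<le> (\<Sum>s\<le>m. \<tau> s)"
      using Suc.IH[OF Suc.prems(1) _ p] Suc.prems(2) by simp
    moreover have "deviation I (g a) \<omega> \<le> deviation I (g (\<pi> m a)) \<omega> + deviation I (link (Suc m) a) \<omega>"
      unfolding link_def nat.case using gint aF[OF Suc.prems(3)] \<pi>F by (intro deviation_diff_le) auto
    ultimately show ?case by simp
  qed
  have GS: "c \<in> G S" if "c \<in> F" for c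
    using \<pi>[OF that, of S] sep[OF that \<pi>F[OF that, of S]] by (metis not_less)
  have "{\<omega> \<in> space M. \<exists>c\<in>F. 16 * b * sqrt (real n * (3 * V + x)) < deviation I (g c) \<omega>} \<subseteq> (\<Union>s\<le>S. Bad s)"
  proof
    fix \<omega> assume "\<omega> \<in> {\<omega> \<in> space M. \<exists>c\<in>F. 16 * b * sqrt (real n * (3 * V + x)) < deviation I (g c) \<omega>}"
    then obtain c where c: "\<omega> \<in> space M" "c \<in> F" "16 * b * sqrt (real n * (3 * V + x)) < deviation I (g c) \<omega>"
      by blast
    show "\<omega> \<in> (\<Union>s\<le>S. Bad s)"
    proof (rule ccontr)
      assume "\<omega> \<notin> (\<Union>s\<le>S. Bad s)"
      then have "deviation I (g c) \<omega> \<le> (\<Sum>s\<le>S. \<tau> s)" by (intro chain c(1) GS c(2)) auto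
      then show False using c(3) sum_\<tau> by linarith
    qed
  qed
  then have "prob {\<omega> \<in> space M. \<exists>c\<in>F. 16 * b * sqrt (real n * (3 * V + x)) < deviation I (g c) \<omega>} \<le> prob (\<Union>s\<le>S. Bad s)"
    using Badm by (intro finite_measure_mono sets.finite_UN) auto
  also have "\<dots> \<le> (\<Sum>s\<le>S. prob (Bad s))" using Badm by (intro finite_measure_subadditive_finite) auto
  also have "\<dots> \<le> (\<Sum>s\<le>S. exp (- x) * (2 * (1 / 5) ^ Suc s))" using Bad by (intro sum_mono) auto
  also have "\<dots> = exp (- x) * (\<Sum>s\<le>S. 2 * (1 / 5) ^ Suc s)" by (rule sum_distrib_left[symmetric])
  also have "(\<Sum>s\<le>S. 2 * (1 / 5) ^ Suc s) = (1 / 2 - (1 / 5) ^ Suc S / 2 :: real)"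
  proof -
    have "(\<Sum>s\<le>S. 2 * q ^ Suc s) = 1 / 2 - q ^ Suc S / 2" if q: "q = (1 / 5 :: real)" for q
    proof (induction S)
      case (Suc S)
      have "q ^ Suc (Suc S) = q ^ Suc S / 5" using q by simp
      then show ?case using Suc unfolding sum.atMost_Suc by linarith
    qed (simp add: q)
    then show ?thesis by blast
  qed
  also have "exp (- x) * (1 / 2 - (1 / 5) ^ Suc S / 2) \<le> exp (- x) * (1 / 2)"
    by (intro mult_left_mono) auto
  finally show ?thesis by simp
qed

text \<open>
  The condition on \<open>n\<close> in the chaining bound involves \<open>x\<close>. As soon as \<open>x\<close> exceeds \<open>ln (4 card F)\<close>,
  however, a plain union bound is good enough, and so one condition on \<open>n\<close> serves all \<open>x\<close>.
\<close>

lemma prob_ex_deviation_gt_le: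
  fixes g :: "'c \<Rightarrow> 'b \<Rightarrow> 'i \<Rightarrow> real" and \<rho> :: "'c \<Rightarrow> 'c \<Rightarrow> real"
  assumes I: "finite I" and F: "finite F" "F \<noteq> {}"
    and g: "\<And>c l. c \<in> F \<Longrightarrow> l \<in> I \<Longrightarrow> (\<lambda>y. g c y l) \<in> borel_measurable K"
    and bound: "\<And>c y. c \<in> F \<Longrightarrow> y \<in> space K \<Longrightarrow> L2_set (g c y) I \<le> b" and b: "0 < b"
    and var: "\<And>c c'. c \<in> F \<Longrightarrow> c' \<in> F \<Longrightarrow>
      (\<integral>y. (L2_set (\<lambda>l. g c y l - g c' y l) I)\<^sup>2 \<partial>\<nu>) \<le> b\<^sup>2 * \<rho> c c'"
    and sym: "\<And>c c'. \<rho> c c' = \<rho> c' c"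
    and pack: "\<And>s G. G \<subseteq> F \<Longrightarrow> (\<And>c c'. c \<in> G \<Longrightarrow> c' \<in> G \<Longrightarrow> c \<noteq> c' \<Longrightarrow> 1 / 4 ^ s \<le> \<rho> c c') \<Longrightarrow>
      ln (real (card G)) \<le> V * real (Suc s)"
    and sep: "\<And>c c'. c \<in> F \<Longrightarrow> c' \<in> F \<Longrightarrow> c \<noteq> c' \<Longrightarrow> 1 / 4 ^ S \<le> \<rho> c c'"
    and V: "1 \<le> V" and x: "0 \<le> x"
    and n_ge: "4 * 4 ^ S * ((V + 2) * real (Suc S) + ln (4 * real (card F))) \<le> real n"
  shows "prob {\<omega> \<in> space M. \<exists>c\<in>F. 16 * b * sqrt (real n * (3 * V + x)) < deviation I (g c) \<omega>} \<le> exp (- x) / 2"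
proof (cases "x \<le> ln (4 * real (card F))")
  case True
  then have "4 * 4 ^ S * ((V + 2) * real (Suc S) + x) \<le> 4 * 4 ^ S * ((V + 2) * real (Suc S) + ln (4 * real (card F)))"
    by (intro mult_left_mono) auto
  note le = order_trans[OF this n_ge]
  show ?thesis by (rule prob_ex_deviation_gt_le_chaining[OF I F(1) g bound b var sym pack sep V x le])
next
  case False
  define \<tau> where "\<tau> = 16 * b * sqrt (real n * (3 * V + x))"
  have cF: "0 < real (card F)" using F by (simp add: card_gt_0_iff)
  have n0: "0 < real n" using n by simp
  have devm: "deviation I (g c) \<in> borel_measurable M" if "c \<in> F" for c
    using g[OF that] by (rule deviation_measurable)
  have \<tau>2: "3 * \<tau>\<^sup>2 / (16 * real n * b\<^sup>2) = 48 * (3 * V + x)"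
    using n0 b V x by (simp add: \<tau>_def power_mult_distrib)
  have "prob {\<omega> \<in> space M. \<exists>c\<in>F. \<tau> < deviation I (g c) \<omega>} = prob (\<Union>c\<in>F. {\<omega> \<in> space M. \<tau> < deviation I (g c) \<omega>})"
    by (intro arg_cong[of _ _ prob]) auto
  also have "\<dots> \<le> (\<Sum>c\<in>F. prob {\<omega> \<in> space M. \<tau> < deviation I (g c) \<omega>})"
  proof (rule finite_measure_subadditive_finite[OF F(1)], safe)
    fix c assume "c \<in> F"
    then show "{\<omega> \<in> space M. \<tau> < deviation I (g c) \<omega>} \<in> events" using devm by measurable
  qed
  also have "\<dots> \<le> (\<Sum>c\<in>F. 2 * exp (- (2 * x)))"
  proof (rule sum_mono)
    fix c assume c: "c \<in> F"
    have "prob {\<omega> \<in> space M. \<tau> < deviation I (g c) \<omega>} \<le> 2 * exp (- (48 * (3 * V + x)))"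
      using prob_deviation_gt_le_subgaussian[OF I g[OF c] bound[OF c] b, of \<tau>] b V x
      unfolding \<tau>2 by (simp add: \<tau>_def)
    also have "\<dots> \<le> 2 * exp (- (2 * x))" using V x by simp
    finally show "prob {\<omega> \<in> space M. \<tau> < deviation I (g c) \<omega>} \<le> 2 * exp (- (2 * x))" .
  qed
  also have "\<dots> = exp (- x) * (2 * real (card F) * exp (- x))" by (simp add: exp_add[symmetric])
  also have "\<dots> \<le> exp (- x) * (1 / 2)"
  proof (intro mult_left_mono)
    have "4 * real (card F) = exp (ln (4 * real (card F)))" using cF by simp
    also have "\<dots> \<le> exp x" using False by simp
    finally show "2 * real (card F) * exp (- x) \<le> 1 / 2" by (simp add: exp_minus field_simps)
  qed simp
  finally show ?thesis by (simp add: \<tau>_def)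
qed

end


section \<open>Integrals against random measures\<close>

abbreviation "ball0 d R \<equiv> closed_ball d (zero_vec d) R"

lemma ball_measuresD:
  assumes Q: "Q \<in> ball_measures d R M"
  shows "sets Q = sets (Rd d)" "space Q = space (Rd d)" "finite_measure Q"
    and "AE u in Q. u \<in> ball0 d R" "0 \<le> M \<Longrightarrow> measure Q (space Q) \<le> M"
proof -
  show s: "sets Q = sets (Rd d)" using Q by (simp add: ball_measures_def)
  show sp: "space Q = space (Rd d)" using s by (rule sets_eq_imp_space_eq)
  have le: "emeasure Q (space Q) \<le> ennreal M" using Q sp by (simp add: ball_measures_def)
  show fin: "finite_measure Q" using le by (intro finite_measureI) (auto simp: top_unique)
  show "AE u in Q. u \<in> ball0 d R"
    using Q sp s by (intro AE_I[of _ _ "space (Rd d) - ball0 d R"]) (auto simp: ball_measures_def)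
  show "measure Q (space Q) \<le> M" if "0 \<le> M"
    using le finite_measure.emeasure_eq_measure[OF fin] that by simp
qed

lemma integrable_ball_measure:
  fixes f :: "(nat \<Rightarrow> real) \<Rightarrow> real"
  assumes Q: "Q \<in> ball_measures d R M" and f: "f \<in> borel_measurable (Rd d)"
    and bound: "\<And>u. u \<in> ball0 d R \<Longrightarrow> \<bar>f u\<bar> \<le> C"
  shows "integrable Q f"
proof -
  interpret finite_measure Q using ball_measuresD(3)[OF Q] .
  show ?thesis
  proof (rule integrable_const_bound[of _ C])
    show "AE u in Q. norm (f u) \<le> C"
      using ball_measuresD(4)[OF Q] by eventually_elim (simp add: bound)
    show "f \<in> borel_measurable Q" using f measurable_cong_sets[OF ball_measuresD(1)[OF Q] refl] by blast
  qed
qed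

lemma component_le_edist_zero:
  assumes "l \<in> {1..d}"
  shows "\<bar>u l\<bar> \<le> edist d (zero_vec d) u"
  using member_le_L2_set[of "{1..d}" l "\<lambda>i. \<bar>zero_vec d i - u i\<bar>"] assms
  by (simp add: edist_def L2_set_def zero_vec_def)

text \<open>
  Without a bound on the number of atoms, this space contains the mean measure and all empirical
  means besides the sampled measures.
\<close>

definition ball_measure_space :: "nat \<Rightarrow> real \<Rightarrow> real \<Rightarrow> (nat \<Rightarrow> real) measure measure" where
  "ball_measure_space d R M = evaluation_algebra (Rd d) (ball_measures d R M)"

lemma measurable_ball_measure_spaceI:
  assumes "\<And>\<omega>. \<omega> \<in> space \<Omega> \<Longrightarrow> L \<omega> \<in> ball_measures d R M"
    and "\<And>A. A \<in> sets (Rd d) \<Longrightarrow> (\<lambda>\<omega>. emeasure (L \<omega>) A) \<in> borel_measurable \<Omega>"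
  shows "L \<in> measurable \<Omega> (ball_measure_space d R M)"
  unfolding ball_measure_space_def evaluation_algebra_def
  using assms by (auto intro!: measurable_Sup2 measurable_vimage_algebra2)

lemma measurable_ball_measure_spaceD:
  assumes L: "L \<in> measurable \<Omega> (ball_measure_space d R M)"
  shows "\<omega> \<in> space \<Omega> \<Longrightarrow> L \<omega> \<in> ball_measures d R M"
    and "A \<in> sets (Rd d) \<Longrightarrow> (\<lambda>\<omega>. emeasure (L \<omega>) A) \<in> borel_measurable \<Omega>"
  using measurable_space[OF L]
    measurable_compose[OF L[unfolded ball_measure_space_def] measurable_emeasure_evaluation_algebra]
  by (auto simp: ball_measure_space_def space_evaluation_algebra)

lemma space_measure_space_of: "space (measure_space_of d N R M) = discrete_ball_measures d N R M"
  by (simp add: measure_space_of_def space_evaluation_algebra)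

lemma measure_space_of_measurable_ident:
  "(\<lambda>y. y) \<in> measurable (measure_space_of d N R M) (ball_measure_space d R M)"
proof (rule measurable_ball_measure_spaceI)
  show "y \<in> ball_measures d R M" if "y \<in> space (measure_space_of d N R M)" for y
    using that by (simp add: space_measure_space_of discrete_ball_measures_def)
qed (auto simp: measure_space_of_def intro: measurable_emeasure_evaluation_algebra)

lemma measurable_measure_space_ofD:
  "X \<in> measurable \<Omega> (measure_space_of d N R M) \<Longrightarrow> X \<in> measurable \<Omega> (ball_measure_space d R M)"
  using measurable_compose[OF _ measure_space_of_measurable_ident] by blast

text \<open>
  Scaling by \<open>1 / M\<close> turns random measures into sub-probability kernels, for which the
  measurability of parametrised integrals is known.
\<close>

lemma measurable_scaled_kernel:
  assumes L: "L \<in> measurable \<Omega> (ball_measure_space d R M)" and M: "0 < M"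
  shows "(\<lambda>\<omega>. scale_measure (ennreal (1 / M)) (L \<omega>)) \<in> measurable \<Omega> (subprob_algebra (Rd d))"
proof (rule measurable_subprob_algebra)
  fix \<omega> assume \<omega>: "\<omega> \<in> space \<Omega>"
  note Q = measurable_ball_measure_spaceD(1)[OF L \<omega>]
  show "sets (scale_measure (ennreal (1 / M)) (L \<omega>)) = sets (Rd d)" using ball_measuresD(1)[OF Q] by simp
  show "subprob_space (scale_measure (ennreal (1 / M)) (L \<omega>))"
  proof
    have "emeasure (L \<omega>) (space (L \<omega>)) \<le> ennreal M"
      using Q ball_measuresD(2)[OF Q] by (simp add: ball_measures_def)
    then have "ennreal (1 / M) * emeasure (L \<omega>) (space (L \<omega>)) \<le> ennreal (1 / M) * ennreal M"
      by (intro mult_left_mono) auto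
    also have "\<dots> = 1" using M by (simp add: ennreal_mult[symmetric])
    finally show "emeasure (scale_measure (ennreal (1 / M)) (L \<omega>)) (space (scale_measure (ennreal (1 / M)) (L \<omega>))) \<le> 1"
      by (simp add: space_scale_measure)
    show "space (scale_measure (ennreal (1 / M)) (L \<omega>)) \<noteq> {}"
      by (auto simp: space_scale_measure ball_measuresD(2)[OF Q] Rd_def space_PiM)
  qed
next
  fix A assume "A \<in> sets (Rd d)"
  then show "(\<lambda>\<omega>. emeasure (scale_measure (ennreal (1 / M)) (L \<omega>)) A) \<in> borel_measurable \<Omega>"
    using measurable_ball_measure_spaceD(2)[OF L] by simp
qed

lemma borel_measurable_nn_integral_kernel:
  assumes L: "L \<in> measurable \<Omega> (ball_measure_space d R M)" and M: "0 < M"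
    and f: "(\<lambda>(\<omega>, u). f \<omega> u) \<in> borel_measurable (\<Omega> \<Otimes>\<^sub>M Rd d)"
  shows "(\<lambda>\<omega>. \<integral>\<^sup>+u. f \<omega> u \<partial>L \<omega>) \<in> borel_measurable \<Omega>"
proof -
  have "(\<lambda>\<omega>. ennreal M * (\<integral>\<^sup>+u. f \<omega> u \<partial>scale_measure (ennreal (1 / M)) (L \<omega>))) \<in> borel_measurable \<Omega>"
    using nn_integral_measurable_subprob_algebra2[OF f measurable_scaled_kernel[OF L M]] by measurable
  moreover have "ennreal M * (\<integral>\<^sup>+u. f \<omega> u \<partial>scale_measure (ennreal (1 / M)) (L \<omega>)) = (\<integral>\<^sup>+u. f \<omega> u \<partial>L \<omega>)"
    if \<omega>: "\<omega> \<in> space \<Omega>" for \<omega>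
  proof -
    note Q = measurable_ball_measure_spaceD(1)[OF L \<omega>]
    have "f \<omega> \<in> borel_measurable (Rd d)" using measurable_Pair2[OF f \<omega>] by simp
    then have "f \<omega> \<in> borel_measurable (L \<omega>)"
      using measurable_cong_sets[OF ball_measuresD(1)[OF Q] refl] by blast
    then have "ennreal M * (\<integral>\<^sup>+u. f \<omega> u \<partial>scale_measure (ennreal (1 / M)) (L \<omega>))
        = (ennreal M * ennreal (1 / M)) * (\<integral>\<^sup>+u. f \<omega> u \<partial>L \<omega>)"
      by (simp add: nn_integral_scale_measure mult.assoc)
    also have "ennreal M * ennreal (1 / M) = 1" using M by (simp add: ennreal_mult[symmetric])
    finally show ?thesis by simp
  qed
  ultimately show ?thesis by (simp cong: measurable_cong)
qed

lemma borel_measurable_integral_kernel: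
  fixes f :: "'a \<Rightarrow> (nat \<Rightarrow> real) \<Rightarrow> real"
  assumes L: "L \<in> measurable \<Omega> (ball_measure_space d R M)" and M: "0 < M"
    and f: "(\<lambda>(\<omega>, u). f \<omega> u) \<in> borel_measurable (\<Omega> \<Otimes>\<^sub>M Rd d)"
    and bound: "\<And>\<omega> u. \<omega> \<in> space \<Omega> \<Longrightarrow> u \<in> ball0 d R \<Longrightarrow> \<bar>f \<omega> u\<bar> \<le> C"
  shows "(\<lambda>\<omega>. \<integral>u. f \<omega> u \<partial>L \<omega>) \<in> borel_measurable \<Omega>"
proof -
  have "(\<integral>u. f \<omega> u \<partial>L \<omega>) = enn2real (\<integral>\<^sup>+u. ennreal (f \<omega> u) \<partial>L \<omega>) - enn2real (\<integral>\<^sup>+u. ennreal (- f \<omega> u) \<partial>L \<omega>)"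
    if \<omega>: "\<omega> \<in> space \<Omega>" for \<omega>
  proof (rule real_lebesgue_integral_def, rule integrable_ball_measure)
    show "L \<omega> \<in> ball_measures d R M" by (rule measurable_ball_measure_spaceD(1)[OF L \<omega>])
    show "f \<omega> \<in> borel_measurable (Rd d)" using measurable_Pair2[OF f \<omega>] by simp
  qed (rule bound[OF \<omega>])
  moreover have "(\<lambda>\<omega>. enn2real (\<integral>\<^sup>+u. ennreal (f \<omega> u) \<partial>L \<omega>) - enn2real (\<integral>\<^sup>+u. ennreal (- f \<omega> u) \<partial>L \<omega>))
      \<in> borel_measurable \<Omega>"
  proof -
    have p: "(\<lambda>(\<omega>, u). ennreal (f \<omega> u)) \<in> borel_measurable (\<Omega> \<Otimes>\<^sub>M Rd d)"
      "(\<lambda>(\<omega>, u). ennreal (- f \<omega> u)) \<in> borel_measurable (\<Omega> \<Otimes>\<^sub>M Rd d)"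
      using f unfolding case_prod_beta by measurable
    show ?thesis
      by (intro borel_measurable_diff borel_measurable_enn2real
          borel_measurable_nn_integral_kernel[OF L M p(1)] borel_measurable_nn_integral_kernel[OF L M p(2)])
  qed
  ultimately show ?thesis by (simp cong: measurable_cong)
qed

lemma mean_measure_ball:
  assumes L: "L \<in> measurable \<Omega> (ball_measure_space d R M)" and \<Omega>: "prob_space \<Omega>"
  shows "sets (mean_measure \<Omega> (Rd d) L) = sets (Rd d)"
    and "A \<in> sets (Rd d) \<Longrightarrow> emeasure (mean_measure \<Omega> (Rd d) L) A = (\<integral>\<^sup>+\<omega>. emeasure (L \<omega>) A \<partial>\<Omega>)"
    and "mean_measure \<Omega> (Rd d) L \<in> ball_measures d R M"
proof -
  interpret prob_space \<Omega> by (rule \<Omega>)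
  show s: "sets (mean_measure \<Omega> (Rd d) L) = sets (Rd d)" by (simp add: mean_measure_def)
  have e: "emeasure (mean_measure \<Omega> (Rd d) L) A = (\<integral>\<^sup>+\<omega>. emeasure (L \<omega>) A \<partial>\<Omega>)" if "A \<in> sets (Rd d)" for A
    by (rule emeasure_mean_measure[OF L[unfolded ball_measure_space_def] _ that]) (simp add: ball_measures_def)
  then show "A \<in> sets (Rd d) \<Longrightarrow> emeasure (mean_measure \<Omega> (Rd d) L) A = (\<integral>\<^sup>+\<omega>. emeasure (L \<omega>) A \<partial>\<Omega>)" .
  have Q: "L \<omega> \<in> ball_measures d R M" if "\<omega> \<in> space \<Omega>" for \<omega> by (rule measurable_ball_measure_spaceD(1)[OF L that])
  have "(\<integral>\<^sup>+\<omega>. emeasure (L \<omega>) (space (Rd d) - ball0 d R) \<partial>\<Omega>) = (\<integral>\<^sup>+\<omega>. 0 \<partial>\<Omega>)"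
    using Q by (intro nn_integral_cong) (simp add: ball_measures_def)
  moreover have "(\<integral>\<^sup>+\<omega>. emeasure (L \<omega>) (space (Rd d)) \<partial>\<Omega>) \<le> (\<integral>\<^sup>+\<omega>. ennreal M \<partial>\<Omega>)"
    using Q by (intro nn_integral_mono) (simp add: ball_measures_def)
  ultimately show "mean_measure \<Omega> (Rd d) L \<in> ball_measures d R M"
    using s e by (simp add: ball_measures_def emeasure_space_1)
qed

text \<open>Campbell's formula, for functions that are bounded on the ball.\<close>

lemma integral_mean_measure:
  fixes f :: "(nat \<Rightarrow> real) \<Rightarrow> real"
  assumes L: "L \<in> measurable \<Omega> (ball_measure_space d R M)" and \<Omega>: "prob_space \<Omega>" and M: "0 < M"
    and f: "f \<in> borel_measurable (Rd d)" and bound: "\<And>u. u \<in> ball0 d R \<Longrightarrow> \<bar>f u\<bar> \<le> C"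
  shows "(\<integral>u. f u \<partial>mean_measure \<Omega> (Rd d) L) = (\<integral>\<omega>. \<integral>u. f u \<partial>L \<omega> \<partial>\<Omega>)"
    and "integrable \<Omega> (\<lambda>\<omega>. \<integral>u. f u \<partial>L \<omega>)"
proof -
  interpret prob_space \<Omega> by (rule \<Omega>)
  define \<mu> where "\<mu> = mean_measure \<Omega> (Rd d) L"
  define S where "S = (\<lambda>\<omega>. scale_measure (ennreal (1 / M)) (L \<omega>))"
  note \<mu> = mean_measure_ball[OF L \<Omega>, folded \<mu>_def]
  note Sm = measurable_scaled_kernel[OF L M, folded S_def]
  have Q: "L \<omega> \<in> ball_measures d R M" if "\<omega> \<in> space \<Omega>" for \<omega> by (rule measurable_ball_measure_spaceD(1)[OF L that])
  have fam: "g \<in> borel_measurable Q'" if "g \<in> borel_measurable (Rd d)" "Q' \<in> ball_measures d R M" for Q'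
    and g :: "(nat \<Rightarrow> real) \<Rightarrow> 'z :: topological_space"
    using that(1) measurable_cong_sets[OF ball_measuresD(1)[OF that(2)] refl] by blast
  have bind: "scale_measure (ennreal (1 / M)) \<mu> = \<Omega> \<bind> S"
  proof (rule measure_eqI)
    show "sets (scale_measure (ennreal (1 / M)) \<mu>) = sets (\<Omega> \<bind> S)"
      using sets_bind[of \<Omega> S "Rd d"] sets_kernel[OF Sm] not_empty \<mu>(1) by simp
    fix A assume "A \<in> sets (scale_measure (ennreal (1 / M)) \<mu>)"
    then have A: "A \<in> sets (Rd d)" using \<mu>(1) by simp
    show "emeasure (scale_measure (ennreal (1 / M)) \<mu>) A = emeasure (\<Omega> \<bind> S) A"
      using emeasure_bind[OF not_empty Sm A] \<mu>(2)[OF A] measurable_ball_measure_spaceD(2)[OF L A]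
      by (simp add: S_def nn_integral_cmult)
  qed
  have nn: "(\<integral>\<^sup>+u. g u \<partial>\<mu>) = (\<integral>\<^sup>+\<omega>. \<integral>\<^sup>+u. g u \<partial>L \<omega> \<partial>\<Omega>)" if g: "g \<in> borel_measurable (Rd d)" for g
  proof -
    have Lg: "(\<lambda>\<omega>. \<integral>\<^sup>+u. g u \<partial>L \<omega>) \<in> borel_measurable \<Omega>"
      using g by (intro borel_measurable_nn_integral_kernel[OF L M]) (simp add: case_prod_beta')
    have "ennreal (1 / M) * (\<integral>\<^sup>+u. g u \<partial>\<mu>) = (\<integral>\<^sup>+u. g u \<partial>(\<Omega> \<bind> S))"
      using nn_integral_scale_measure[OF fam[OF g \<mu>(3)]] by (simp add: bind[symmetric])
    also have "\<dots> = (\<integral>\<^sup>+\<omega>. \<integral>\<^sup>+u. g u \<partial>S \<omega> \<partial>\<Omega>)" by (rule nn_integral_bind[OF g Sm])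
    also have "\<dots> = (\<integral>\<^sup>+\<omega>. ennreal (1 / M) * (\<integral>\<^sup>+u. g u \<partial>L \<omega>) \<partial>\<Omega>)"
      unfolding S_def by (intro nn_integral_cong nn_integral_scale_measure fam[OF g] Q)
    also have "\<dots> = ennreal (1 / M) * (\<integral>\<^sup>+\<omega>. \<integral>\<^sup>+u. g u \<partial>L \<omega> \<partial>\<Omega>)"
      by (rule nn_integral_cmult[OF Lg])
    finally show ?thesis using M by (simp add: ennreal_mult_cancel_left)
  qed
  have meas: "(\<lambda>\<omega>. \<integral>u. h u \<partial>L \<omega>) \<in> borel_measurable \<Omega>"
    if "h \<in> borel_measurable (Rd d)" "\<And>u. u \<in> ball0 d R \<Longrightarrow> \<bar>h u\<bar> \<le> C'" for h :: "(nat \<Rightarrow> real) \<Rightarrow> real" and C'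
    using that by (intro borel_measurable_integral_kernel[OF L M]) (simp_all add: case_prod_beta')
  have int: "integrable \<Omega> (\<lambda>\<omega>. \<integral>u. h u \<partial>L \<omega>)"
    if h: "h \<in> borel_measurable (Rd d)" "\<And>u. u \<in> ball0 d R \<Longrightarrow> \<bar>h u\<bar> \<le> C'" and C': "0 \<le> C'"
    for h :: "(nat \<Rightarrow> real) \<Rightarrow> real" and C'
  proof (rule integrable_const_bound[of _ "C' * M"])
    show "AE \<omega> in \<Omega>. norm (\<integral>u. h u \<partial>L \<omega>) \<le> C' * M"
    proof (rule AE_I2)
      fix \<omega> assume \<omega>: "\<omega> \<in> space \<Omega>"
      interpret L: finite_measure "L \<omega>" using ball_measuresD(3)[OF Q[OF \<omega>]] .
      have "norm (\<integral>u. h u \<partial>L \<omega>) \<le> (\<integral>u. norm (h u) \<partial>L \<omega>)" by (rule integral_norm_bound)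
      also have "\<dots> \<le> (\<integral>u. C' \<partial>L \<omega>)"
      proof (rule integral_mono_AE)
        show "integrable (L \<omega>) (\<lambda>u. norm (h u))"
          using integrable_ball_measure[OF Q[OF \<omega>] h] by simp
        show "AE u in L \<omega>. norm (h u) \<le> C'"
          using ball_measuresD(4)[OF Q[OF \<omega>]] by eventually_elim (simp add: h(2))
      qed simp
      also have "\<dots> \<le> C' * M"
        using ball_measuresD(5)[OF Q[OF \<omega>]] M C' by (simp add: mult_left_mono mult.commute)
      finally show "norm (\<integral>u. h u \<partial>L \<omega>) \<le> C' * M" .
    qed
  qed (rule meas[OF h])
  have nonneg: "(\<integral>u. h u \<partial>\<mu>) = (\<integral>\<omega>. \<integral>u. h u \<partial>L \<omega> \<partial>\<Omega>)"
    if h: "h \<in> borel_measurable (Rd d)" "\<And>u. u \<in> ball0 d R \<Longrightarrow> \<bar>h u\<bar> \<le> C'" "\<And>u. 0 \<le> h u"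
    for h :: "(nat \<Rightarrow> real) \<Rightarrow> real" and C'
  proof -
    have "(\<integral>u. h u \<partial>\<mu>) = enn2real (\<integral>\<^sup>+u. ennreal (h u) \<partial>\<mu>)"
      using h(3) fam[OF h(1) \<mu>(3)] by (intro integral_eq_nn_integral) auto
    also have "(\<integral>\<^sup>+u. ennreal (h u) \<partial>\<mu>) = (\<integral>\<^sup>+\<omega>. \<integral>\<^sup>+u. ennreal (h u) \<partial>L \<omega> \<partial>\<Omega>)"
      using h(1) by (intro nn) measurable
    also have "\<dots> = (\<integral>\<^sup>+\<omega>. ennreal (\<integral>u. h u \<partial>L \<omega>) \<partial>\<Omega>)"
      using integrable_ball_measure[OF Q h(1,2)] h(3) by (intro nn_integral_cong nn_integral_eq_integral) auto
    also have "enn2real \<dots> = (\<integral>\<omega>. \<integral>u. h u \<partial>L \<omega> \<partial>\<Omega>)"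
      using h(3) meas[OF h(1,2)] by (intro integral_eq_nn_integral[symmetric]) auto
    finally show ?thesis .
  qed
  have bound': "\<bar>max 0 (f u)\<bar> \<le> \<bar>C\<bar>" "\<bar>max 0 (- f u)\<bar> \<le> \<bar>C\<bar>" "\<bar>f u\<bar> \<le> \<bar>C\<bar>" if "u \<in> ball0 d R" for u
    using bound[OF that] by (auto simp: max_def)
  have fp: "(\<lambda>u. max 0 (f u)) \<in> borel_measurable (Rd d)" "(\<lambda>u. max 0 (- f u)) \<in> borel_measurable (Rd d)"
    using f by auto
  have split: "(\<integral>u. f u \<partial>Q') = (\<integral>u. max 0 (f u) \<partial>Q') - (\<integral>u. max 0 (- f u) \<partial>Q')"
    if "Q' \<in> ball_measures d R M" for Q'
  proof -
    have "(\<integral>u. f u \<partial>Q') = (\<integral>u. max 0 (f u) - max 0 (- f u) \<partial>Q')" by (intro Bochner_Integration.integral_cong) auto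
    also have "\<dots> = (\<integral>u. max 0 (f u) \<partial>Q') - (\<integral>u. max 0 (- f u) \<partial>Q')"
      using integrable_ball_measure[OF that fp(1) bound'(1)] integrable_ball_measure[OF that fp(2) bound'(2)]
      by (rule Bochner_Integration.integral_diff)
    finally show ?thesis .
  qed
  have "(\<integral>u. f u \<partial>\<mu>) = (\<integral>\<omega>. \<integral>u. max 0 (f u) \<partial>L \<omega> \<partial>\<Omega>) - (\<integral>\<omega>. \<integral>u. max 0 (- f u) \<partial>L \<omega> \<partial>\<Omega>)"
    unfolding split[OF \<mu>(3)] using nonneg[OF fp(1) bound'(1)] nonneg[OF fp(2) bound'(2)] by simp
  also have "\<dots> = (\<integral>\<omega>. (\<integral>u. max 0 (f u) \<partial>L \<omega>) - (\<integral>u. max 0 (- f u) \<partial>L \<omega>) \<partial>\<Omega>)"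
    using int[OF fp(1) bound'(1)] int[OF fp(2) bound'(2)]
    by (intro Bochner_Integration.integral_diff[symmetric]) auto
  also have "\<dots> = (\<integral>\<omega>. \<integral>u. f u \<partial>L \<omega> \<partial>\<Omega>)"
    by (intro Bochner_Integration.integral_cong refl split[symmetric] Q)
  finally show "(\<integral>u. f u \<partial>mean_measure \<Omega> (Rd d) L) = (\<integral>\<omega>. \<integral>u. f u \<partial>L \<omega> \<partial>\<Omega>)" by (simp add: \<mu>_def)
  show "integrable \<Omega> (\<lambda>\<omega>. \<integral>u. f u \<partial>L \<omega>)" by (rule int[OF f bound'(3)]) auto
qed

text \<open>The empirical mean is the mean measure of a uniformly chosen member of the sample.\<close>

lemma empirical_mean_eq_mean_measure:
  assumes "1 \<le> n"
  shows "empirical_mean K n y = mean_measure (uniform_count_measure {1..n}) K y"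
  unfolding empirical_mean_def mean_measure_def
proof (rule measure_of_eq)
  show "sets K \<subseteq> Pow (space K)" by (rule sets.space_closed)
  show "ennreal (1 / real n) * (\<Sum>i=1..n. emeasure (y i) A)
      = (\<integral>\<^sup>+i. emeasure (y i) A \<partial>uniform_count_measure {1..n})" for A
    using assms by (simp add: uniform_count_measure_def nn_integral_point_measure_finite sum_distrib_left)
qed

lemma measurable_uniform_count_measure_ball:
  assumes "\<And>i. i \<in> {1..n} \<Longrightarrow> y i \<in> ball_measures d R M"
  shows "y \<in> measurable (uniform_count_measure {1..n}) (ball_measure_space d R M)"
  using assms
  by (intro measurable_ball_measure_spaceI)
    (auto simp: space_uniform_count_measure measurable_def sets_uniform_count_measure)

lemma empirical_mean_ball:
  assumes n: "1 \<le> n" and y: "\<And>i. i \<in> {1..n} \<Longrightarrow> y i \<in> ball_measures d R M"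
  shows "empirical_mean (Rd d) n y \<in> ball_measures d R M"
proof -
  have "prob_space (uniform_count_measure {1..n})" using n by (intro prob_space_uniform_count_measure) auto
  then show ?thesis unfolding empirical_mean_eq_mean_measure[OF n]
    by (intro mean_measure_ball(3)[OF measurable_uniform_count_measure_ball[OF y]])
qed

lemma integral_empirical_mean:
  fixes f :: "(nat \<Rightarrow> real) \<Rightarrow> real"
  assumes n: "1 \<le> n" and y: "\<And>i. i \<in> {1..n} \<Longrightarrow> y i \<in> ball_measures d R M" and M: "0 < M"
    and f: "f \<in> borel_measurable (Rd d)" and bound: "\<And>u. u \<in> ball0 d R \<Longrightarrow> \<bar>f u\<bar> \<le> C"
  shows "(\<integral>u. f u \<partial>empirical_mean (Rd d) n y) = (\<Sum>i=1..n. \<integral>u. f u \<partial>y i) / real n"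
proof -
  have "prob_space (uniform_count_measure {1..n})" using n by (intro prob_space_uniform_count_measure) auto
  then have "(\<integral>u. f u \<partial>empirical_mean (Rd d) n y) = (\<integral>i. \<integral>u. f u \<partial>y i \<partial>uniform_count_measure {1..n})"
    unfolding empirical_mean_eq_mean_measure[OF n]
    by (intro integral_mean_measure(1)[OF measurable_uniform_count_measure_ball[OF y] _ M f bound])
  also have "\<dots> = (\<Sum>i=1..n. \<integral>u. f u \<partial>y i) / real n"
    by (subst integral_uniform_count_measure) auto
  finally show ?thesis .
qed

lemma measurable_empirical_mean:
  assumes n: "1 \<le> n" and Y: "\<And>i. i \<in> {1..n} \<Longrightarrow> Y i \<in> measurable \<Omega> (ball_measure_space d R M)"
  shows "(\<lambda>\<omega>. empirical_mean (Rd d) n (\<lambda>i. Y i \<omega>)) \<in> measurable \<Omega> (ball_measure_space d R M)"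
proof (rule measurable_ball_measure_spaceI)
  have Q: "Y i \<omega> \<in> ball_measures d R M" if "i \<in> {1..n}" "\<omega> \<in> space \<Omega>" for i \<omega>
    by (rule measurable_ball_measure_spaceD(1)[OF Y[OF that(1)] that(2)])
  then show "empirical_mean (Rd d) n (\<lambda>i. Y i \<omega>) \<in> ball_measures d R M" if "\<omega> \<in> space \<Omega>" for \<omega>
    using that by (intro empirical_mean_ball n)
  fix A assume A: "A \<in> sets (Rd d)"
  have "(\<lambda>\<omega>. ennreal (1 / real n) * (\<Sum>i=1..n. emeasure (Y i \<omega>) A)) \<in> borel_measurable \<Omega>"
    using measurable_ball_measure_spaceD(2)[OF Y A]
    by (intro borel_measurable_times_ennreal borel_measurable_const borel_measurable_sum)
  moreover have "emeasure (empirical_mean (Rd d) n (\<lambda>i. Y i \<omega>)) A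
      = ennreal (1 / real n) * (\<Sum>i=1..n. emeasure (Y i \<omega>) A)" if "\<omega> \<in> space \<Omega>" for \<omega>
    using ball_measuresD(1)[OF Q[OF _ that]] by (intro emeasure_empirical_mean A)
  ultimately show "(\<lambda>\<omega>. emeasure (empirical_mean (Rd d) n (\<lambda>i. Y i \<omega>)) A) \<in> borel_measurable \<Omega>"
    by (simp cong: measurable_cong)
qed

lemma measurable_codepoint:
  assumes c: "c \<in> measurable \<Omega> (codebook_space d k)" and j: "j \<in> {1..k}"
  shows "(\<lambda>\<omega>. c \<omega> j) \<in> measurable \<Omega> (Rd d)"
  using measurable_compose[OF c[unfolded codebook_space_def] measurable_component_singleton[OF j]] .

lemma measurable_edist_codepoint:
  assumes c: "c \<in> measurable \<Omega> (codebook_space d k)" and j: "j \<in> {1..k}"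
  shows "(\<lambda>p. edist d (snd p) (c (fst p) j)) \<in> borel_measurable (\<Omega> \<Otimes>\<^sub>M Rd d)"
  by (intro borel_measurable_edist measurable_snd measurable_compose[OF measurable_fst measurable_codepoint[OF c j]])

lemma measurable_indicator_cell:
  assumes c: "c \<in> measurable \<Omega> (codebook_space d k)" and j: "j \<in> {1..k}"
  shows "(\<lambda>(\<omega>, u). indicat_real (cell d k (c \<omega>) j) u) \<in> borel_measurable (\<Omega> \<Otimes>\<^sub>M Rd d)"
proof -
  have "{p \<in> space (\<Omega> \<Otimes>\<^sub>M Rd d). (\<forall>i\<in>{1..k}. i < j \<longrightarrow> edist d (snd p) (c (fst p) j) < edist d (snd p) (c (fst p) i)) \<and>
      (\<forall>i\<in>{1..k}. i > j \<longrightarrow> edist d (snd p) (c (fst p) j) \<le> edist d (snd p) (c (fst p) i))} \<in> sets (\<Omega> \<Otimes>\<^sub>M Rd d)"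
    by (rule sets_Collect_nearest[OF measurable_edist_codepoint[OF c] j])
  then have "(\<lambda>p. indicat_real {p \<in> space (\<Omega> \<Otimes>\<^sub>M Rd d).
      (\<forall>i\<in>{1..k}. i < j \<longrightarrow> edist d (snd p) (c (fst p) j) < edist d (snd p) (c (fst p) i)) \<and>
      (\<forall>i\<in>{1..k}. i > j \<longrightarrow> edist d (snd p) (c (fst p) j) \<le> edist d (snd p) (c (fst p) i))} p)
      \<in> borel_measurable (\<Omega> \<Otimes>\<^sub>M Rd d)"
    by (rule borel_measurable_indicator)
  then show ?thesis
  proof (rule measurable_cong[THEN iffD1, rotated], goal_cases)
    case (1 p)
    then show ?case by (cases p) (simp add: indicator_def cell_def space_pair_measure)
  qed
qed

lemma measurable_lloyd_step:
  assumes L: "L \<in> measurable \<Omega> (ball_measure_space d R M)" and M: "0 < M"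
    and c: "c \<in> measurable \<Omega> (codebook_space d k)"
  shows "(\<lambda>\<omega>. lloyd_step d k (L \<omega>) (c \<omega>)) \<in> measurable \<Omega> (codebook_space d k)"
proof -
  have Q: "L \<omega> \<in> ball_measures d R M" if "\<omega> \<in> space \<Omega>" for \<omega> by (rule measurable_ball_measure_spaceD(1)[OF L that])
  have mass: "(\<lambda>\<omega>. measure (L \<omega>) (cell d k (c \<omega>) j)) \<in> borel_measurable \<Omega>" if j: "j \<in> {1..k}" for j
  proof -
    have "(\<lambda>\<omega>. \<integral>u. indicat_real (cell d k (c \<omega>) j) u \<partial>L \<omega>) \<in> borel_measurable \<Omega>"
      by (rule borel_measurable_integral_kernel[OF L M measurable_indicator_cell[OF c j], of 1]) (auto simp: indicator_def)
    moreover have "(\<integral>u. indicat_real (cell d k (c \<omega>) j) u \<partial>L \<omega>) = measure (L \<omega>) (cell d k (c \<omega>) j)"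
      if "\<omega> \<in> space \<Omega>" for \<omega>
      using cell_subset_space[of d k "c \<omega>" j] ball_measuresD(2)[OF Q[OF that]] by (simp add: Int_absorb2)
    ultimately show ?thesis by (simp cong: measurable_cong)
  qed
  have mom: "(\<lambda>\<omega>. \<integral>u. u l * indicator (cell d k (c \<omega>) j) u \<partial>L \<omega>) \<in> borel_measurable \<Omega>"
    if j: "j \<in> {1..k}" and l: "l \<in> {1..d}" for j l
  proof (rule borel_measurable_integral_kernel[OF L M])
    have "(\<lambda>p. snd p l * (case p of (\<omega>, u) \<Rightarrow> indicat_real (cell d k (c \<omega>) j) u)) \<in> borel_measurable (\<Omega> \<Otimes>\<^sub>M Rd d)"
      by (intro borel_measurable_times measurable_indicator_cell[OF c j] borel_measurable_component[OF measurable_snd l])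
    then show "(\<lambda>(\<omega>, u). u l * indicator (cell d k (c \<omega>) j) u) \<in> borel_measurable (\<Omega> \<Otimes>\<^sub>M Rd d)"
      by (simp add: case_prod_beta')
    fix \<omega> u assume "u \<in> ball0 d R"
    then have "\<bar>u l\<bar> \<le> R" using component_le_edist_zero[OF l, of u] by (simp add: closed_ball_def)
    then show "\<bar>u l * indicator (cell d k (c \<omega>) j) u\<bar> \<le> R" by (auto simp: indicator_def)
  qed
  have "(\<lambda>\<omega>. if measure (L \<omega>) (cell d k (c \<omega>) j) = 0 then zero_vec d
     else (\<lambda>l\<in>{1..d}. (1 / measure (L \<omega>) (cell d k (c \<omega>) j)) *
            (\<integral>u. u l * indicator (cell d k (c \<omega>) j) u \<partial>L \<omega>))) \<in> measurable \<Omega> (Rd d)" if j: "j \<in> {1..k}" for j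
  proof (rule measurable_If)
    show "(\<lambda>\<omega>. zero_vec d) \<in> measurable \<Omega> (Rd d)"
      by (rule measurable_const) (auto simp: Rd_def space_PiM zero_vec_def)
    show "(\<lambda>\<omega>. \<lambda>l\<in>{1..d}. (1 / measure (L \<omega>) (cell d k (c \<omega>) j)) *
            (\<integral>u. u l * indicator (cell d k (c \<omega>) j) u \<partial>L \<omega>)) \<in> measurable \<Omega> (Rd d)"
      unfolding Rd_def[of d]
      by (intro measurable_restrict borel_measurable_times borel_measurable_divide borel_measurable_const
          mass[OF j] mom[unfolded Rd_def[of d], OF j])
    show "{\<omega> \<in> space \<Omega>. measure (L \<omega>) (cell d k (c \<omega>) j) = 0} \<in> sets \<Omega>"
      using borel_measurable_eq[OF mass[OF j] borel_measurable_const[of 0]] .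
  qed
  then show ?thesis unfolding lloyd_step_def codebook_space_def by (intro measurable_restrict)
qed

lemma measurable_lloyd_iterates:
  assumes L: "L \<in> measurable \<Omega> (ball_measure_space d R M)" and M: "0 < M"
    and c: "c \<in> measurable \<Omega> (codebook_space d k)"
  shows "(\<lambda>\<omega>. (lloyd_step d k (L \<omega>) ^^ m) (c \<omega>)) \<in> measurable \<Omega> (codebook_space d k)"
  by (induction m) (use c measurable_lloyd_step[OF L M] in auto)

lemma measurable_distortion:
  assumes \<mu>: "\<mu> \<in> ball_measures d R M" and c: "c \<in> measurable \<Omega> (codebook_space d k)" and k: "1 \<le> k"
  shows "(\<lambda>\<omega>. distortion d k \<mu> (c \<omega>)) \<in> borel_measurable \<Omega>"
proof -
  interpret finite_measure \<mu> using ball_measuresD(3)[OF \<mu>] .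
  have "(\<lambda>p. MIN j\<in>{1..k}. (edist d (snd p) (c (fst p) j))\<^sup>2) \<in> borel_measurable (\<Omega> \<Otimes>\<^sub>M Rd d)"
    by (intro borel_measurable_Min borel_measurable_power measurable_edist_codepoint[OF c]) auto
  then have "(\<lambda>(\<omega>, u). MIN j\<in>{1..k}. (edist d u (c \<omega> j))\<^sup>2) \<in> borel_measurable (\<Omega> \<Otimes>\<^sub>M \<mu>)"
    by (subst measurable_cong_sets[OF sets_pair_measure_cong[OF refl ball_measuresD(1)[OF \<mu>]] refl])
      (simp add: case_prod_beta')
  then show ?thesis unfolding distortion_def by (rule borel_measurable_lebesgue_integral)
qed

lemma sets_codebook_neighbourhood:
  assumes C: "finite C" "C \<subseteq> codebooks d k"
  shows "codebook_neighbourhood d k C t \<in> sets (codebook_space d k)"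
proof -
  have "{c \<in> codebooks d k. codebook_dist d k c' c \<le> t} \<in> sets (codebook_space d k)" if "c' \<in> C" for c'
  proof -
    have "(\<lambda>c. edist d (c' j) (c j)) \<in> borel_measurable (codebook_space d k)" if "j \<in> {1..k}" for j
      unfolding edist_commute[of d "c' j"]
      using measurable_compose[OF measurable_codepoint[OF measurable_ident_sets[OF refl] that] borel_measurable_edist_const]
      by simp
    then have "(\<lambda>c. \<Sum>j\<in>{1..k}. (edist d (c' j) (c j))\<^sup>2) \<in> borel_measurable (codebook_space d k)"
      by (intro borel_measurable_sum borel_measurable_power)
    then have "codebook_dist d k c' \<in> borel_measurable (codebook_space d k)"
      unfolding codebook_dist_def[abs_def] L2_set_def by measurable
    then show ?thesis by measurable
  qed
  then show ?thesis unfolding codebook_neighbourhood_def using C by (intro sets.finite_UN) auto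
qed


section \<open>Optimal codebooks and the Lloyd step\<close>

lemma sum_indicator_cell:
  assumes "u \<in> cell d k c i" "i \<in> {1..k}"
  shows "(\<Sum>j=1..k. h j * indicat_real (cell d k c j) u) = h i"
proof -
  have "u \<in> cell d k c j \<longleftrightarrow> j = i" if "j \<in> {1..k}" for j
    using cell_unique[OF assms(1) _ assms(2) that] assms(1) by metis
  then have "(\<Sum>j=1..k. h j * indicat_real (cell d k c j) u) = (\<Sum>j=1..k. if j = i then h j else 0)"
    by (intro sum.cong refl) (simp add: indicator_def)
  then show ?thesis using assms(2) by simp
qed

lemma ball0_space: "u \<in> ball0 d R \<Longrightarrow> u \<in> space (Rd d)"
  by (simp add: closed_ball_def)

lemma edist_ball0_le:
  assumes "u \<in> ball0 d R"
  shows "edist d u a \<le> R + edist d (zero_vec d) a"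
  using edist_triangle[of d u a "zero_vec d"] assms by (simp add: closed_ball_def edist_commute)

lemma edist_ball0_ball0_le: "u \<in> ball0 d R \<Longrightarrow> a \<in> ball0 d R \<Longrightarrow> edist d u a \<le> 2 * R"
  using edist_ball0_le[of u d R a] by (simp add: closed_ball_def)

lemma edist_zero_vec: "edist d (zero_vec d) a = L2_set a {1..d}"
  by (simp add: edist_def L2_set_def zero_vec_def)

lemma borel_measurable_indicator_cell:
  "j \<in> {1..k} \<Longrightarrow> indicat_real (cell d k c j) \<in> borel_measurable (Rd d)"
  by (intro borel_measurable_indicator sets_cell)

lemma borel_measurable_coord: "l \<in> {1..d} \<Longrightarrow> (\<lambda>u. u l) \<in> borel_measurable (Rd d)"
  by (intro borel_measurable_component measurable_ident_sets) auto

definition cell_offset ::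
    "nat \<Rightarrow> nat \<Rightarrow> (nat \<Rightarrow> real) measure \<Rightarrow> (nat \<Rightarrow> nat \<Rightarrow> real) \<Rightarrow> nat \<Rightarrow> nat \<Rightarrow> real" where
  "cell_offset d k Q c j l = (\<integral>u. (u l - c j l) * indicator (cell d k c j) u \<partial>Q)"

lemma integrable_offset:
  assumes Q: "Q \<in> ball_measures d R M" and jl: "j \<in> {1..k}" "l \<in> {1..d}"
  shows "integrable Q (\<lambda>u. (u l - a) * indicat_real (cell d k c j) u)"
proof (rule integrable_ball_measure[OF Q])
  show "(\<lambda>u. (u l - a) * indicat_real (cell d k c j) u) \<in> borel_measurable (Rd d)"
    using jl by (intro borel_measurable_times borel_measurable_diff borel_measurable_const
        borel_measurable_indicator_cell borel_measurable_coord)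
  fix u assume "u \<in> ball0 d R"
  then have "\<bar>u l\<bar> \<le> R" using component_le_edist_zero[OF jl(2), of u] by (simp add: closed_ball_def)
  then show "\<bar>(u l - a) * indicat_real (cell d k c j) u\<bar> \<le> R + \<bar>a\<bar>" by (auto simp: indicator_def)
qed

lemma integral_indicator_cell:
  assumes "Q \<in> ball_measures d R M"
  shows "(\<integral>u. indicat_real (cell d k c j) u \<partial>Q) = measure Q (cell d k c j)"
  using cell_subset_space[of d k c j] ball_measuresD(2)[OF assms] by (simp add: Int_absorb2)

lemma integrable_indicator_ball_measure:
  assumes Q: "Q \<in> ball_measures d R M" and A: "A \<in> sets (Rd d)"
  shows "integrable Q (indicat_real A)"
  using A by (intro integrable_ball_measure[OF Q, of _ 1] borel_measurable_indicator) (auto simp: indicator_def)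

text \<open>
  Keeping the cells of \<open>c\<close> but moving the codepoints to \<open>c'\<close> bounds the distortion of \<open>c'\<close> from
  above by a quadratic polynomial in the displacement.
\<close>

lemma distortion_le_quadratic:
  assumes Q: "Q \<in> ball_measures d R M" and k: "1 \<le> k"
  shows "distortion d k Q c' \<le> distortion d k Q c
    + (\<Sum>j=1..k. measure Q (cell d k c j) * (edist d (c' j) (c j))\<^sup>2
        - 2 * (\<Sum>l=1..d. (c' j l - c j l) * cell_offset d k Q c j l))"
proof -
  define h where "h = (\<lambda>j u. (edist d (c' j) (c j))\<^sup>2 * indicat_real (cell d k c j) u
    - 2 * (\<Sum>l=1..d. (c' j l - c j l) * ((u l - c j l) * indicat_real (cell d k c j) u)))"
  have MIN: "integrable Q (\<lambda>u. MIN j\<in>{1..k}. (edist d u (b j))\<^sup>2)" for b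
  proof (rule integrable_ball_measure[OF Q])
    show "(\<lambda>u. MIN j\<in>{1..k}. (edist d u (b j))\<^sup>2) \<in> borel_measurable (Rd d)"
      by (intro borel_measurable_Min borel_measurable_power borel_measurable_edist_const) auto
    fix u assume u: "u \<in> ball0 d R"
    obtain i where i: "i \<in> {1..k}" "u \<in> cell d k b i" using ex_cell[OF ball0_space[OF u] k] by blast
    have "1 \<in> {1..k}" using k by simp
    then have "edist d u (b i) \<le> R + edist d (zero_vec d) (b 1)"
      using cell_nearest[OF i(2), of 1] edist_ball0_le[OF u, of "b 1"] by linarith
    then show "\<bar>MIN j\<in>{1..k}. (edist d u (b j))\<^sup>2\<bar> \<le> (R + edist d (zero_vec d) (b 1))\<^sup>2"
      unfolding MIN_edist_cell[OF i(2,1)] by (simp add: power_mono)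
  qed
  have off: "integrable Q (\<lambda>u. (u l - c j l) * indicat_real (cell d k c j) u)"
    if "j \<in> {1..k}" "l \<in> {1..d}" for j l
    using that by (rule integrable_offset[OF Q])
  have ind: "integrable Q (indicat_real (cell d k c j))" if "j \<in> {1..k}" for j
    using sets_cell[OF that] by (rule integrable_indicator_ball_measure[OF Q])
  have offs: "integrable Q (\<lambda>u. \<Sum>l=1..d. (c' j l - c j l) * ((u l - c j l) * indicat_real (cell d k c j) u))"
    if "j \<in> {1..k}" for j
    using off[OF that] by (intro Bochner_Integration.integrable_sum integrable_mult_right) auto
  have hint: "integrable Q (h j)" if "j \<in> {1..k}" for j
    unfolding h_def using offs[OF that] ind[OF that]
    by (intro Bochner_Integration.integrable_diff integrable_mult_right) auto
  have hI: "(\<integral>u. h j u \<partial>Q) = measure Q (cell d k c j) * (edist d (c' j) (c j))\<^sup>2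
      - 2 * (\<Sum>l=1..d. (c' j l - c j l) * cell_offset d k Q c j l)" if j: "j \<in> {1..k}" for j
  proof -
    have "(\<integral>u. h j u \<partial>Q) = (\<integral>u. (edist d (c' j) (c j))\<^sup>2 * indicat_real (cell d k c j) u \<partial>Q)
      - (\<integral>u. 2 * (\<Sum>l=1..d. (c' j l - c j l) * ((u l - c j l) * indicat_real (cell d k c j) u)) \<partial>Q)"
      unfolding h_def using offs[OF j] ind[OF j] by (intro Bochner_Integration.integral_diff) auto
    also have "(\<integral>u. (edist d (c' j) (c j))\<^sup>2 * indicat_real (cell d k c j) u \<partial>Q)
        = measure Q (cell d k c j) * (edist d (c' j) (c j))\<^sup>2"
      unfolding integral_mult_right_zero integral_indicator_cell[OF Q] by (rule mult.commute)
    also have "(\<integral>u. 2 * (\<Sum>l=1..d. (c' j l - c j l) * ((u l - c j l) * indicat_real (cell d k c j) u)) \<partial>Q)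
        = 2 * (\<Sum>l=1..d. (c' j l - c j l) * cell_offset d k Q c j l)"
      unfolding integral_mult_right_zero cell_offset_def using off[OF j]
      by (subst Bochner_Integration.integral_sum) auto
    finally show ?thesis .
  qed
  have "distortion d k Q c' \<le> (\<integral>u. (MIN j\<in>{1..k}. (edist d u (c j))\<^sup>2) + (\<Sum>j=1..k. h j u) \<partial>Q)"
    unfolding distortion_def
  proof (rule integral_mono_AE)
    show "integrable Q (\<lambda>u. (MIN j\<in>{1..k}. (edist d u (c j))\<^sup>2) + (\<Sum>j=1..k. h j u))"
      using hint by (intro Bochner_Integration.integrable_add MIN Bochner_Integration.integrable_sum) auto
    show "AE u in Q. (MIN j\<in>{1..k}. (edist d u (c' j))\<^sup>2) \<le> (MIN j\<in>{1..k}. (edist d u (c j))\<^sup>2) + (\<Sum>j=1..k. h j u)"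
      using ball_measuresD(4)[OF Q]
    proof eventually_elim
      case (elim u)
      obtain i where i: "i \<in> {1..k}" "u \<in> cell d k c i" using ex_cell[OF ball0_space[OF elim] k] by blast
      have "(\<Sum>j=1..k. h j u) = (\<Sum>j=1..k. ((edist d (c' j) (c j))\<^sup>2
          - 2 * (\<Sum>l=1..d. (c' j l - c j l) * (u l - c j l))) * indicat_real (cell d k c j) u)"
        unfolding h_def by (intro sum.cong refl) (simp add: algebra_simps sum_distrib_left)
      also have "\<dots> = (edist d (c' i) (c i))\<^sup>2 - 2 * (\<Sum>l=1..d. (c' i l - c i l) * (u l - c i l))"
        by (rule sum_indicator_cell[OF i(2,1)])
      also have "\<dots> = (edist d u (c' i))\<^sup>2 - (edist d u (c i))\<^sup>2"
        unfolding edist_sq sum_distrib_left sum_subtractf[symmetric]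
        by (intro sum.cong refl) (simp add: power2_eq_square algebra_simps)
      finally have "(MIN j\<in>{1..k}. (edist d u (c j))\<^sup>2) + (\<Sum>j=1..k. h j u) = (edist d u (c' i))\<^sup>2"
        unfolding MIN_edist_cell[OF i(2,1)] by simp
      moreover have "(MIN j\<in>{1..k}. (edist d u (c' j))\<^sup>2) \<le> (edist d u (c' i))\<^sup>2"
        using i(1) by (intro Min_le) auto
      ultimately show ?case by simp
    qed
  qed (rule MIN)
  also have "\<dots> = distortion d k Q c + (\<Sum>j=1..k. \<integral>u. h j u \<partial>Q)"
    unfolding distortion_def using hint
    by (subst Bochner_Integration.integral_add[OF MIN])
      (auto simp: Bochner_Integration.integral_sum)
  also have "(\<Sum>j=1..k. \<integral>u. h j u \<partial>Q) = (\<Sum>j=1..k. measure Q (cell d k c j) * (edist d (c' j) (c j))\<^sup>2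
        - 2 * (\<Sum>l=1..d. (c' j l - c j l) * cell_offset d k Q c j l))"
    by (intro sum.cong refl hI)
  finally show ?thesis .
qed

text \<open>
  The codepoints of an optimal codebook are the centroids of their cells: moving each of them to
  the centroid would otherwise decrease the quadratic upper bound, and hence the distortion.
\<close>

lemma cell_offset_C_opt:
  assumes Q: "Q \<in> ball_measures d R M" and k: "1 \<le> k" and c: "c \<in> C_opt d k Q"
    and pos: "\<And>j. j \<in> {1..k} \<Longrightarrow> 0 < measure Q (cell d k c j)"
    and jl: "j \<in> {1..k}" "l \<in> {1..d}"
  shows "cell_offset d k Q c j l = 0"
proof -
  define m where "m = (\<lambda>j. measure Q (cell d k c j))"
  define D where "D = cell_offset d k Q c"
  define c' where "c' = (\<lambda>j\<in>{1..k}. \<lambda>l\<in>{1..d}. c j l + D j l / m j)"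
  have "c' \<in> codebooks d k" by (auto simp: c'_def codebook_space_def Rd_def space_PiM)
  then have "distortion d k Q c \<le> distortion d k Q c'" using c by (simp add: C_opt_def)
  also have "\<dots> \<le> distortion d k Q c
    + (\<Sum>j=1..k. m j * (edist d (c' j) (c j))\<^sup>2 - 2 * (\<Sum>l=1..d. (c' j l - c j l) * D j l))"
    unfolding m_def D_def by (rule distortion_le_quadratic[OF Q k])
  also have "(\<Sum>j=1..k. m j * (edist d (c' j) (c j))\<^sup>2 - 2 * (\<Sum>l=1..d. (c' j l - c j l) * D j l))
      = (\<Sum>j=1..k. \<Sum>l=1..d. - ((D j l)\<^sup>2 / m j))"
  proof (rule sum.cong[OF refl])
    fix j assume j: "j \<in> {1..k}"
    have "m j * (edist d (c' j) (c j))\<^sup>2 - 2 * (\<Sum>l=1..d. (c' j l - c j l) * D j l)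
      = (\<Sum>l=1..d. m j * (D j l / m j)\<^sup>2 - 2 * (D j l / m j * D j l))"
      unfolding edist_sq sum_distrib_left sum_subtractf[symmetric]
      using j by (intro sum.cong refl) (simp add: c'_def)
    also have "\<dots> = (\<Sum>l=1..d. - ((D j l)\<^sup>2 / m j))"
      using pos[OF j] by (intro sum.cong refl) (simp add: m_def power2_eq_square field_simps)
    finally show "m j * (edist d (c' j) (c j))\<^sup>2 - 2 * (\<Sum>l=1..d. (c' j l - c j l) * D j l)
      = (\<Sum>l=1..d. - ((D j l)\<^sup>2 / m j))" .
  qed
  finally have le: "(\<Sum>j=1..k. \<Sum>l=1..d. (D j l)\<^sup>2 / m j) \<le> 0" by (simp add: sum_negf)
  have nn: "0 \<le> (D j l)\<^sup>2 / m j" for j l by (simp add: m_def)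
  have "(\<Sum>l=1..d. (D j l)\<^sup>2 / m j) \<le> (\<Sum>j=1..k. \<Sum>l=1..d. (D j l)\<^sup>2 / m j)"
    using jl(1) nn by (intro member_le_sum sum_nonneg) auto
  moreover have "(D j l)\<^sup>2 / m j \<le> (\<Sum>l=1..d. (D j l)\<^sup>2 / m j)"
    using jl(2) nn by (intro member_le_sum) auto
  ultimately have "(D j l)\<^sup>2 / m j = 0" using le nn[of j l] by linarith
  then show ?thesis using pos[OF jl(1)] by (simp add: D_def m_def)
qed

lemma C_opt_in_ball:
  assumes Q: "Q \<in> ball_measures d R M" and k: "1 \<le> k" and c: "c \<in> C_opt d k Q"
    and pos: "\<And>j. j \<in> {1..k} \<Longrightarrow> 0 < measure Q (cell d k c j)" and j: "j \<in> {1..k}"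
  shows "c j \<in> ball0 d R"
proof -
  define m where "m = measure Q (cell d k c j)"
  have m: "0 < m" using pos[OF j] by (simp add: m_def)
  have ind: "integrable Q (indicat_real (cell d k c j))"
    using sets_cell[OF j] by (rule integrable_indicator_ball_measure[OF Q])
  have mean: "m * c j l = (\<integral>u. u l * indicat_real (cell d k c j) u \<partial>Q)" if l: "l \<in> {1..d}" for l
  proof -
    have "0 = (\<integral>u. (u l - c j l) * indicat_real (cell d k c j) u \<partial>Q)"
      using cell_offset_C_opt[OF Q k c pos j l] by (simp add: cell_offset_def)
    also have "\<dots> = (\<integral>u. u l * indicat_real (cell d k c j) u - c j l * indicat_real (cell d k c j) u \<partial>Q)"
      by (simp add: algebra_simps)
    also have "\<dots> = (\<integral>u. u l * indicat_real (cell d k c j) u \<partial>Q) - c j l * m"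
      using integrable_offset[OF Q j l, of 0 c] ind integral_indicator_cell[OF Q, of k c j]
      by (subst Bochner_Integration.integral_diff) (auto simp: m_def)
    finally show ?thesis by (simp add: mult.commute)
  qed
  have "m * L2_set (c j) {1..d} = L2_set (\<lambda>l. m * c j l) {1..d}"
    using m by (simp add: L2_set_right_distrib)
  also have "\<dots> = L2_set (\<lambda>l. \<integral>u. u l * indicat_real (cell d k c j) u \<partial>Q) {1..d}"
    by (intro L2_set_cong refl mean)
  also have "\<dots> \<le> (\<integral>u. R * indicat_real (cell d k c j) u \<partial>Q)"
  proof (rule L2_set_integral_le)
    show "AE u in Q. L2_set (\<lambda>l. u l * indicat_real (cell d k c j) u) {1..d} \<le> R * indicat_real (cell d k c j) u"
      using ball_measuresD(4)[OF Q]
    proof eventually_elim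
      case (elim u)
      then show ?case
        by (cases "u \<in> cell d k c j") (auto simp: closed_ball_def edist_zero_vec L2_set_def)
    qed
  qed (use integrable_offset[OF Q j, of _ 0 c] ind in auto)
  also have "\<dots> = m * R" unfolding integral_mult_right_zero integral_indicator_cell[OF Q] by (simp add: m_def)
  finally have "L2_set (c j) {1..d} \<le> R" using m by simp
  moreover have "c j \<in> space (Rd d)" using c j by (auto simp: C_opt_def codebook_space_def space_PiM)
  ultimately show ?thesis by (simp add: closed_ball_def edist_zero_vec)
qed

lemma codebook_dist_sq: "(codebook_dist d k c c')\<^sup>2 = (\<Sum>j=1..k. (edist d (c j) (c' j))\<^sup>2)"
  by (simp add: codebook_dist_def L2_set_def sum_nonneg)

lemma codebook_dist_nonneg [simp]: "0 \<le> codebook_dist d k c c'"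
  by (simp add: codebook_dist_def)

lemma codebook_dist_0_imp_eq:
  assumes "c \<in> codebooks d k" "c' \<in> codebooks d k" "codebook_dist d k c c' = 0"
  shows "c = c'"
proof -
  have "c j l = c' j l" if "j \<in> {1..k}" "l \<in> {1..d}" for j l
  proof -
    have "edist d (c j) (c' j) = 0"
      using edist_le_codebook_dist[OF that(1), of d c c'] assms(3) edist_nonneg[of d "c j" "c' j"] by linarith
    then show ?thesis using that(2) by (simp add: edist_def L2_set_eq_0_iff)
  qed
  moreover have "c j l = c' j l" if "j \<in> {1..k}" "l \<notin> {1..d}" for j l
    using assms(1,2) that
    by (auto simp: codebook_space_def Rd_def space_PiM PiE_iff extensional_def)
  ultimately have "c j = c' j" if "j \<in> {1..k}" for j using that by blast
  then show ?thesis
    using assms(1,2) by (intro PiE_ext[of c "{1..k}" "\<lambda>_. space (Rd d)" c']) (auto simp: codebook_space_def space_PiM)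
qed

text \<open>
  At an optimal codebook the linear term of the quadratic upper bound vanishes.
\<close>

lemma distortion_excess_le:
  assumes Q: "Q \<in> ball_measures d R M" and k: "1 \<le> k" and c: "c \<in> C_opt d k Q"
    and pos: "\<And>j. j \<in> {1..k} \<Longrightarrow> 0 < measure Q (cell d k c j)"
  shows "distortion d k Q c' - distortion d k Q c \<le> measure Q (space Q) * (codebook_dist d k c c')\<^sup>2"
proof -
  interpret finite_measure Q using ball_measuresD(3)[OF Q] .
  have "distortion d k Q c' - distortion d k Q c \<le> (\<Sum>j=1..k. measure Q (cell d k c j) * (edist d (c' j) (c j))\<^sup>2)"
    using distortion_le_quadratic[OF Q k, of c' c] cell_offset_C_opt[OF Q k c pos] by simp
  also have "\<dots> \<le> (\<Sum>j=1..k. measure Q (space Q) * (edist d (c j) (c' j))\<^sup>2)"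
    unfolding edist_commute[of d "c _"] by (intro sum_mono mult_right_mono bounded_measure) auto
  finally show ?thesis by (simp add: codebook_dist_sq sum_distrib_left)
qed

lemma sum_indicator_cell_diff:
  assumes u: "u \<in> space (Rd d)" and k: "1 \<le> k"
  shows "(\<Sum>j=1..k. \<bar>indicat_real (cell d k c j) u - indicat_real (cell d k c' j) u\<bar>)
    = 2 * indicat_real (mismatch d k c c') u"
proof -
  obtain i where i: "i \<in> {1..k}" "u \<in> cell d k c i" using ex_cell[OF u k] by blast
  obtain i' where i': "i' \<in> {1..k}" "u \<in> cell d k c' i'" using ex_cell[OF u k] by blast
  have c: "u \<in> cell d k c j \<longleftrightarrow> j = i" if "j \<in> {1..k}" for j
    using cell_unique[OF i(2) _ i(1) that] i(2) by metis
  have c': "u \<in> cell d k c' j \<longleftrightarrow> j = i'" if "j \<in> {1..k}" for j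
    using cell_unique[OF i'(2) _ i'(1) that] i'(2) by metis
  have mis: "u \<in> mismatch d k c c' \<longleftrightarrow> i \<noteq> i'"
    unfolding mismatch_def using c c' i(1) i'(1) by auto
  have "(\<Sum>j=1..k. \<bar>indicat_real (cell d k c j) u - indicat_real (cell d k c' j) u\<bar>)
      = (\<Sum>j=1..k. (if j = i then of_bool (i \<noteq> i') else 0) + (if j = i' then of_bool (i \<noteq> i') else 0))"
    using c c' by (intro sum.cong refl) (auto simp: indicator_def)
  also have "\<dots> = 2 * of_bool (i \<noteq> i')" using i(1) i'(1) by (simp add: sum.distrib)
  finally show ?thesis using mis by (simp add: indicator_def)
qed

text \<open>
  One step of Lloyd's algorithm under an arbitrary measure \<open>Q\<close>: the new codepoints differ from
  \<open>a\<close> by how far \<open>a\<close> is from being a centroid for \<open>Q\<close>, and by the mass that changes cell.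
\<close>

lemma lloyd_step_dist_le:
  assumes Q: "Q \<in> ball_measures d R M" and k: "1 \<le> k" and R: "0 \<le> R"
    and a: "\<And>j. j \<in> {1..k} \<Longrightarrow> a j \<in> ball0 d R"
    and q: "0 < q" "\<And>j. j \<in> {1..k} \<Longrightarrow> q \<le> measure Q (cell d k c j)"
  shows "q * codebook_dist d k a (lloyd_step d k Q c)
    \<le> L2_set (\<lambda>j. L2_set (cell_offset d k Q a j) {1..d}) {1..k} + 4 * R * measure Q (mismatch d k a c)"
proof -
  define m where "m = (\<lambda>j. measure Q (cell d k c j))"
  define e where "e = (\<lambda>j. L2_set (cell_offset d k Q a j) {1..d})"
  define \<delta> where "\<delta> = (\<lambda>j. \<integral>u. \<bar>indicat_real (cell d k c j) u - indicat_real (cell d k a j) u\<bar> \<partial>Q)"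
  have ind: "integrable Q (indicat_real (cell d k b j))" if "j \<in> {1..k}" for b j
    using sets_cell[OF that] by (rule integrable_indicator_ball_measure[OF Q])
  have dint: "integrable Q (\<lambda>u. \<bar>indicat_real (cell d k c j) u - indicat_real (cell d k a j) u\<bar>)"
    if "j \<in> {1..k}" for j using ind[OF that] by auto
  have \<delta>0: "0 \<le> \<delta> j" for j by (simp add: \<delta>_def)
  have step: "q * edist d (a j) (lloyd_step d k Q c j) \<le> e j + 2 * R * \<delta> j" if j: "j \<in> {1..k}" for j
  proof -
    have m: "0 < m j" "q \<le> m j" using q(1) q(2)[OF j] by (auto simp: m_def)
    have off: "integrable Q (\<lambda>u. (u l - a j l) * indicat_real (cell d k b j) u)" if "l \<in> {1..d}" for l b
      by (rule integrable_offset[OF Q j that])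
    have comp: "m j * (lloyd_step d k Q c j l - a j l) = cell_offset d k Q a j l
        + (\<integral>u. (u l - a j l) * (indicat_real (cell d k c j) u - indicat_real (cell d k a j) u) \<partial>Q)"
      if l: "l \<in> {1..d}" for l
    proof -
      have "m j * lloyd_step d k Q c j l = (\<integral>u. u l * indicat_real (cell d k c j) u \<partial>Q)"
        using m j l by (simp add: lloyd_step_def m_def)
      moreover have "(\<integral>u. (u l - a j l) * indicat_real (cell d k c j) u \<partial>Q)
          = (\<integral>u. u l * indicat_real (cell d k c j) u \<partial>Q) - a j l * m j"
      proof -
        have "(\<integral>u. (u l - a j l) * indicat_real (cell d k c j) u \<partial>Q)
            = (\<integral>u. u l * indicat_real (cell d k c j) u - a j l * indicat_real (cell d k c j) u \<partial>Q)"
          by (simp add: algebra_simps)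
        also have "\<dots> = (\<integral>u. u l * indicat_real (cell d k c j) u \<partial>Q) - a j l * m j"
          using integrable_offset[OF Q j l, of 0 c] ind[OF j] integral_indicator_cell[OF Q, of k c j]
          by (subst Bochner_Integration.integral_diff) (auto simp: m_def)
        finally show ?thesis .
      qed
      moreover have "(\<integral>u. (u l - a j l) * indicat_real (cell d k c j) u \<partial>Q) = cell_offset d k Q a j l
        + (\<integral>u. (u l - a j l) * (indicat_real (cell d k c j) u - indicat_real (cell d k a j) u) \<partial>Q)"
        unfolding cell_offset_def right_diff_distrib using off[OF l]
        by (subst Bochner_Integration.integral_diff) auto
      ultimately show ?thesis by (simp add: right_diff_distrib mult.commute)
    qed
    have "q * edist d (a j) (lloyd_step d k Q c j) \<le> m j * edist d (lloyd_step d k Q c j) (a j)"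
      unfolding edist_commute[of d "a j"] using m by (intro mult_right_mono) auto
    also have "\<dots> = L2_set (\<lambda>l. m j * (lloyd_step d k Q c j l - a j l)) {1..d}"
      unfolding edist_def using m by (simp add: L2_set_right_distrib)
    also have "\<dots> = L2_set (\<lambda>l. cell_offset d k Q a j l
        + (\<integral>u. (u l - a j l) * (indicat_real (cell d k c j) u - indicat_real (cell d k a j) u) \<partial>Q)) {1..d}"
      by (intro L2_set_cong refl comp)
    also have "\<dots> \<le> e j + L2_set (\<lambda>l. \<integral>u. (u l - a j l) * (indicat_real (cell d k c j) u - indicat_real (cell d k a j) u) \<partial>Q) {1..d}"
      unfolding e_def by (rule L2_set_triangle_ineq)
    also have "L2_set (\<lambda>l. \<integral>u. (u l - a j l) * (indicat_real (cell d k c j) u - indicat_real (cell d k a j) u) \<partial>Q) {1..d}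
        \<le> (\<integral>u. 2 * R * \<bar>indicat_real (cell d k c j) u - indicat_real (cell d k a j) u\<bar> \<partial>Q)"
    proof (rule L2_set_integral_le)
      show "integrable Q (\<lambda>u. (u l - a j l) * (indicat_real (cell d k c j) u - indicat_real (cell d k a j) u))"
        if "l \<in> {1..d}" for l
        unfolding right_diff_distrib by (intro Bochner_Integration.integrable_diff off that)
      show "AE u in Q. L2_set (\<lambda>l. (u l - a j l) * (indicat_real (cell d k c j) u - indicat_real (cell d k a j) u)) {1..d}
          \<le> 2 * R * \<bar>indicat_real (cell d k c j) u - indicat_real (cell d k a j) u\<bar>"
        using ball_measuresD(4)[OF Q]
      proof eventually_elim
        case (elim u)
        define t where "t = indicat_real (cell d k c j) u - indicat_real (cell d k a j) u"
        have "L2_set (\<lambda>l. (u l - a j l) * t) {1..d} = edist d u (a j) * \<bar>t\<bar>"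
          by (simp add: edist_def L2_set_def power_mult_distrib sum_distrib_right[symmetric] real_sqrt_mult)
        also have "\<dots> \<le> 2 * R * \<bar>t\<bar>"
          using edist_ball0_ball0_le[OF elim a[OF j]] by (intro mult_right_mono) auto
        finally show ?case by (simp add: t_def)
      qed
    qed (use dint[OF j] in auto)
    finally show ?thesis by (simp add: \<delta>_def)
  qed
  have "q * codebook_dist d k a (lloyd_step d k Q c) = L2_set (\<lambda>j. q * edist d (a j) (lloyd_step d k Q c j)) {1..k}"
    unfolding codebook_dist_def using q by (simp add: L2_set_right_distrib)
  also have "\<dots> \<le> L2_set (\<lambda>j. e j + 2 * R * \<delta> j) {1..k}"
    using q by (intro L2_set_mono step) auto
  also have "\<dots> \<le> L2_set e {1..k} + L2_set (\<lambda>j. 2 * R * \<delta> j) {1..k}" by (rule L2_set_triangle_ineq)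
  also have "L2_set (\<lambda>j. 2 * R * \<delta> j) {1..k} \<le> (\<Sum>j=1..k. 2 * R * \<delta> j)"
    using R \<delta>0 by (intro L2_set_le_sum) auto
  also have "\<dots> = 2 * R * (\<Sum>j=1..k. \<delta> j)" by (rule sum_distrib_left[symmetric])
  also have "(\<Sum>j=1..k. \<delta> j) = (\<integral>u. (\<Sum>j=1..k. \<bar>indicat_real (cell d k c j) u - indicat_real (cell d k a j) u\<bar>) \<partial>Q)"
    unfolding \<delta>_def using dint by (intro Bochner_Integration.integral_sum[symmetric]) auto
  also have "\<dots> = (\<integral>u. 2 * indicat_real (mismatch d k c a) u \<partial>Q)"
    using sum_indicator_cell_diff[OF _ k] ball_measuresD(2)[OF Q] by (intro Bochner_Integration.integral_cong) auto
  also have "\<dots> = 2 * measure Q (mismatch d k a c)"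
    unfolding mismatch_commute[of d k c a]
    using sets_mismatch[of d k a c] sets.sets_into_space ball_measuresD(2)[OF Q]
    by (simp add: Int_absorb2)
  finally show ?thesis by (simp add: e_def)
qed

lemma measure_cell_ge:
  assumes Q: "Q \<in> ball_measures d R M" and j: "j \<in> {1..k}"
  shows "measure Q (cell d k a j) - measure Q (mismatch d k a c) \<le> measure Q (cell d k c j)"
proof -
  interpret finite_measure Q using ball_measuresD(3)[OF Q] .
  have s: "cell d k c j \<in> sets Q" "mismatch d k a c \<in> sets Q"
    using sets_cell[OF j] sets_mismatch ball_measuresD(1)[OF Q] by auto
  have "cell d k a j \<subseteq> cell d k c j \<union> mismatch d k a c"
  proof
    fix u assume "u \<in> cell d k a j"
    then have "u \<in> mismatch d k c a \<or> u \<in> cell d k c j"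
      unfolding mismatch_def using j by (auto simp del: atLeastAtMost_iff)
    then show "u \<in> cell d k c j \<union> mismatch d k a c" unfolding mismatch_commute[of d k c a] by blast
  qed
  then have "measure Q (cell d k a j) \<le> measure Q (cell d k c j \<union> mismatch d k a c)"
    using s by (intro finite_measure_mono) auto
  also have "\<dots> \<le> measure Q (cell d k c j) + measure Q (mismatch d k a c)"
    using s by (intro measure_Un_le)
  finally show ?thesis by simp
qed

text \<open>
  If \<open>s\<close> is a small multiple of \<open>q \<delta> / R\<close>, this says that one step contracts the distance to \<open>a\<close> up
  to the error made by the centroids of the cells of \<open>a\<close> itself.
\<close>

lemma lloyd_step_contraction:
  assumes Q: "Q \<in> ball_measures d R M" and k: "1 \<le> k" and R: "0 \<le> R"
    and a: "\<And>j. j \<in> {1..k} \<Longrightarrow> a j \<in> ball0 d R"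
    and B: "0 < B" "\<And>i j. i \<in> {1..k} \<Longrightarrow> j \<in> {1..k} \<Longrightarrow> i \<noteq> j \<Longrightarrow> B \<le> edist d (a i) (a j)"
    and \<delta>: "codebook_dist d k a c \<le> \<delta>" "\<delta> \<le> R / 2"
    and s: "measure Q (strip d k a (4 * R * \<delta> / B)) \<le> s"
    and q: "0 < q" "\<And>j. j \<in> {1..k} \<Longrightarrow> q + s \<le> measure Q (cell d k a j)"
  shows "q * codebook_dist d k a (lloyd_step d k Q c)
    \<le> L2_set (\<lambda>j. L2_set (cell_offset d k Q a j) {1..d}) {1..k} + 4 * R * s"
proof -
  interpret finite_measure Q using ball_measuresD(3)[OF Q] .
  have "measure Q (mismatch d k a c) \<le> measure Q (strip d k a (4 * R * \<delta> / B))"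
  proof (rule finite_measure_mono_AE)
    show "AE u in Q. u \<in> mismatch d k a c \<longrightarrow> u \<in> strip d k a (4 * R * \<delta> / B)"
      using ball_measuresD(4)[OF Q]
      by eventually_elim (auto intro: mismatch_subset_strip[OF _ _ a B \<delta>])
    show "strip d k a (4 * R * \<delta> / B) \<in> sets Q" using sets_strip ball_measuresD(1)[OF Q] by blast
  qed
  then have mis: "measure Q (mismatch d k a c) \<le> s" using s by linarith
  have "q \<le> measure Q (cell d k c j)" if j: "j \<in> {1..k}" for j
    using measure_cell_ge[OF Q j, of a c] q(2)[OF j] mis by linarith
  from lloyd_step_dist_le[OF Q k R a q(1) this]
  have "q * codebook_dist d k a (lloyd_step d k Q c)
    \<le> L2_set (\<lambda>j. L2_set (cell_offset d k Q a j) {1..d}) {1..k} + 4 * R * measure Q (mismatch d k a c)" .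
  also have "\<dots> \<le> L2_set (\<lambda>j. L2_set (cell_offset d k Q a j) {1..d}) {1..k} + 4 * R * s"
    using mis R by (intro add_left_mono mult_left_mono) auto
  finally show ?thesis .
qed

lemma lloyd_step_C_opt:
  assumes Q: "Q \<in> ball_measures d R M" and k: "1 \<le> k" and c: "c \<in> C_opt d k Q"
    and pos: "\<And>j. j \<in> {1..k} \<Longrightarrow> 0 < measure Q (cell d k c j)" and R: "0 \<le> R"
  shows "lloyd_step d k Q c = c"
proof (rule codebook_dist_0_imp_eq[symmetric])
  show cc: "c \<in> codebooks d k" using c by (simp add: C_opt_def)
  show "lloyd_step d k Q c \<in> codebooks d k"
    by (auto simp: lloyd_step_def codebook_space_def Rd_def space_PiM zero_vec_def)
  define q where "q = Min ((\<lambda>j. measure Q (cell d k c j)) ` {1..k})"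
  have ne: "{1..k} \<noteq> {}" using k by auto
  have q: "0 < q" "\<And>j. j \<in> {1..k} \<Longrightarrow> q \<le> measure Q (cell d k c j)"
    using pos ne by (auto simp: q_def)
  have "L2_set (\<lambda>j. L2_set (cell_offset d k Q c j) {1..d}) {1..k} = 0"
    using cell_offset_C_opt[OF Q k c pos] by (simp add: L2_set_eq_0_iff)
  moreover have "mismatch d k c c = {}" by (simp add: mismatch_def)
  moreover have "q * codebook_dist d k c (lloyd_step d k Q c)
      \<le> L2_set (\<lambda>j. L2_set (cell_offset d k Q c j) {1..d}) {1..k} + 4 * R * measure Q (mismatch d k c c)"
    by (rule lloyd_step_dist_le[OF Q k R _ q]) (rule C_opt_in_ball[OF Q k c pos])
  ultimately have "q * codebook_dist d k c (lloyd_step d k Q c) \<le> 0" by simp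
  then show "codebook_dist d k c (lloyd_step d k Q c) = 0"
    using q(1) codebook_dist_nonneg[of d k c "lloyd_step d k Q c"] by (simp add: mult_le_0_iff)
qed


section \<open>Consequences of the margin condition\<close>

locale margin_setting =
  fixes d k :: nat and R M r0 :: real and \<mu> :: "(nat \<Rightarrow> real) measure"
  assumes d: "1 \<le> d" and k: "2 \<le> k" and R: "0 < R" and M: "0 < M"
    and \<mu>: "\<mu> \<in> ball_measures d R M" and r0: "0 < r0" and margin: "margin_condition d k R \<mu> r0"
    and C_opt_nonempty: "C_opt d k \<mu> \<noteq> {}" and B_pos: "0 < B_sep d k \<mu>" and p_pos: "0 < p_min d k \<mu>"
begin

abbreviation "B \<equiv> B_sep d k \<mu>"
abbreviation "p \<equiv> p_min d k \<mu>"
abbreviation "C \<equiv> C_opt d k \<mu>"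
definition "R0 = B * r0 / (16 * sqrt 2 * R)"

sublocale \<mu>: finite_measure \<mu> using ball_measuresD(3)[OF \<mu>] .

lemma k1: "1 \<le> k" using k by simp

lemma B_le: "c \<in> C \<Longrightarrow> i \<in> {1..k} \<Longrightarrow> j \<in> {1..k} \<Longrightarrow> i \<noteq> j \<Longrightarrow> B \<le> edist d (c i) (c j)"
  unfolding B_sep_def by (rule cInf_lower) (auto intro!: bdd_belowI[of _ 0])

lemma p_le: "c \<in> C \<Longrightarrow> j \<in> {1..k} \<Longrightarrow> p \<le> measure \<mu> (cell d k c j)"
  unfolding p_min_def by (rule cInf_lower) (auto intro!: bdd_belowI[of _ 0])

lemma cell_pos: "c \<in> C \<Longrightarrow> j \<in> {1..k} \<Longrightarrow> 0 < measure \<mu> (cell d k c j)"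
  using p_le p_pos by (rule less_le_trans[rotated])

lemma in_ball: "c \<in> C \<Longrightarrow> j \<in> {1..k} \<Longrightarrow> c j \<in> ball0 d R"
  by (rule C_opt_in_ball[OF \<mu> k1 _ cell_pos])

lemma in_codebooks: "c \<in> C \<Longrightarrow> c \<in> codebooks d k"
  by (simp add: C_opt_def)

lemma strip_le:
  assumes c: "c \<in> C" and t: "0 \<le> t" "t \<le> r0"
  shows "measure \<mu> (strip d k c t) \<le> B * p / (128 * R\<^sup>2) * t"
proof -
  have "measure \<mu> (strip d k c t) = measure \<mu> (neighbourhood d (cell_boundary d k c) t)"
    using B_le[OF c] B_pos
    by (subst neighbourhood_cell_boundary_eq_strip[OF _ t(1) in_codebooks[OF c]]) (auto intro: less_le_trans)
  also have "\<dots> \<le> (SUP c\<in>C. measure \<mu> (neighbourhood d (cell_boundary d k c) t))"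
    using c by (intro cSUP_upper bdd_aboveI2[of _ _ "measure \<mu> (space \<mu>)"] \<mu>.bounded_measure)
  also have "\<dots> \<le> B * p / (128 * R\<^sup>2) * t"
    using margin t by (simp add: margin_condition_def)
  finally show ?thesis .
qed

lemma p_le_mass: "p \<le> measure \<mu> (space \<mu>)"
proof -
  obtain c where "c \<in> C" using C_opt_nonempty by blast
  then show ?thesis using p_le[of c 1] \<mu>.bounded_measure[of "cell d k c 1"] k by auto
qed

lemma mass_le: "measure \<mu> (space \<mu>) \<le> M"
  using ball_measuresD(5)[OF \<mu>] M by simp

lemma B_le_2R: "B \<le> 2 * R"
proof -
  obtain c where c: "c \<in> C" using C_opt_nonempty by blast
  have "B \<le> edist d (c 1) (c 2)" using k by (intro B_le[OF c]) auto
  also have "\<dots> \<le> 2 * R" using k by (intro edist_ball0_ball0_le in_ball[OF c]) auto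
  finally show ?thesis .
qed

text \<open>Every point of the ball is within \<open>2 R\<close> of a cell boundary, so a margin that wide would contain
  the whole mass.\<close>

lemma r0_less: "r0 < 2 * R"
proof (rule ccontr)
  assume "\<not> r0 < 2 * R"
  then have r: "2 * R \<le> r0" by simp
  obtain c where c: "c \<in> C" using C_opt_nonempty by blast
  have sub: "ball0 d R \<subseteq> strip d k c (2 * R)" by (rule ball_subset_strip[OF k]) (rule in_ball[OF c])
  have s: "strip d k c (2 * R) \<in> sets \<mu>" using sets_strip ball_measuresD(1)[OF \<mu>] by blast
  have "measure \<mu> (space \<mu>) \<le> measure \<mu> (strip d k c (2 * R))"
  proof (rule \<mu>.finite_measure_mono_AE[OF _ s])
    show "AE u in \<mu>. u \<in> space \<mu> \<longrightarrow> u \<in> strip d k c (2 * R)"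
      using ball_measuresD(4)[OF \<mu>] by eventually_elim (use sub in blast)
  qed
  also have "\<dots> \<le> B * p / (128 * R\<^sup>2) * (2 * R)" using R r by (intro strip_le[OF c]) auto
  also have "\<dots> = B / (64 * R) * p" using R by (simp add: power2_eq_square)
  also have "\<dots> \<le> 1 / 32 * p" using B_le_2R R p_pos by (intro mult_right_mono) (auto simp: field_simps)
  finally show False using p_le_mass p_pos by simp
qed

lemma sqrt2: "1 \<le> sqrt (2 :: real)" by simp

lemma R0_pos: "0 < R0" using B_pos r0 R by (simp add: R0_def)

lemma R0_le: "R0 \<le> R / 2"
proof -
  have "B * r0 \<le> (2 * R) * (2 * R)"
    using B_le_2R r0_less B_pos r0 R by (intro mult_mono) auto
  also have "\<dots> \<le> R / 2 * (16 * sqrt 2 * R)"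
  proof -
    have "R * R * 1 \<le> R * R * sqrt 2" "0 \<le> R * R" using R by (auto intro!: mult_left_mono)
    moreover have "R / 2 * (16 * sqrt 2 * R) = 8 * (R * R * sqrt 2)" by simp
    ultimately show ?thesis by linarith
  qed
  finally show ?thesis using R by (simp add: R0_def field_simps)
qed

lemma radius_le:
  assumes "0 \<le> \<delta>" "\<delta> \<le> R0"
  shows "4 * R * \<delta> / B \<le> r0 / 2"
proof -
  have "4 * R * \<delta> / B \<le> 4 * R * R0 / B"
    using assms R B_pos by (intro divide_right_mono mult_left_mono) auto
  also have "\<dots> = r0 / (4 * sqrt 2)" using R B_pos by (simp add: R0_def field_simps)
  also have "\<dots> \<le> r0 / 2" using r0 by (intro divide_left_mono) (auto intro: order_trans[OF _ mult_left_mono[OF sqrt2]])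
  finally show ?thesis .
qed

lemma strip_radius_le:
  assumes "c \<in> C" "0 \<le> \<delta>" "\<delta> \<le> R0"
  shows "measure \<mu> (strip d k c (4 * R * \<delta> / B)) \<le> p * \<delta> / (32 * R)"
proof -
  have "measure \<mu> (strip d k c (4 * R * \<delta> / B)) \<le> B * p / (128 * R\<^sup>2) * (4 * R * \<delta> / B)"
    using radius_le[OF assms(2,3)] assms R B_pos r0 by (intro strip_le) auto
  also have "\<dots> = p * \<delta> / (32 * R)" using R B_pos by (simp add: field_simps power2_eq_square)
  finally show ?thesis .
qed

lemma offset_0: "c \<in> C \<Longrightarrow> L2_set (\<lambda>j. L2_set (cell_offset d k \<mu> c j) {1..d}) {1..k} = 0"
  using cell_offset_C_opt[OF \<mu> k1 _ cell_pos] by (simp add: L2_set_eq_0_iff)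

text \<open>
  Distinct optimal codebooks are far apart, for both are fixed points of Lloyd's iteration, which
  is a contraction towards each of them.
\<close>

lemma C_opt_isolated:
  assumes c: "c \<in> C" and c': "c' \<in> C" and dist: "codebook_dist d k c c' \<le> R0"
  shows "c = c'"
proof (rule codebook_dist_0_imp_eq[OF in_codebooks[OF c] in_codebooks[OF c']])
  define \<delta> where "\<delta> = codebook_dist d k c c'"
  have \<delta>: "0 \<le> \<delta>" "\<delta> \<le> R0" using dist by (auto simp: \<delta>_def)
  have fixpt: "lloyd_step d k \<mu> c' = c'"
    using R by (intro lloyd_step_C_opt[OF \<mu> k1 c' cell_pos[OF c']]) auto
  have "p / 2 * codebook_dist d k c (lloyd_step d k \<mu> c')
      \<le> L2_set (\<lambda>j. L2_set (cell_offset d k \<mu> c j) {1..d}) {1..k} + 4 * R * (p * \<delta> / (32 * R))"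
  proof (rule lloyd_step_contraction[OF \<mu> k1 _ in_ball[OF c] B_pos B_le[OF c]])
    show "codebook_dist d k c c' \<le> \<delta>" by (simp add: \<delta>_def)
    show "\<delta> \<le> R / 2" using \<delta> R0_le by simp
    show "measure \<mu> (strip d k c (4 * R * \<delta> / B)) \<le> p * \<delta> / (32 * R)" by (rule strip_radius_le[OF c \<delta>])
    fix j assume j: "j \<in> {1..k}"
    have "p * \<delta> \<le> p * R" using \<delta> R0_le R p_pos by (intro mult_left_mono) auto
    then have "p * \<delta> / (32 * R) \<le> p / 2" using R p_pos by (simp add: field_simps)
    then show "p / 2 + p * \<delta> / (32 * R) \<le> measure \<mu> (cell d k c j)" using p_le[OF c j] by linarith
  qed (use R p_pos in auto)
  then have "p / 2 * \<delta> \<le> p * \<delta> / 8" using R unfolding fixpt offset_0[OF c] by (simp add: \<delta>_def)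
  then have "p * \<delta> \<le> 0" by (simp add: mult.commute)
  then show "codebook_dist d k c c' = 0" using p_pos by (auto simp: \<delta>_def mult_le_0_iff intro: antisym)
qed

text \<open>
  Optimal codebooks lie in a ball and keep a fixed distance from each other, so rounding their
  coordinates to a fine grid maps them injectively to a finite set.
\<close>

lemma finite_C_opt: "finite C"
proof -
  \<comment> \<open>Codebooks that agree after rounding on the scale \<open>1 / m\<close> are within \<open>k d / m \<le> R0\<close> of each other.\<close>
  define m where "m = nat \<lceil>real k * real d / R0\<rceil> + 1"
  have m: "0 < real m" "real k * real d \<le> R0 * real m"
  proof -
    show "0 < real m" by (simp add: m_def)
    have "real k * real d / R0 \<le> real m" unfolding m_def by linarith
    then show "real k * real d \<le> R0 * real m" using R0_pos by (simp add: field_simps)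
  qed
  define J where "J = {1..k} \<times> {1..d}"
  define q where "q = (\<lambda>c. \<lambda>(j, l)\<in>J. \<lfloor>real m * c j l\<rfloor> :: int)"
  have "inj_on q C"
  proof (rule inj_onI)
    fix c c' assume c: "c \<in> C" "c' \<in> C" and eq: "q c = q c'"
    have "\<bar>c j l - c' j l\<bar> \<le> 1 / real m" if "j \<in> {1..k}" "l \<in> {1..d}" for j l
    proof -
      have "q c (j, l) = q c' (j, l)" using eq by simp
      then have "\<lfloor>real m * c j l\<rfloor> = \<lfloor>real m * c' j l\<rfloor>" using that by (simp add: q_def J_def)
      then have "\<bar>real m * c j l - real m * c' j l\<bar> \<le> 1" by linarith
      then have "real m * \<bar>c j l - c' j l\<bar> \<le> 1" using m by (simp add: abs_mult right_diff_distrib[symmetric])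
      then show ?thesis using m by (simp add: field_simps)
    qed
    then have "edist d (c j) (c' j) \<le> real d * (1 / real m)" if "j \<in> {1..k}" for j
      unfolding edist_def using that
      by (intro order_trans[OF L2_set_le_sum_abs] order_trans[OF sum_bounded_above[of _ _ "1 / real m"]]) auto
    then have "codebook_dist d k c c' \<le> real k * (real d * (1 / real m))"
      unfolding codebook_dist_def
      by (intro order_trans[OF L2_set_le_sum] order_trans[OF sum_bounded_above[of _ _ "real d * (1 / real m)"]]) auto
    also have "\<dots> \<le> R0" using m by (simp add: field_simps)
    finally show "c = c'" by (rule C_opt_isolated[OF c])
  qed
  moreover have "q ` C \<subseteq> PiE J (\<lambda>_. {\<lfloor>- (real m * R)\<rfloor>..\<lfloor>real m * R\<rfloor>})"
  proof (intro image_subsetI PiE_I)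
    fix c x assume c: "c \<in> C" and x: "x \<in> J"
    obtain j l where jl: "x = (j, l)" "j \<in> {1..k}" "l \<in> {1..d}" using x by (auto simp: J_def)
    have "\<bar>c j l\<bar> \<le> R"
      using in_ball[OF c jl(2)] component_le_edist_zero[OF jl(3), of "c j"] by (simp add: closed_ball_def)
    then have "\<bar>real m * c j l\<bar> \<le> real m * R" using m unfolding abs_mult by (simp add: mult_left_mono)
    then have "- (real m * R) \<le> real m * c j l" "real m * c j l \<le> real m * R" by linarith+
    then show "q c x \<in> {\<lfloor>- (real m * R)\<rfloor>..\<lfloor>real m * R\<rfloor>}"
      using x unfolding q_def jl(1) by (simp add: floor_mono)
  qed (auto simp: q_def)
  moreover have "finite (PiE J (\<lambda>_. {\<lfloor>- (real m * R)\<rfloor>..\<lfloor>real m * R\<rfloor>}))"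
    by (intro finite_PiE) (auto simp: J_def)
  ultimately show ?thesis by (metis finite_imageD finite_subset)
qed

text \<open>
  Two optimal codebooks with almost everywhere equal cells would have the same centroids.
\<close>

lemma mismatch_pos:
  assumes c: "c \<in> C" and c': "c' \<in> C" and ne: "c \<noteq> c'"
  shows "0 < measure \<mu> (mismatch d k c c')"
proof (rule ccontr)
  assume "\<not> ?thesis"
  then have 0: "measure \<mu> (mismatch d k c c') = 0" using measure_nonneg[of \<mu> "mismatch d k c c'"] by linarith
  have fixpt: "lloyd_step d k \<mu> c' = c'"
    using R by (intro lloyd_step_C_opt[OF \<mu> k1 c' cell_pos[OF c']]) auto
  have "p * codebook_dist d k c (lloyd_step d k \<mu> c')
      \<le> L2_set (\<lambda>j. L2_set (cell_offset d k \<mu> c j) {1..d}) {1..k} + 4 * R * measure \<mu> (mismatch d k c c')"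
    using R by (intro lloyd_step_dist_le[OF \<mu> k1 _ in_ball[OF c] p_pos p_le[OF c']]) auto
  then have "p * codebook_dist d k c c' \<le> 0" unfolding fixpt offset_0[OF c] 0 by simp
  then have "codebook_dist d k c c' = 0"
    using p_pos by (auto simp: mult_le_0_iff intro: antisym)
  then show False using codebook_dist_0_imp_eq[OF in_codebooks[OF c] in_codebooks[OF c']] ne by blast
qed

end


section \<open>Fluctuations along a Lloyd trajectory\<close>

text \<open>
  The constant in position \<open>0\<close> is \<open>R\<close> rather than \<open>1\<close>, so that masses are measured on the same scale
  as first moments.
\<close>

definition moment :: "real \<Rightarrow> (nat \<Rightarrow> real) \<Rightarrow> nat \<Rightarrow> real" where
  "moment R u l = (if l = 0 then R else u l)"

definition cell_moments ::
    "nat \<Rightarrow> nat \<Rightarrow> real \<Rightarrow> (nat \<Rightarrow> nat \<Rightarrow> real) \<Rightarrow> (nat \<Rightarrow> real) measure \<Rightarrow> nat \<times> nat \<Rightarrow> real" where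
  "cell_moments d k R c y = (\<lambda>(j, l). \<integral>u. indicator (cell d k c j) u * moment R u l \<partial>y)"

abbreviation "moment_index d k \<equiv> {1..k} \<times> {0..d}"

lemma L2_set_Times:
  "L2_set (\<lambda>(j, l). f j * g l) (A \<times> A') = L2_set f A * L2_set g A'"
proof -
  have "(\<Sum>p\<in>A \<times> A'. (case p of (j, l) \<Rightarrow> f j * g l)\<^sup>2) = (\<Sum>j\<in>A. (f j)\<^sup>2) * (\<Sum>l\<in>A'. (g l)\<^sup>2)"
    by (simp add: sum_product sum.cartesian_product case_prod_beta power_mult_distrib)
  then show ?thesis by (simp add: L2_set_def real_sqrt_mult)
qed

lemma L2_set_sq: "(L2_set f A)\<^sup>2 = (\<Sum>i\<in>A. (f i)\<^sup>2)"
  by (simp add: L2_set_def sum_nonneg)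

lemma abs_le_L2_set: "finite A \<Longrightarrow> i \<in> A \<Longrightarrow> \<bar>f i\<bar> \<le> L2_set f A"
  using member_le_L2_set[of A i "\<lambda>i. \<bar>f i\<bar>"] by (simp add: L2_set_def)

lemma moment_norm_le:
  assumes "u \<in> ball0 d R" "0 < R"
  shows "(L2_set (moment R u) {0..d})\<^sup>2 \<le> 2 * R\<^sup>2"
proof -
  have "{0..d} = insert 0 {1..d}" by auto
  then have "(L2_set (moment R u) {0..d})\<^sup>2 = R\<^sup>2 + (\<Sum>l=1..d. (moment R u l)\<^sup>2)"
    unfolding L2_set_sq by (simp add: moment_def)
  also have "(\<Sum>l=1..d. (moment R u l)\<^sup>2) = (\<Sum>l=1..d. (u l)\<^sup>2)"
    by (intro sum.cong) (auto simp: moment_def)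
  also have "\<dots> = (edist d (zero_vec d) u)\<^sup>2" by (simp add: edist_zero_vec L2_set_sq)
  also have "\<dots> \<le> R\<^sup>2" using assms by (intro power_mono) (auto simp: closed_ball_def)
  finally show ?thesis by simp
qed

lemma abs_moment_le:
  assumes "u \<in> ball0 d R" "0 < R" "l \<in> {0..d}"
  shows "\<bar>moment R u l\<bar> \<le> R"
  using assms component_le_edist_zero[of l d u] by (cases "l = 0") (auto simp: moment_def closed_ball_def)

lemma cell_moment_measurable:
  assumes "j \<in> {1..k}" "l \<in> {0..d}"
  shows "(\<lambda>u. indicat_real (cell d k c j) u * moment R u l) \<in> borel_measurable (Rd d)"
proof -
  have "(\<lambda>u. moment R u l) \<in> borel_measurable (Rd d)"
    using assms(2) borel_measurable_coord[of l d] by (cases "l = 0") (auto simp: moment_def)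
  then show ?thesis using borel_measurable_indicator_cell[OF assms(1)] by (intro borel_measurable_times)
qed

lemma cell_moment_bounded:
  assumes "u \<in> ball0 d R" "0 < R" "l \<in> {0..d}"
  shows "\<bar>indicat_real (cell d k c j) u * moment R u l\<bar> \<le> R"
  using abs_moment_le[OF assms] assms(2) by (auto simp: indicator_def)

lemma cell_moment_integrable:
  assumes Q: "Q \<in> ball_measures d R M" and R: "0 < R" and jl: "j \<in> {1..k}" "l \<in> {0..d}"
  shows "integrable Q (\<lambda>u. indicat_real (cell d k c j) u * moment R u l)"
  by (rule integrable_ball_measure[OF Q cell_moment_measurable[OF jl] cell_moment_bounded[OF _ R jl(2)]])

lemma norm_cell_moments_le:
  assumes Q: "Q \<in> ball_measures d R M" and R: "0 < R" and M: "0 < M" and k: "1 \<le> k"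
  shows "L2_set (cell_moments d k R c Q) (moment_index d k) \<le> 2 * R * M"
proof -
  interpret finite_measure Q using ball_measuresD(3)[OF Q] .
  have "L2_set (cell_moments d k R c Q) (moment_index d k)
      = L2_set (\<lambda>p. \<integral>u. (case p of (j, l) \<Rightarrow> indicator (cell d k c j) u * moment R u l) \<partial>Q) (moment_index d k)"
    by (intro L2_set_cong) (auto simp: cell_moments_def)
  also have "\<dots> \<le> (\<integral>u. 2 * R \<partial>Q)"
  proof (rule L2_set_integral_le)
    fix p assume "p \<in> moment_index d k"
    then show "integrable Q (\<lambda>u. case p of (j, l) \<Rightarrow> indicat_real (cell d k c j) u * moment R u l)"
      using cell_moment_integrable[OF Q R] by (cases p) auto
  next
    show "AE u in Q. L2_set (\<lambda>p. case p of (j, l) \<Rightarrow> indicat_real (cell d k c j) u * moment R u l) (moment_index d k) \<le> 2 * R"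
      using ball_measuresD(4)[OF Q]
    proof eventually_elim
      case (elim u)
      obtain i where i: "i \<in> {1..k}" "u \<in> cell d k c i" using ex_cell[OF ball0_space[OF elim] k] by blast
      have "(L2_set (\<lambda>j. indicat_real (cell d k c j) u) {1..k})\<^sup>2 = (\<Sum>j=1..k. 1 * indicat_real (cell d k c j) u)"
        unfolding L2_set_sq by (intro sum.cong refl) (auto simp: indicator_def)
      also have "\<dots> = 1\<^sup>2" using sum_indicator_cell[OF i(2,1), of "\<lambda>_. 1"] by simp
      finally have one: "L2_set (\<lambda>j. indicat_real (cell d k c j) u) {1..k} = 1"
        by (rule power2_eq_imp_eq) auto
      have "2 * R\<^sup>2 \<le> (2 * R)\<^sup>2" by (simp add: power2_eq_square)
      then have "(L2_set (moment R u) {0..d})\<^sup>2 \<le> (2 * R)\<^sup>2" using moment_norm_le[OF elim R] by linarith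
      then have "L2_set (moment R u) {0..d} \<le> 2 * R" by (rule power2_le_imp_le) (use R in simp)
      then show ?case unfolding L2_set_Times one by simp
    qed
  qed auto
  also have "\<dots> \<le> 2 * R * M" using ball_measuresD(5)[OF Q] R M by simp
  finally show ?thesis .
qed

lemma norm_cell_moments_diff_le:
  assumes Q: "Q \<in> ball_measures d R M" and R: "0 < R" and M: "0 < M" and k: "1 \<le> k"
  shows "(L2_set (\<lambda>p. cell_moments d k R c Q p - cell_moments d k R c' Q p) (moment_index d k))\<^sup>2
    \<le> 4 * R\<^sup>2 * M * measure Q (mismatch d k c c')"
proof -
  interpret finite_measure Q using ball_measuresD(3)[OF Q] .
  define f where "f = (\<lambda>u. \<lambda>(j, l). (indicat_real (cell d k c j) u - indicat_real (cell d k c' j) u) * moment R u l)"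
  define \<delta> where "\<delta> = measure Q (mismatch d k c c')"
  have mis: "mismatch d k c c' \<in> sets (Rd d)" by (rule sets_mismatch)
  have "L2_set (\<lambda>p. cell_moments d k R c Q p - cell_moments d k R c' Q p) (moment_index d k)
      = L2_set (\<lambda>p. \<integral>u. f u p \<partial>Q) (moment_index d k)"
  proof (intro L2_set_cong refl)
    fix p assume p: "p \<in> moment_index d k"
    obtain j l where jl: "p = (j, l)" by (cases p)
    show "cell_moments d k R c Q p - cell_moments d k R c' Q p = (\<integral>u. f u p \<partial>Q)"
      unfolding jl f_def cell_moments_def prod.case left_diff_distrib
      using p unfolding jl by (intro Bochner_Integration.integral_diff[symmetric] cell_moment_integrable[OF Q R]) auto
  qed
  also have "\<dots> \<le> (\<integral>u. 2 * R * indicat_real (mismatch d k c c') u \<partial>Q)"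
  proof (rule L2_set_integral_le)
    fix p assume p: "p \<in> moment_index d k"
    obtain j l where jl: "p = (j, l)" by (cases p)
    show "integrable Q (\<lambda>u. f u p)"
      unfolding jl f_def prod.case left_diff_distrib
      using p unfolding jl by (intro Bochner_Integration.integrable_diff cell_moment_integrable[OF Q R]) auto
  next
    show "integrable Q (\<lambda>u. 2 * R * indicat_real (mismatch d k c c') u)"
      using integrable_indicator_ball_measure[OF Q mis] by simp
    show "AE u in Q. L2_set (f u) (moment_index d k) \<le> 2 * R * indicat_real (mismatch d k c c') u"
      using ball_measuresD(4)[OF Q]
    proof eventually_elim
      case (elim u)
      have "(L2_set (\<lambda>j. indicat_real (cell d k c j) u - indicat_real (cell d k c' j) u) {1..k})\<^sup>2
          = (\<Sum>j=1..k. \<bar>indicat_real (cell d k c j) u - indicat_real (cell d k c' j) u\<bar>)"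
        unfolding L2_set_sq by (intro sum.cong refl) (auto simp: indicator_def)
      also have "\<dots> = 2 * indicat_real (mismatch d k c c') u"
        by (rule sum_indicator_cell_diff[OF ball0_space[OF elim] k])
      finally have "(L2_set (f u) (moment_index d k))\<^sup>2
          = (2 * indicat_real (mismatch d k c c') u) * (L2_set (moment R u) {0..d})\<^sup>2"
        unfolding f_def L2_set_Times power_mult_distrib by simp
      also have "\<dots> \<le> (2 * indicat_real (mismatch d k c c') u) * (2 * R\<^sup>2)"
        by (intro mult_left_mono moment_norm_le[OF elim R]) auto
      also have "\<dots> = (2 * R * indicat_real (mismatch d k c c') u)\<^sup>2"
        by (auto simp: indicator_def power2_eq_square)
      finally show ?case by (rule power2_le_imp_le) (use R in auto)
    qed
  qed auto
  also have "\<dots> = 2 * R * \<delta>"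
    using mis sets.sets_into_space[OF mis] ball_measuresD(2)[OF Q] by (simp add: Int_absorb2 \<delta>_def)
  finally have "L2_set (\<lambda>p. cell_moments d k R c Q p - cell_moments d k R c' Q p) (moment_index d k) \<le> 2 * R * \<delta>" .
  then have "(L2_set (\<lambda>p. cell_moments d k R c Q p - cell_moments d k R c' Q p) (moment_index d k))\<^sup>2 \<le> (2 * R * \<delta>)\<^sup>2"
    by (intro power_mono) auto
  also have "\<dots> = 4 * R\<^sup>2 * \<delta> * \<delta>" by (simp add: power2_eq_square)
  also have "\<dots> \<le> 4 * R\<^sup>2 * M * \<delta>"
  proof -
    have "\<delta> \<le> M" using bounded_measure[of "mismatch d k c c'"] ball_measuresD(5)[OF Q] M by (simp add: \<delta>_def)
    then show ?thesis using R by (intro mult_right_mono mult_left_mono) (auto simp: \<delta>_def)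
  qed
  finally show ?thesis by (simp add: \<delta>_def)
qed

lemma cell_moments_0:
  assumes Q: "Q \<in> ball_measures d R M"
  shows "cell_moments d k R c Q (j, 0) = R * measure Q (cell d k c j)"
proof -
  have "cell_moments d k R c Q (j, 0) = (\<integral>u. R * indicat_real (cell d k c j) u \<partial>Q)"
    by (simp add: cell_moments_def moment_def mult.commute)
  then show ?thesis unfolding integral_mult_right_zero integral_indicator_cell[OF Q] .
qed

lemma cell_offset_eq_moments:
  assumes Q: "Q \<in> ball_measures d R M" and R: "0 < R" and jl: "j \<in> {1..k}" "l \<in> {1..d}"
  shows "cell_offset d k Q c j l = cell_moments d k R c Q (j, l) - c j l / R * cell_moments d k R c Q (j, 0)"
proof -
  have l: "l \<in> {0..d}" "l \<noteq> 0" using jl by auto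
  have "cell_offset d k Q c j l = (\<integral>u. indicat_real (cell d k c j) u * moment R u l
      - c j l * indicat_real (cell d k c j) u \<partial>Q)"
    using l by (simp add: cell_offset_def moment_def algebra_simps)
  also have "\<dots> = (\<integral>u. indicat_real (cell d k c j) u * moment R u l \<partial>Q) - c j l * measure Q (cell d k c j)"
    using cell_moment_integrable[OF Q R jl(1) l(1)] integrable_indicator_ball_measure[OF Q sets_cell[OF jl(1)]]
      integral_indicator_cell[OF Q, of k c j]
    by (subst Bochner_Integration.integral_diff) auto
  finally show ?thesis unfolding cell_moments_0[OF Q] using R by (simp add: cell_moments_def)
qed

text \<open>
  The vector \<open>cell_moments\<close> controls both quantities on which a Lloyd step depends: the offsets of
  the codepoints from the centroids of their cells, and the masses of the cells.
\<close>

lemma cell_offset_le_moments_diff: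
  assumes Q: "Q \<in> ball_measures d R M" and \<mu>: "\<mu> \<in> ball_measures d R M" and R: "0 < R"
    and c: "\<And>j. j \<in> {1..k} \<Longrightarrow> c j \<in> ball0 d R"
    and off: "\<And>j l. j \<in> {1..k} \<Longrightarrow> l \<in> {1..d} \<Longrightarrow> cell_offset d k \<mu> c j l = 0"
  shows "L2_set (\<lambda>j. L2_set (cell_offset d k Q c j) {1..d}) {1..k}
    \<le> 2 * L2_set (\<lambda>p. cell_moments d k R c Q p - cell_moments d k R c \<mu> p) (moment_index d k)"
proof -
  define \<Delta> where "\<Delta> = (\<lambda>p. cell_moments d k R c Q p - cell_moments d k R c \<mu> p)"
  define N where "N = L2_set \<Delta> (moment_index d k)"
  have row: "L2_set (cell_offset d k Q c j) {1..d} \<le> L2_set (\<lambda>l. \<Delta> (j, l)) {1..d} + \<bar>\<Delta> (j, 0)\<bar>"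
    if j: "j \<in> {1..k}" for j
  proof -
    have "cell_offset d k Q c j l = \<Delta> (j, l) + (- \<Delta> (j, 0) / R) * c j l" if l: "l \<in> {1..d}" for l
      using cell_offset_eq_moments[OF Q R j l, of c] cell_offset_eq_moments[OF \<mu> R j l, of c] off[OF j l]
      by (simp add: \<Delta>_def algebra_simps diff_divide_distrib)
    then have "L2_set (cell_offset d k Q c j) {1..d} = L2_set (\<lambda>l. \<Delta> (j, l) + (- \<Delta> (j, 0) / R) * c j l) {1..d}"
      by (intro L2_set_cong) auto
    also have "\<dots> \<le> L2_set (\<lambda>l. \<Delta> (j, l)) {1..d} + L2_set (\<lambda>l. (- \<Delta> (j, 0) / R) * c j l) {1..d}"
      by (rule L2_set_triangle_ineq)
    also have "L2_set (\<lambda>l. (- \<Delta> (j, 0) / R) * c j l) {1..d} = \<bar>\<Delta> (j, 0)\<bar> / R * L2_set (c j) {1..d}"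
    proof -
      have "L2_set (\<lambda>l. (- \<Delta> (j, 0) / R) * c j l) {1..d} = L2_set (\<lambda>l. \<bar>\<Delta> (j, 0)\<bar> / R * c j l) {1..d}"
        by (simp add: L2_set_def power_mult_distrib power_divide)
      also have "\<dots> = \<bar>\<Delta> (j, 0)\<bar> / R * L2_set (c j) {1..d}"
        using R by (intro L2_set_right_distrib[symmetric]) auto
      finally show ?thesis .
    qed
    also have "\<dots> \<le> \<bar>\<Delta> (j, 0)\<bar> / R * R"
      using c[OF j] R by (intro mult_left_mono) (auto simp: closed_ball_def edist_zero_vec)
    finally show ?thesis using R by simp
  qed
  have "L2_set (\<lambda>j. L2_set (cell_offset d k Q c j) {1..d}) {1..k}
      \<le> L2_set (\<lambda>j. L2_set (\<lambda>l. \<Delta> (j, l)) {1..d} + \<bar>\<Delta> (j, 0)\<bar>) {1..k}"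
    by (intro L2_set_mono row) auto
  also have "\<dots> \<le> L2_set (\<lambda>j. L2_set (\<lambda>l. \<Delta> (j, l)) {1..d}) {1..k} + L2_set (\<lambda>j. \<bar>\<Delta> (j, 0)\<bar>) {1..k}"
    by (rule L2_set_triangle_ineq)
  also have "\<dots> \<le> N + N"
  proof (intro add_mono)
    have N: "N\<^sup>2 = (\<Sum>j=1..k. \<Sum>l=0..d. (\<Delta> (j, l))\<^sup>2)"
      unfolding N_def L2_set_sq by (simp add: sum.cartesian_product)
    have "(L2_set (\<lambda>j. L2_set (\<lambda>l. \<Delta> (j, l)) {1..d}) {1..k})\<^sup>2 \<le> N\<^sup>2"
      unfolding N L2_set_sq by (intro sum_mono sum_mono2) auto
    then show "L2_set (\<lambda>j. L2_set (\<lambda>l. \<Delta> (j, l)) {1..d}) {1..k} \<le> N"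
      by (rule power2_le_imp_le) (simp add: N_def)
    have "(L2_set (\<lambda>j. \<bar>\<Delta> (j, 0)\<bar>) {1..k})\<^sup>2 \<le> N\<^sup>2"
      unfolding N L2_set_sq power2_abs by (intro sum_mono member_le_sum) auto
    then show "L2_set (\<lambda>j. \<bar>\<Delta> (j, 0)\<bar>) {1..k} \<le> N"
      by (rule power2_le_imp_le) (simp add: N_def)
  qed
  finally show ?thesis by (simp add: N_def \<Delta>_def)
qed

lemma measure_cell_diff_le_moments_diff:
  assumes Q: "Q \<in> ball_measures d R M" and \<mu>: "\<mu> \<in> ball_measures d R M" and R: "0 < R" and j: "j \<in> {1..k}"
  shows "R * \<bar>measure Q (cell d k c j) - measure \<mu> (cell d k c j)\<bar>
    \<le> L2_set (\<lambda>p. cell_moments d k R c Q p - cell_moments d k R c \<mu> p) (moment_index d k)"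
proof -
  have "R * \<bar>measure Q (cell d k c j) - measure \<mu> (cell d k c j)\<bar>
      = \<bar>cell_moments d k R c Q (j, 0) - cell_moments d k R c \<mu> (j, 0)\<bar>"
    unfolding cell_moments_0[OF Q] cell_moments_0[OF \<mu>] using R by (simp add: right_diff_distrib[symmetric] abs_mult)
  also have "\<dots> \<le> L2_set (\<lambda>p. cell_moments d k R c Q p - cell_moments d k R c \<mu> p) (moment_index d k)"
    using j abs_le_L2_set[of "moment_index d k" "(j, 0)" "\<lambda>p. cell_moments d k R c Q p - cell_moments d k R c \<mu> p"]
    by simp
  finally show ?thesis .
qed

context margin_setting
begin

text \<open>
  A Lloyd trajectory that starts near the optimal codebook \<open>a\<close>. Here \<open>e\<close> is the fluctuation of the
  cell moments at \<open>a\<close> and \<open>Z\<close> that of the masses of the strips around the cell boundary of \<open>a\<close>,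
  on a grid of \<open>n\<close> widths.
\<close>

lemma lloyd_iterates_dist_le:
  assumes Q: "Q \<in> ball_measures d R M" and a: "a \<in> C" and n: "100 \<le> n"
    and e: "L2_set (\<lambda>p. cell_moments d k R a Q p - cell_moments d k R a \<mu> p) (moment_index d k) \<le> e" "e \<le> p * R0 / 64"
    and Z: "\<And>s. s \<in> {1..n} \<Longrightarrow> measure Q (strip d k a (real s * r0 / real n))
        \<le> 2 * measure \<mu> (strip d k a (real s * r0 / real n)) + Z" "0 \<le> Z" "Z \<le> p * R0 / (128 * R)"
    and c: "codebook_dist d k a c \<le> R0"
  defines "\<nu> \<equiv> 4 * e / p + 8 * R * Z / p + 3 * R0 / real n"
  shows "codebook_dist d k a ((lloyd_step d k Q ^^ m) c) \<le> R0 / 2 ^ m + 2 * \<nu> * (1 - 1 / 2 ^ m)"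
proof -
  interpret Q: finite_measure Q using ball_measuresD(3)[OF Q] .
  have n0: "0 < real n" using n by simp
  have off: "L2_set (\<lambda>j. L2_set (cell_offset d k Q a j) {1..d}) {1..k} \<le> 2 * e"
    using cell_offset_le_moments_diff[OF Q \<mu> R in_ball[OF a] cell_offset_C_opt[OF \<mu> k1 a cell_pos[OF a]]] e(1)
    by linarith
  have cellQ: "p - e / R \<le> measure Q (cell d k a j)" if j: "j \<in> {1..k}" for j
  proof -
    have "R * \<bar>measure Q (cell d k a j) - measure \<mu> (cell d k a j)\<bar> \<le> e"
      using measure_cell_diff_le_moments_diff[OF Q \<mu> R j, of a] e(1) by linarith
    then have "\<bar>measure Q (cell d k a j) - measure \<mu> (cell d k a j)\<bar> \<le> e / R" using R by (simp add: field_simps)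
    then show ?thesis using p_le[OF a j] by linarith
  qed
  have step: "codebook_dist d k a (lloyd_step d k Q c) \<le> \<delta> / 2 + \<nu>"
    if \<delta>: "codebook_dist d k a c \<le> \<delta>" "\<delta> \<le> R0" for c \<delta>
  proof -
    have \<delta>0: "0 \<le> \<delta>" using \<delta>(1) codebook_dist_nonneg order_trans by blast
    define t where "t = 4 * R * \<delta> / B"
    have t: "0 \<le> t" "t \<le> r0 / 2" using radius_le[OF \<delta>0 \<delta>(2)] \<delta>0 R B_pos by (auto simp: t_def)
    \<comment> \<open>The next width of the grid. Rounding up costs \<open>r0 / n\<close>, which contributes only \<open>O(1 / n\<^sup>2)\<close> to the squared distance.\<close>
    define s where "s = nat \<lfloor>t * real n / r0\<rfloor> + 1"
    have x0: "0 \<le> t * real n / r0" using t r0 by simp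
    have s: "t * real n / r0 \<le> real s" "real s \<le> t * real n / r0 + 1" using x0 unfolding s_def by linarith+
    have "t * real n / r0 \<le> real n / 2" using t r0 n0 by (simp add: field_simps)
    then have "real s \<le> real n" using s(2) n by linarith
    then have sn: "s \<in> {1..n}" by (simp add: s_def)
    have ts: "t \<le> real s * r0 / real n" using s(1) r0 n0 by (simp add: field_simps)
    have st: "real s * r0 / real n \<le> t + r0 / real n" using s(2) r0 n0 by (simp add: field_simps)
    have sr: "real s * r0 / real n \<le> r0" using sn r0 n0 by (simp add: field_simps)
    define S where "S = p * \<delta> / (16 * R) + B * p * r0 / (64 * R\<^sup>2 * real n) + Z"
    have "measure Q (strip d k a t) \<le> measure Q (strip d k a (real s * r0 / real n))"
      using sets_strip ball_measuresD(1)[OF Q] strip_mono[OF ts] by (intro Q.finite_measure_mono) auto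
    also have "\<dots> \<le> 2 * measure \<mu> (strip d k a (real s * r0 / real n)) + Z" by (rule Z(1)[OF sn])
    also have "\<dots> \<le> 2 * (B * p / (128 * R\<^sup>2) * (real s * r0 / real n)) + Z"
      using strip_le[OF a order_trans[OF t(1) ts] sr] by linarith
    also have "\<dots> \<le> 2 * (B * p / (128 * R\<^sup>2) * (t + r0 / real n)) + Z"
      using B_pos p_pos by (intro add_right_mono mult_left_mono st) auto
    also have "\<dots> = S" using R B_pos n0 by (simp add: S_def t_def field_simps power2_eq_square)
    finally have QS: "measure Q (strip d k a t) \<le> S" .
    have Br: "B * r0 = 16 * sqrt 2 * R * R0" using R by (simp add: R0_def)
    have s2: "sqrt 2 \<le> (3 / 2 :: real)" by (rule real_le_lsqrt) (auto simp: power2_eq_square)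
    have mid: "4 * R * (B * p * r0 / (64 * R\<^sup>2 * real n)) \<le> p * (3 / 2 * R0 / real n)"
    proof -
      have "4 * R * (B * p * r0 / (64 * R\<^sup>2 * real n)) = p * (B * r0) / (16 * R * real n)"
        using R n0 by (simp add: field_simps power2_eq_square)
      also have "\<dots> = p * (sqrt 2 * R0 / real n)" unfolding Br using R n0 by (simp add: field_simps)
      also have "\<dots> \<le> p * (3 / 2 * R0 / real n)"
        using s2 p_pos R0_pos n0 by (intro mult_left_mono divide_right_mono mult_right_mono) auto
      finally show ?thesis .
    qed
    have S4: "4 * R * S \<le> p * \<delta> / 4 + p * (3 / 2 * R0 / real n) + 4 * R * Z"
    proof -
      have "4 * R * (p * \<delta> / (16 * R)) = p * \<delta> / 4" using R by simp
      then show ?thesis using mid unfolding S_def distrib_left by linarith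
    qed
    have Sp: "S + e / R \<le> p / 2"
    proof -
      have pR: "p * R0 \<le> p * (R / 2)" using R0_le p_pos by (intro mult_left_mono) auto
      have 1: "p * \<delta> / 4 \<le> p * R / 8" using mult_left_mono[OF \<delta>(2), of p] pR p_pos by linarith
      have "p * (3 / 2 * R0 / real n) \<le> p * (3 / 2 * R0 / 100)"
        using p_pos R0_pos n by (intro mult_left_mono divide_left_mono) auto
      then have 2: "p * (3 / 2 * R0 / real n) \<le> p * R / 100" using pR mult_pos_pos[OF p_pos R] by linarith
      have "4 * R * Z \<le> 4 * R * (p * R0 / (128 * R))" using Z(3) R by (intro mult_left_mono) auto
      also have "\<dots> = p * R0 / 32" using R by simp
      finally have 3: "4 * R * Z \<le> p * R / 64" using pR by linarith
      have 4: "4 * e \<le> p * R / 32" using e(2) pR by linarith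
      have "4 * R * (S + e / R) = 4 * R * S + 4 * e" using R by (simp add: distrib_left)
      also have "\<dots> \<le> p * R / 8 + p * R / 100 + p * R / 64 + p * R / 32" using S4 1 2 3 4 by linarith
      also have "\<dots> \<le> 4 * R * (p / 2)"
        using mult_pos_pos[OF p_pos R] by (simp add: mult.commute[of R])
      finally show ?thesis using R by (simp add: mult_le_cancel_left)
    qed
    have "p / 2 * codebook_dist d k a (lloyd_step d k Q c)
        \<le> L2_set (\<lambda>j. L2_set (cell_offset d k Q a j) {1..d}) {1..k} + 4 * R * S"
    proof (rule lloyd_step_contraction[OF Q k1 _ in_ball[OF a] B_pos B_le[OF a] \<delta>(1)])
      show "\<delta> \<le> R / 2" using \<delta>(2) R0_le by simp
      show "measure Q (strip d k a (4 * R * \<delta> / B)) \<le> S" using QS by (simp add: t_def)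
      fix j assume "j \<in> {1..k}"
      then show "p / 2 + S \<le> measure Q (cell d k a j)" using cellQ[of j] Sp by linarith
    qed (use R p_pos in auto)
    also have "\<dots> \<le> 2 * e + (p * \<delta> / 4 + p * (3 / 2 * R0 / real n) + 4 * R * Z)" using off S4 by linarith
    also have "\<dots> = p / 2 * (\<delta> / 2 + \<nu>)" using p_pos n0 by (simp add: \<nu>_def field_simps)
    finally show ?thesis using p_pos by simp
  qed
  have \<nu>: "2 * \<nu> \<le> R0"
  proof -
    have "4 * e / p \<le> R0 / 16" using e(2) p_pos by (simp add: field_simps)
    moreover have "8 * R * Z / p \<le> R0 / 16" using Z(3) p_pos R by (simp add: field_simps)
    moreover have "3 * R0 / real n \<le> 3 * R0 / 100" using R0_pos n by (intro divide_left_mono) auto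
    ultimately have "\<nu> \<le> R0 / 16 + R0 / 16 + 3 * R0 / 100" unfolding \<nu>_def by (intro add_mono)
    then show ?thesis using R0_pos by linarith
  qed
  show ?thesis
  proof (induction m)
    case (Suc m)
    define \<delta> where "\<delta> = R0 / 2 ^ m + 2 * \<nu> * (1 - 1 / 2 ^ m)"
    have "2 * \<nu> * (1 - 1 / 2 ^ m) \<le> R0 * (1 - 1 / 2 ^ m)" using \<nu> by (intro mult_right_mono) auto
    then have "\<delta> \<le> R0" by (simp add: \<delta>_def right_diff_distrib)
    then have "codebook_dist d k a (lloyd_step d k Q ((lloyd_step d k Q ^^ m) c)) \<le> \<delta> / 2 + \<nu>"
      using Suc by (intro step) (auto simp: \<delta>_def)
    also have "\<delta> / 2 + \<nu> = R0 / 2 ^ Suc m + 2 * \<nu> * (1 - 1 / 2 ^ Suc m)"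
      by (simp add: \<delta>_def field_simps)
    finally show ?case by simp
  qed (use c in simp)
qed

end


section \<open>The excess distortion\<close>

text \<open>
  A step that halves the distance to the optimum quarters its square, while the number of steps
  is tuned to the factor \<open>3 / 4\<close>. The surplus \<open>3 ^ T\<close> pays for the factor \<open>2\<close>.
\<close>

lemma power_lloyd_steps_ge:
  assumes n: "2 \<le> n" and T: "T = nat \<lceil>ln (real n) / ln (4 / 3)\<rceil>"
  shows "2 * real n \<le> 4 ^ T"
proof -
  have l: "0 < ln (4 / 3 :: real)" by simp
  have "0 < ln (real n)" using n by simp
  then have pos: "0 < ln (real n) / ln (4 / 3)" using l by simp
  have "ln (real n) / ln (4 / 3) \<le> real T" unfolding T by linarith
  then have "ln (real n) \<le> real T * ln (4 / 3)" using l by (simp add: pos_divide_le_eq)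
  also have "\<dots> = ln ((4 / 3) ^ T)" by (simp add: ln_realpow)
  finally have nT: "real n \<le> (4 / 3) ^ T" using n by (subst (asm) ln_le_cancel_iff) auto
  have "1 \<le> T" unfolding T using pos by linarith
  then have "(3 :: real) ^ 1 \<le> 3 ^ T" by (intro power_increasing) auto
  then have "(4 / 3) ^ T * 2 \<le> (4 / 3) ^ T * (3 :: real) ^ T" by (intro mult_left_mono) auto
  also have "\<dots> = 4 ^ T" by (simp add: power_mult_distrib[symmetric])
  finally show ?thesis using nT by linarith
qed

context margin_setting
begin

text \<open>
  The order of the entropy of partitions into \<open>k\<close> Voronoi cells.
\<close>

definition "W = (real k)\<^sup>2 * real d * ln (real k)"

lemma W_ge_1: "1 \<le> W"
proof -
  have "2 / 3 \<le> ln (2 :: real)" using ln2_ge_two_thirds .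
  also have "\<dots> \<le> ln (real k)" using k by (intro ln_mono) auto
  finally have lnk: "2 / 3 \<le> ln (real k)" .
  have "(2 :: real)\<^sup>2 \<le> (real k)\<^sup>2" using k by (intro power_mono) auto
  then have "4 * 1 \<le> (real k)\<^sup>2 * real d" using d by (intro mult_mono) auto
  then have "4 * (2 / 3) \<le> (real k)\<^sup>2 * real d * ln (real k)" using lnk by (intro mult_mono) auto
  then show ?thesis by (simp add: W_def)
qed

lemma min_distortion_eq: "a \<in> C \<Longrightarrow> min_distortion d k \<mu> = distortion d k \<mu> a"
  unfolding min_distortion_def by (rule cInf_eq_minimum) (auto simp: C_opt_def)

text \<open>
  The excess distortion is at most the total mass times the squared distance to the optimal
  codebook. The fluctuations \<open>e\<close> and \<open>Z\<close> have to satisfy two kinds of bounds: the bounds without \<open>x\<close>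
  keep the trajectory close to \<open>a\<close>, the bounds with \<open>x\<close> determine the final error.
\<close>

lemma lloyd_excess_le:
  assumes Q: "Q \<in> ball_measures d R M" and a: "a \<in> C" and n: "100 \<le> n"
    and e: "L2_set (\<lambda>p. cell_moments d k R a Q p - cell_moments d k R a \<mu> p) (moment_index d k) \<le> e" "e \<le> p * R0 / 64"
    and Z: "\<And>s. s \<in> {1..n} \<Longrightarrow> measure Q (strip d k a (real s * r0 / real n))
        \<le> 2 * measure \<mu> (strip d k a (real s * r0 / real n)) + Z" "0 \<le> Z" "Z \<le> p * R0 / (128 * R)"
    and c: "codebook_dist d k a c \<le> R0" and T: "T = nat \<lceil>ln (real n) / ln (4 / 3)\<rceil>" and x: "0 \<le> x"
    and e2: "e\<^sup>2 \<le> 67584 * (R\<^sup>2 * M\<^sup>2 * W * (1 + x) / real n)"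
    and Z2: "Z\<^sup>2 \<le> 2 * (M\<^sup>2 * W * (1 + x) / real n)"
  shows "distortion d k \<mu> ((lloyd_step d k Q ^^ T) c) - min_distortion d k \<mu>
    \<le> measure \<mu> (space \<mu>) * (B\<^sup>2 * r0\<^sup>2 / (512 * R\<^sup>2 * real n)
       + 10 ^ 8 * (M\<^sup>2 * R\<^sup>2 * (real k)\<^sup>2 * real d * ln (real k) / (real n * p\<^sup>2)) * (1 + x))"
proof -
  define \<nu> where "\<nu> = 4 * e / p + 8 * R * Z / p + 3 * R0 / real n"
  define D where "D = codebook_dist d k a ((lloyd_step d k Q ^^ T) c)"
  define E where "E = M\<^sup>2 * R\<^sup>2 * W * (1 + x) / (real n * p\<^sup>2)"
  have n0: "0 < real n" using n by simp
  have e0: "0 \<le> e" using e(1) L2_set_nonneg order_trans by blast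
  have \<nu>0: "0 \<le> \<nu>" unfolding \<nu>_def using e0 p_pos R Z(2) R0_pos n0 by (intro add_nonneg_nonneg) auto
  have "D \<le> R0 / 2 ^ T + 2 * \<nu> * (1 - 1 / 2 ^ T)"
    unfolding D_def \<nu>_def by (rule lloyd_iterates_dist_le[OF Q a n e Z c])
  also have "\<dots> \<le> R0 / 2 ^ T + 2 * \<nu>" using \<nu>0 by (simp add: right_diff_distrib)
  finally have "D\<^sup>2 \<le> (R0 / 2 ^ T + 2 * \<nu>)\<^sup>2" by (intro power_mono) (auto simp: D_def)
  also have "\<dots> \<le> 2 * (R0 / 2 ^ T)\<^sup>2 + 2 * (2 * \<nu>)\<^sup>2"
    using sum_squares_bound[of "R0 / 2 ^ T" "2 * \<nu>"] by (simp add: power2_sum)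
  also have "2 * (R0 / 2 ^ T)\<^sup>2 \<le> R0\<^sup>2 / real n"
  proof -
    have "(2 ^ T)\<^sup>2 = (4 ^ T :: real)" by (simp add: power2_eq_square power_mult_distrib[symmetric])
    then have "2 * (R0 / 2 ^ T)\<^sup>2 = R0\<^sup>2 * (2 / 4 ^ T)" by (simp add: power_divide)
    also have "\<dots> \<le> R0\<^sup>2 * (1 / real n)"
      using power_lloyd_steps_ge[OF _ T] n n0 by (intro mult_left_mono) (auto simp: field_simps)
    finally show ?thesis by simp
  qed
  also have "2 * (2 * \<nu>)\<^sup>2 \<le> 24 * ((4 * e / p)\<^sup>2 + (8 * R * Z / p)\<^sup>2 + (3 * R0 / real n)\<^sup>2)"
  proof -
    have sq: "(u + v + w)\<^sup>2 \<le> 3 * (u\<^sup>2 + v\<^sup>2 + w\<^sup>2)" for u v w :: real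
    proof -
      have "3 * (u\<^sup>2 + v\<^sup>2 + w\<^sup>2) - (u + v + w)\<^sup>2 = (u - v)\<^sup>2 + (u - w)\<^sup>2 + (v - w)\<^sup>2"
        by (simp add: power2_eq_square algebra_simps)
      then show ?thesis using zero_le_power2[of "u - v"] zero_le_power2[of "u - w"] zero_le_power2[of "v - w"] by linarith
    qed
    have "2 * (2 * \<nu>)\<^sup>2 = 8 * \<nu>\<^sup>2" by (simp add: power_mult_distrib)
    then show ?thesis using sq[of "4 * e / p" "8 * R * Z / p" "3 * R0 / real n"] unfolding \<nu>_def by linarith
  qed
  also have "(4 * e / p)\<^sup>2 \<le> 1081344 * E"
  proof -
    have "(4 * e / p)\<^sup>2 = 16 / p\<^sup>2 * e\<^sup>2" by (simp add: power_divide power_mult_distrib)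
    also have "\<dots> \<le> 16 / p\<^sup>2 * (67584 * (R\<^sup>2 * M\<^sup>2 * W * (1 + x) / real n))" using e2 by (intro mult_left_mono) auto
    finally show ?thesis using p_pos n0 by (simp add: E_def mult_ac)
  qed
  also have "(8 * R * Z / p)\<^sup>2 \<le> 128 * E"
  proof -
    have "(8 * R * Z / p)\<^sup>2 = 64 * R\<^sup>2 / p\<^sup>2 * Z\<^sup>2" by (simp add: power_divide power_mult_distrib)
    also have "\<dots> \<le> 64 * R\<^sup>2 / p\<^sup>2 * (2 * (M\<^sup>2 * W * (1 + x) / real n))" using Z2 by (intro mult_left_mono) auto
    finally show ?thesis using p_pos n0 by (simp add: E_def mult_ac)
  qed
  also have "(3 * R0 / real n)\<^sup>2 \<le> 9 * E"
  proof -
    have "p\<^sup>2 \<le> M\<^sup>2" using p_le_mass mass_le p_pos by (intro power_mono) auto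
    then have pM: "1 \<le> M\<^sup>2 / p\<^sup>2" using p_pos by simp
    have "1 * 1 \<le> W * (1 + x)" using W_ge_1 x by (intro mult_mono) auto
    then have W1: "1 \<le> W * (1 + x)" by simp
    have "R0\<^sup>2 \<le> R\<^sup>2" using R0_le R0_pos R by (intro power_mono) auto
    moreover have "1 / (real n)\<^sup>2 \<le> 1 / real n" using n0 n by (simp add: field_simps power2_eq_square)
    ultimately have "R0\<^sup>2 * (1 / (real n)\<^sup>2) \<le> R\<^sup>2 * (1 / real n)" by (intro mult_mono) auto
    also have "\<dots> = R\<^sup>2 * (1 / real n) * (1 * 1)" by simp
    also have "\<dots> \<le> R\<^sup>2 * (1 / real n) * ((M\<^sup>2 / p\<^sup>2) * (W * (1 + x)))"
      using pM W1 by (intro mult_left_mono mult_mono) auto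
    also have "\<dots> = E" by (simp add: E_def)
    finally show ?thesis by (simp add: power_divide power_mult_distrib)
  qed
  finally have D2: "D\<^sup>2 \<le> R0\<^sup>2 / real n + 24 * (1081344 * E + 128 * E + 9 * E)" by simp
  have E0: "0 \<le> E" using W_ge_1 x n0 by (simp add: E_def)
  have D3: "D\<^sup>2 \<le> R0\<^sup>2 / real n + 10 ^ 8 * E" using D2 E0 by simp
  have R02: "R0\<^sup>2 / real n = B\<^sup>2 * r0\<^sup>2 / (512 * R\<^sup>2 * real n)"
    by (simp add: R0_def power_divide power_mult_distrib)
  have Eeq: "10 ^ 8 * E = 10 ^ 8 * (M\<^sup>2 * R\<^sup>2 * (real k)\<^sup>2 * real d * ln (real k) / (real n * p\<^sup>2)) * (1 + x)"
    by (simp add: E_def W_def)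
  have "distortion d k \<mu> ((lloyd_step d k Q ^^ T) c) - min_distortion d k \<mu> \<le> measure \<mu> (space \<mu>) * D\<^sup>2"
    unfolding min_distortion_eq[OF a] D_def by (rule distortion_excess_le[OF \<mu> k1 a cell_pos[OF a]])
  also have "\<dots> \<le> measure \<mu> (space \<mu>) * (R0\<^sup>2 / real n + 10 ^ 8 * E)" using D3 by (intro mult_left_mono) auto
  finally show ?thesis unfolding R02 Eeq .
qed

definition "\<rho> c c' = measure \<mu> (mismatch d k c c') / measure \<mu> (space \<mu>)"

lemma mass_pos: "0 < measure \<mu> (space \<mu>)" using p_le_mass p_pos by linarith

text \<open>
  The entropy of the optimal codebooks in the metric \<open>\<rho>\<close>, in the form required for chaining. As
  \<open>k \<ge> 2\<close>, a multiple of \<open>ln k\<close> absorbs all constants.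
\<close>

lemma packing_C_opt:
  assumes G: "G \<subseteq> C" and sep: "\<And>c c'. c \<in> G \<Longrightarrow> c' \<in> G \<Longrightarrow> c \<noteq> c' \<Longrightarrow> 1 / 4 ^ s \<le> \<rho> c c'"
  shows "ln (real (card G)) \<le> 22 * W * real (Suc s)"
proof -
  have lnk: "ln 2 \<le> ln (real k)" using k by (intro ln_mono) auto
  have l2: "2 / 3 \<le> ln (2 :: real)" "ln (2 :: real) \<le> 25 / 36" using ln2_ge_two_thirds ln2_le_25_over_36 by auto
  have "ln (real (card G)) \<le> (real k)\<^sup>2 * real (Suc d) * (3 + 2 * ln (2 * (real k)\<^sup>2 / (1 / 4 ^ s)))"
  proof (rule ln_card_separated_codebooks[OF _ ball_measuresD(1)[OF \<mu>] mass_pos])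
    show "finite G" using G finite_C_opt by (rule finite_subset)
    fix c c' assume "c \<in> G" "c' \<in> G" "c \<noteq> c'"
    then have "1 / 4 ^ s \<le> \<rho> c c'" by (rule sep)
    then show "1 / 4 ^ s * measure \<mu> (space \<mu>) \<le> measure \<mu> (mismatch d k c c')"
      using mass_pos by (simp add: \<rho>_def field_simps)
  qed (use d k1 \<mu>.finite_measure_axioms in auto)
  also have "ln (2 * (real k)\<^sup>2 / (1 / 4 ^ s)) = ln 2 + 2 * ln (real k) + real s * ln 4"
    using k by (simp add: ln_mult ln_realpow)
  also have "ln (4 :: real) = 2 * ln 2" using ln_realpow[of 2 2] by simp
  also have "(real k)\<^sup>2 * real (Suc d) * (3 + 2 * (ln 2 + 2 * ln (real k) + real s * (2 * ln 2)))
      \<le> (real k)\<^sup>2 * (2 * real d) * (11 * ln (real k) * real (Suc s))"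
  proof (intro mult_mono)
    have arith: "3 + 2 * (u + 2 * v + t * (2 * u)) \<le> 11 * v * (1 + t)"
      if "2 / 3 \<le> u" "u \<le> 25 / 36" "u \<le> v" "0 \<le> t" for t u v :: real
    proof -
      have "t * u \<le> t * v" "0 \<le> t * v" using that by (auto intro: mult_left_mono)
      then have "3 + 2 * u + 4 * v + 4 * (t * u) \<le> 11 * v + 11 * (t * v)" using that by linarith
      then show ?thesis by (simp add: algebra_simps)
    qed
    show "3 + 2 * (ln 2 + 2 * ln (real k) + real s * (2 * ln 2)) \<le> 11 * ln (real k) * real (Suc s)"
      unfolding of_nat_Suc by (rule arith[OF l2 lnk]) simp
    show "0 \<le> 3 + 2 * (ln 2 + 2 * ln (real k) + real s * (2 * ln 2))"
      using lnk l2 by (intro add_nonneg_nonneg mult_nonneg_nonneg) auto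
  qed (use d in auto)
  also have "\<dots> = 22 * W * real (Suc s)" by (simp add: W_def)
  finally show ?thesis .
qed

lemma ex_separation_C_opt: "\<exists>S. \<forall>c\<in>C. \<forall>c'\<in>C. c \<noteq> c' \<longrightarrow> 1 / 4 ^ S \<le> \<rho> c c'"
proof -
  define P where "P = {q \<in> C \<times> C. fst q \<noteq> snd q}"
  have P: "finite P" using finite_C_opt by (simp add: P_def)
  have "\<exists>S. \<forall>q\<in>P. 1 / 4 ^ S \<le> \<rho> (fst q) (snd q)"
  proof -
    have "\<exists>S. 1 / 4 ^ S \<le> \<rho> (fst q) (snd q)" if "q \<in> P" for q
    proof -
      have "0 < \<rho> (fst q) (snd q)" using that mismatch_pos mass_pos by (auto simp: P_def \<rho>_def)
      then obtain S where "(1 / 4) ^ S < \<rho> (fst q) (snd q)" using real_arch_pow_inv[of _ "1 / 4"] by auto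
      then show ?thesis by (intro exI[of _ S]) (simp add: power_one_over)
    qed
    then obtain S where S: "\<And>q. q \<in> P \<Longrightarrow> 1 / 4 ^ S q \<le> \<rho> (fst q) (snd q)" by metis
    define S' where "S' = (\<Sum>q\<in>P. S q)"
    have "1 / 4 ^ S' \<le> \<rho> (fst q) (snd q)" if "q \<in> P" for q
    proof -
      have "S q \<le> S'" unfolding S'_def using P that by (intro member_le_sum) auto
      then have "1 / 4 ^ S' \<le> 1 / (4 ^ S q :: real)" by (intro divide_left_mono power_increasing) auto
      then show ?thesis using S[OF that] by linarith
    qed
    then show ?thesis by blast
  qed
  then show ?thesis unfolding P_def by fastforce
qed

end

locale sampled_setting =
  margin_setting d k R M r0 \<mu> +
  sample: iid_sample \<Omega> "measure_space_of d N R M" \<nu> Y n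
  for d k :: nat and R M r0 :: real and \<mu> :: "(nat \<Rightarrow> real) measure"
    and \<Omega> :: "'w measure" and N :: nat and \<nu> :: "(nat \<Rightarrow> real) measure measure"
    and Y :: "nat \<Rightarrow> 'w \<Rightarrow> (nat \<Rightarrow> real) measure" and n :: nat +
  assumes mean: "\<And>f c. f \<in> borel_measurable (Rd d) \<Longrightarrow> (\<And>u. u \<in> ball0 d R \<Longrightarrow> \<bar>f u\<bar> \<le> (c :: real)) \<Longrightarrow>
    (\<integral>y. (\<integral>u. f u \<partial>y) \<partial>\<nu>) = (\<integral>u. f u \<partial>\<mu>)"
begin

abbreviation "K \<equiv> measure_space_of d N R M"
abbreviation "I \<equiv> moment_index d k"
definition "Qn \<omega> = empirical_mean (Rd d) n (\<lambda>i. Y i \<omega>)"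

lemma space_K: "y \<in> space K \<Longrightarrow> y \<in> ball_measures d R M"
  by (simp add: space_measure_space_of discrete_ball_measures_def)

lemma Y_ball: "i \<in> {1..n} \<Longrightarrow> \<omega> \<in> space \<Omega> \<Longrightarrow> Y i \<omega> \<in> ball_measures d R M"
  using space_K measurable_space[OF sample.Y_measurable] by blast

lemma Qn_ball: "\<omega> \<in> space \<Omega> \<Longrightarrow> Qn \<omega> \<in> ball_measures d R M"
  unfolding Qn_def by (intro empirical_mean_ball sample.n Y_ball)

lemma n_pos: "0 < real n" using sample.n by simp

lemma integral_Qn:
  fixes f :: "(nat \<Rightarrow> real) \<Rightarrow> real"
  assumes "\<omega> \<in> space \<Omega>" "f \<in> borel_measurable (Rd d)" "\<And>u. u \<in> ball0 d R \<Longrightarrow> \<bar>f u\<bar> \<le> c"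
  shows "(\<Sum>i=1..n. \<integral>u. f u \<partial>Y i \<omega>) = real n * (\<integral>u. f u \<partial>Qn \<omega>)"
  unfolding Qn_def using n_pos
  by (subst integral_empirical_mean[OF sample.n Y_ball[OF _ assms(1)] M assms(2,3)]) auto

lemma integral_K_measurable:
  fixes f :: "(nat \<Rightarrow> real) \<Rightarrow> real"
  assumes "f \<in> borel_measurable (Rd d)" "\<And>u. u \<in> ball0 d R \<Longrightarrow> \<bar>f u\<bar> \<le> c"
  shows "(\<lambda>y. \<integral>u. f u \<partial>y) \<in> borel_measurable K"
  using assms by (intro borel_measurable_integral_kernel[OF measure_space_of_measurable_ident M])
    (simp_all add: case_prod_beta')

lemma moments_measurable:
  assumes "q \<in> I"
  shows "(\<lambda>y. cell_moments d k R c y q) \<in> borel_measurable K"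
proof -
  obtain j l where q: "q = (j, l)" "j \<in> {1..k}" "l \<in> {0..d}" using assms by auto
  show ?thesis unfolding q(1) cell_moments_def prod.case
    by (rule integral_K_measurable[OF cell_moment_measurable[OF q(2,3)] cell_moment_bounded[OF _ R q(3)]])
qed

lemma moments_bound: "y \<in> space K \<Longrightarrow> L2_set (cell_moments d k R c y) I \<le> 2 * R * M"
  by (rule norm_cell_moments_le[OF space_K R M k1])

lemma deviation_moments:
  assumes \<omega>: "\<omega> \<in> space \<Omega>"
  shows "sample.deviation I (cell_moments d k R c) \<omega>
    = real n * L2_set (\<lambda>q. cell_moments d k R c (Qn \<omega>) q - cell_moments d k R c \<mu> q) I"
proof -
  have "(\<Sum>i=1..n. cell_moments d k R c (Y i \<omega>) q) - real n * (\<integral>y. cell_moments d k R c y q \<partial>\<nu>)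
    = real n * (cell_moments d k R c (Qn \<omega>) q - cell_moments d k R c \<mu> q)" if qI: "q \<in> I" for q
  proof -
    obtain j l where q: "q = (j, l)" "j \<in> {1..k}" "l \<in> {0..d}" using qI by auto
    note f = cell_moment_measurable[OF q(2,3), of c R] cell_moment_bounded[OF _ R q(3), of _ k c j]
    show ?thesis unfolding q(1) cell_moments_def prod.case
      using integral_Qn[OF \<omega> f] mean[OF f] by (simp add: right_diff_distrib)
  qed
  then show ?thesis unfolding sample.deviation_def
    using n_pos by (subst L2_set_right_distrib) (auto intro!: L2_set_cong)
qed

text \<open>
  Cell moments differ at most by \<open>2 R\<close> times the mass of the mismatch. In the square of this mass
  one factor is bounded by \<open>M\<close>, and the mean of the other one is given by the mean measure.
\<close>

lemma moments_var:
  shows "(\<integral>y. (L2_set (\<lambda>q. cell_moments d k R c y q - cell_moments d k R c' y q) I)\<^sup>2 \<partial>\<nu>)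
    \<le> (2 * R * M)\<^sup>2 * \<rho> c c'"
proof -
  define f where "f = (\<lambda>y :: (nat \<Rightarrow> real) measure. \<integral>u. indicat_real (mismatch d k c c') u \<partial>y)"
  have ind: "indicat_real (mismatch d k c c') \<in> borel_measurable (Rd d)"
    by (intro borel_measurable_indicator sets_mismatch)
  have indb: "\<bar>indicat_real (mismatch d k c c') u\<bar> \<le> 1" for u by (simp add: indicator_def)
  have feq: "f y = measure y (mismatch d k c c')" if "y \<in> ball_measures d R M" for y
    using sets.sets_into_space[OF sets_mismatch] ball_measuresD(2)[OF that] by (simp add: f_def Int_absorb2)
  have fK: "f \<in> borel_measurable K" unfolding f_def by (rule integral_K_measurable[OF ind indb])
  have fM: "0 \<le> f y" "f y \<le> M" if "y \<in> ball_measures d R M" for y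
    using feq[OF that] finite_measure.bounded_measure[OF ball_measuresD(3)[OF that]] ball_measuresD(5)[OF that] M
    by (auto intro: order_trans)
  have le: "(L2_set (\<lambda>q. cell_moments d k R c y q - cell_moments d k R c' y q) I)\<^sup>2 \<le> 4 * R\<^sup>2 * M * f y"
    if "y \<in> space K" for y
    unfolding feq[OF space_K[OF that]] by (rule norm_cell_moments_diff_le[OF space_K[OF that] R M k1])
  have fint: "integrable \<nu> f" using fM space_K by (intro sample.integrable_\<nu>_bounded[OF fK, of M]) auto
  have "(\<integral>y. (L2_set (\<lambda>q. cell_moments d k R c y q - cell_moments d k R c' y q) I)\<^sup>2 \<partial>\<nu>)
      \<le> (\<integral>y. 4 * R\<^sup>2 * M * f y \<partial>\<nu>)"
  proof (rule integral_mono')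
    show "integrable \<nu> (\<lambda>y. 4 * R\<^sup>2 * M * f y)" using fint by simp
    fix y assume "y \<in> space \<nu>"
    then have y: "y \<in> space K" by (simp add: sample.space_\<nu>)
    show "(L2_set (\<lambda>q. cell_moments d k R c y q - cell_moments d k R c' y q) I)\<^sup>2 \<le> 4 * R\<^sup>2 * M * f y"
      by (rule le[OF y])
    show "0 \<le> (4 * R\<^sup>2 * M * f y)" using fM(1)[OF space_K[OF y]] M by simp
  qed
  also have "\<dots> = 4 * R\<^sup>2 * M * measure \<mu> (mismatch d k c c')"
    using mean[OF ind indb] feq[OF \<mu>] by (simp add: f_def)
  also have "\<dots> = 4 * R\<^sup>2 * M * measure \<mu> (space \<mu>) * \<rho> c c'" using mass_pos by (simp add: \<rho>_def)
  also have "\<dots> \<le> 4 * R\<^sup>2 * M * M * \<rho> c c'"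
    using mass_le M by (intro mult_right_mono mult_left_mono) (auto simp: \<rho>_def)
  also have "\<dots> = (2 * R * M)\<^sup>2 * \<rho> c c'" by (simp add: power2_eq_square)
  finally show ?thesis .
qed

lemma prob_moments_chaining:
  assumes S: "\<forall>c\<in>C. \<forall>c'\<in>C. c \<noteq> c' \<longrightarrow> 1 / 4 ^ S \<le> \<rho> c c'" and x: "0 \<le> x"
    and n_ge: "4 * 4 ^ S * ((22 * W + 2) * real (Suc S) + ln (4 * real (card C))) \<le> real n"
  shows "sample.prob {\<omega> \<in> space \<Omega>. \<exists>c\<in>C. 16 * (2 * R * M) * sqrt (real n * (3 * (22 * W) + x))
      < sample.deviation I (cell_moments d k R c) \<omega>} \<le> exp (- x) / 2"
proof (rule sample.prob_ex_deviation_gt_le[OF _ finite_C_opt C_opt_nonempty moments_measurable moments_bound])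
  show "\<rho> c c' = \<rho> c' c" for c c' by (simp add: \<rho>_def mismatch_commute[of d k c c'])
  show "ln (real (card G)) \<le> 22 * W * real (Suc s)"
    if "G \<subseteq> C" "\<And>c c'. c \<in> G \<Longrightarrow> c' \<in> G \<Longrightarrow> c \<noteq> c' \<Longrightarrow> 1 / 4 ^ s \<le> \<rho> c c'" for s G
    using that by (rule packing_C_opt)
  show "1 / 4 ^ S \<le> \<rho> c c'" if "c \<in> C" "c' \<in> C" "c \<noteq> c'" for c c' using S that by blast
  show "1 \<le> 22 * W" using W_ge_1 by simp
qed (use R M x n_ge moments_var in auto)

lemma prob_moments_gt:
  assumes \<tau>: "0 \<le> \<tau>"
  shows "sample.prob {\<omega> \<in> space \<Omega>. \<exists>c\<in>C. \<tau> < sample.deviation I (cell_moments d k R c) \<omega>}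
    \<le> real (card C) * (2 * exp (- (3 * \<tau>\<^sup>2 / (16 * real n * (2 * R * M)\<^sup>2))))"
proof -
  have ev: "{\<omega> \<in> space \<Omega>. \<tau> < sample.deviation I (cell_moments d k R c) \<omega>} \<in> sample.events" for c
    using sample.deviation_measurable[OF moments_measurable] by measurable
  have "sample.prob {\<omega> \<in> space \<Omega>. \<exists>c\<in>C. \<tau> < sample.deviation I (cell_moments d k R c) \<omega>}
      = sample.prob (\<Union>c\<in>C. {\<omega> \<in> space \<Omega>. \<tau> < sample.deviation I (cell_moments d k R c) \<omega>})"
    by (intro arg_cong[of _ _ sample.prob]) auto
  also have "\<dots> \<le> (\<Sum>c\<in>C. sample.prob {\<omega> \<in> space \<Omega>. \<tau> < sample.deviation I (cell_moments d k R c) \<omega>})"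
    using ev by (intro sample.finite_measure_subadditive_finite finite_C_opt) auto
  also have "\<dots> \<le> (\<Sum>c\<in>C. 2 * exp (- (3 * \<tau>\<^sup>2 / (16 * real n * (2 * R * M)\<^sup>2))))"
    using R M by (intro sum_mono sample.prob_deviation_gt_le_subgaussian[OF _ moments_measurable moments_bound _ \<tau>]) auto
  finally show ?thesis by simp
qed

text \<open>
  The masses of the strips exceed twice their means by at most \<open>O(ln n / n)\<close>, even after a union
  bound over all strips. This is of smaller order than the fluctuation of the cell moments.
\<close>

lemma prob_strip_gt:
  "sample.prob {\<omega> \<in> space \<Omega>. \<exists>c\<in>C. \<exists>s\<in>{1..n}.
      2 * measure \<mu> (strip d k c (real s * r0 / real n)) + z < measure (Qn \<omega>) (strip d k c (real s * r0 / real n))}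
    \<le> real (card C) * (real n * exp (- (real n * z / M)))"
  and strip_event: "{\<omega> \<in> space \<Omega>. \<exists>c\<in>C. \<exists>s\<in>{1..n}.
      2 * measure \<mu> (strip d k c (real s * r0 / real n)) + z < measure (Qn \<omega>) (strip d k c (real s * r0 / real n))}
    \<in> sample.events"
proof -
  define A where "A = (\<lambda>c s. strip d k c (real s * r0 / real n))"
  define f where "f = (\<lambda>c s (y :: (nat \<Rightarrow> real) measure). \<integral>u. indicat_real (A c s) u \<partial>y)"
  have A: "A c s \<in> sets (Rd d)" for c s by (simp add: A_def sets_strip)
  have ind: "indicat_real (A c s) \<in> borel_measurable (Rd d)" for c s using A by (rule borel_measurable_indicator)
  have indb: "\<bar>indicat_real (A c s) u\<bar> \<le> 1" for c s u by (simp add: indicator_def)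
  have feq: "f c s y = measure y (A c s)" if "y \<in> ball_measures d R M" for c s y
    using sets.sets_into_space[OF A] ball_measuresD(2)[OF that] by (simp add: f_def Int_absorb2)
  have fK: "f c s \<in> borel_measurable K" for c s unfolding f_def by (rule integral_K_measurable[OF ind indb])
  have fM: "0 \<le> f c s y" "f c s y \<le> M" if "y \<in> space K" for c s y
    using feq[OF space_K[OF that]] finite_measure.bounded_measure[OF ball_measuresD(3)[OF space_K[OF that]]]
      ball_measuresD(5)[OF space_K[OF that]] M
    by (auto intro: order_trans)
  define E where "E = (\<lambda>c s. {\<omega> \<in> space \<Omega>. 2 * real n * (\<integral>y. f c s y \<partial>\<nu>) + real n * z < (\<Sum>i=1..n. f c s (Y i \<omega>))})"
  have Eeq: "\<omega> \<in> E c s \<longleftrightarrow> 2 * measure \<mu> (A c s) + z < measure (Qn \<omega>) (A c s)" if \<omega>: "\<omega> \<in> space \<Omega>" for \<omega> c s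
  proof -
    have "(\<Sum>i=1..n. f c s (Y i \<omega>)) = real n * measure (Qn \<omega>) (A c s)"
      using integral_Qn[OF \<omega> ind indb] feq[OF Qn_ball[OF \<omega>]] by (simp add: f_def)
    moreover have "(\<integral>y. f c s y \<partial>\<nu>) = measure \<mu> (A c s)"
      using mean[OF ind indb] feq[OF \<mu>] by (simp add: f_def)
    moreover have "2 * real n * m + real n * z = real n * (2 * m + z)" for m by (simp add: algebra_simps)
    ultimately show ?thesis using \<omega> n_pos by (simp add: E_def)
  qed
  have ev: "E c s \<in> sample.events" for c s
  proof -
    have "(\<lambda>\<omega>. \<Sum>i=1..n. f c s (Y i \<omega>)) \<in> borel_measurable \<Omega>"
      using measurable_compose[OF sample.Y_measurable fK] by (intro borel_measurable_sum)
    then show ?thesis unfolding E_def by measurable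
  qed
  have U: "{\<omega> \<in> space \<Omega>. \<exists>c\<in>C. \<exists>s\<in>{1..n}. 2 * measure \<mu> (strip d k c (real s * r0 / real n)) + z
      < measure (Qn \<omega>) (strip d k c (real s * r0 / real n))} = (\<Union>q\<in>C \<times> {1..n}. E (fst q) (snd q))"
    (is "?L = ?U")
  proof (intro equalityI subsetI)
    fix \<omega> assume "\<omega> \<in> ?L"
    then obtain c s where cs: "\<omega> \<in> space \<Omega>" "c \<in> C" "s \<in> {1..n}"
      "2 * measure \<mu> (A c s) + z < measure (Qn \<omega>) (A c s)" by (auto simp: A_def)
    then have "\<omega> \<in> E (fst (c, s)) (snd (c, s))" by (simp add: Eeq)
    then show "\<omega> \<in> ?U" using cs by (intro UN_I[of "(c, s)"]) auto
  next
    fix \<omega> assume "\<omega> \<in> ?U"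
    then obtain c s where cs: "c \<in> C" "s \<in> {1..n}" "\<omega> \<in> E c s" by auto
    moreover have "\<omega> \<in> space \<Omega>" using cs(3) by (simp add: E_def)
    ultimately have "2 * measure \<mu> (A c s) + z < measure (Qn \<omega>) (A c s)" by (simp add: Eeq)
    then show "\<omega> \<in> ?L" unfolding A_def using \<open>\<omega> \<in> space \<Omega>\<close>
      by (intro CollectI conjI bexI[OF _ cs(1)] bexI[OF _ cs(2)])
  qed
  show "?L \<in> sample.events" unfolding U using ev finite_C_opt by (intro sets.finite_UN) auto
  have "sample.prob ?L \<le> (\<Sum>q\<in>C \<times> {1..n}. sample.prob (E (fst q) (snd q)))"
    unfolding U using ev finite_C_opt by (intro sample.finite_measure_subadditive_finite) auto
  also have "\<dots> \<le> (\<Sum>q\<in>C \<times> {1..n}. exp (- (real n * z / M)))"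
    unfolding E_def using M by (intro sum_mono sample.prob_sum_gt_twice_mean_le fK fM) auto
  also have "\<dots> = real (card C) * (real n * exp (- (real n * z / M)))"
    by (simp add: card_cartesian_product)
  finally show "sample.prob ?L \<le> real (card C) * (real n * exp (- (real n * z / M)))" .
qed

end


section \<open>The probability of a small excess distortion\<close>

context sampled_setting
begin

text \<open>
  Two of the four exceptional events keep the trajectories near the optimal codebooks. Their
  thresholds do not shrink with \<open>n\<close>, hence their probability is exponentially small in \<open>n\<close>, up to
  polynomial factors that are absorbed by halving the exponent \<open>3 / 262144\<close>. The other two determine
  the accuracy and are responsible for the term \<open>exp (- x)\<close>.
\<close>

lemma prob_lloyd_excess:
  fixes c0 :: "'w \<Rightarrow> nat \<Rightarrow> nat \<Rightarrow> real"
  defines "\<theta> \<equiv> p\<^sup>2 * (R0 / R)\<^sup>2 / M\<^sup>2"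
  assumes S: "\<forall>c\<in>C. \<forall>c'\<in>C. c \<noteq> c' \<longrightarrow> 1 / 4 ^ S \<le> \<rho> c c'" and x: "0 < x"
    and n100: "100 \<le> n"
    and n_ge: "4 * 4 ^ S * ((22 * W + 2) * real (Suc S) + ln (4 * real (card C))) \<le> real n"
    and n_log: "(ln (4 * real n * real (card C)))\<^sup>2 \<le> real n"
    and n_exp: "real (card C) * (2 + real n) * exp (- (3 / 524288 * real n * \<theta>)) \<le> 9"
    and c0: "c0 \<in> measurable \<Omega> (codebook_space d k)" and T: "T = nat \<lceil>ln (real n) / ln (4 / 3)\<rceil>"
  shows "1 - 9 * exp (- (3 / 524288 * real n * \<theta>)) - exp (- x) \<le> sample.prob {\<omega> \<in> space \<Omega>.
    c0 \<omega> \<in> codebook_neighbourhood d k C R0 \<longrightarrow>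
    distortion d k \<mu> ((lloyd_step d k (Qn \<omega>) ^^ T) (c0 \<omega>)) - min_distortion d k \<mu>
    \<le> measure \<mu> (space \<mu>) * (B\<^sup>2 * r0\<^sup>2 / (512 * R\<^sup>2 * real n)
       + 10 ^ 8 * (M\<^sup>2 * R\<^sup>2 * (real k)\<^sup>2 * real d * ln (real k) / (real n * p\<^sup>2)) * (1 + x))}"
    (is "_ \<le> sample.prob ?Ev")
proof -
  define q where "q = real (card C)"
  define dev where "dev = (\<lambda>c. sample.deviation I (cell_moments d k R c))"
  define gap where "gap = (\<lambda>z. {\<omega> \<in> space \<Omega>. \<exists>c\<in>C. \<exists>s\<in>{1..n}.
      2 * measure \<mu> (strip d k c (real s * r0 / real n)) + z < measure (Qn \<omega>) (strip d k c (real s * r0 / real n))})"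
  define \<tau>1 where "\<tau>1 = real n * (p * R0 / 64)"
  define \<tau>2 where "\<tau>2 = 16 * (2 * R * M) * sqrt (real n * (3 * (22 * W) + x))"
  define z1 where "z1 = p * R0 / (128 * R)"
  define y where "y = x + ln (4 * real n * q)"
  define z2 where "z2 = M * y / real n"
  define A1 where "A1 = {\<omega> \<in> space \<Omega>. \<exists>c\<in>C. \<tau>1 < dev c \<omega>}"
  define A2 where "A2 = {\<omega> \<in> space \<Omega>. \<exists>c\<in>C. \<tau>2 < dev c \<omega>}"
  have q1: "1 \<le> q" using C_opt_nonempty finite_C_opt by (simp add: q_def Suc_leI card_gt_0_iff)
  have lnq: "0 \<le> ln (4 * real n * q)"
  proof -
    have "1 * 1 \<le> (4 * real n) * q" using n100 q1 by (intro mult_mono) auto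
    then show ?thesis by simp
  qed
  have z0: "0 \<le> z1" "0 \<le> z2"
    using p_pos R0_pos R M x lnq n_pos by (auto simp: z1_def z2_def y_def)
  have devm: "dev c \<in> borel_measurable \<Omega>" for c
    unfolding dev_def by (rule sample.deviation_measurable[OF moments_measurable])
  have Am: "{\<omega> \<in> space \<Omega>. \<exists>c\<in>C. t < dev c \<omega>} \<in> sample.events" for t
    using devm finite_C_opt by (intro sets.sets_Collect_finite_Ex) auto
  have gapm: "gap z \<in> sample.events" for z unfolding gap_def by (rule strip_event)
  have gapP: "sample.prob (gap z) \<le> q * (real n * exp (- (real n * z / M)))" for z
    unfolding gap_def q_def by (rule prob_strip_gt)
  have \<theta>0: "0 \<le> \<theta>" by (simp add: \<theta>_def)
  have P1: "sample.prob A1 \<le> q * (2 * exp (- (3 / 262144 * real n * \<theta>)))"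
  proof -
    have e1: "3 * \<tau>1\<^sup>2 / (16 * real n * (2 * R * M)\<^sup>2) = 3 / 262144 * real n * \<theta>"
      using n_pos R M by (simp add: \<tau>1_def \<theta>_def power_mult_distrib power_divide field_simps power2_eq_square)
    have "0 \<le> \<tau>1" using p_pos R0_pos by (simp add: \<tau>1_def)
    from prob_moments_gt[OF this] show ?thesis unfolding e1 A1_def dev_def q_def .
  qed
  have P2: "sample.prob (gap z1) \<le> q * (real n * exp (- (3 / 262144 * real n * \<theta>)))"
  proof -
    define w where "w = p * (R0 / R) / M"
    have "p * (R0 / R) \<le> M * 1"
      using p_le_mass mass_le p_pos R0_le R0_pos R by (intro mult_mono) auto
    then have w: "0 \<le> w" "w \<le> 1" using p_pos R0_pos R M by (auto simp: w_def field_simps)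
    have "\<theta> = w\<^sup>2" by (simp add: \<theta>_def w_def power_mult_distrib power_divide)
    also have "\<dots> \<le> w" using w power_decreasing[of 1 2 w] by simp
    finally have \<theta>w: "\<theta> \<le> w" .
    have "3 / 262144 * real n * \<theta> \<le> 1 / 128 * real n * w"
      using \<theta>w \<theta>0 by (intro mult_mono) auto
    also have "\<dots> = real n * z1 / M" using R by (simp add: z1_def w_def)
    finally have "exp (- (real n * z1 / M)) \<le> exp (- (3 / 262144 * real n * \<theta>))" by simp
    then have "q * (real n * exp (- (real n * z1 / M))) \<le> q * (real n * exp (- (3 / 262144 * real n * \<theta>)))"
      using q1 by (intro mult_left_mono) auto
    then show ?thesis using gapP[of z1] by linarith
  qed
  have P3: "sample.prob A2 \<le> exp (- x) / 2"
    unfolding A2_def dev_def \<tau>2_def by (rule prob_moments_chaining[OF S less_imp_le[OF x] n_ge])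
  have P4: "sample.prob (gap z2) \<le> exp (- x) / 4"
  proof -
    have "q * (real n * exp (- (real n * z2 / M))) = q * (real n * exp (- y))"
      using M n_pos by (simp add: z2_def)
    also have "exp (- y) = exp (- x) / (4 * real n * q)"
    proof -
      have "0 < 4 * real n * q" using n_pos q1 by simp
      moreover have "- y = - x - ln (4 * real n * q)" by (simp add: y_def)
      ultimately show ?thesis by (simp only: exp_diff exp_ln)
    qed
    also have "q * (real n * (exp (- x) / (4 * real n * q))) = exp (- x) / 4" using n_pos q1 by simp
    finally have e: "q * (real n * exp (- (real n * z2 / M))) = exp (- x) / 4" .
    show ?thesis using gapP[of z2] unfolding e .
  qed
  define Bad where "Bad = (A1 \<union> gap z1) \<union> (A2 \<union> gap z2)"
  have ev: "A1 \<in> sample.events" "A2 \<in> sample.events" using Am by (auto simp: A1_def A2_def)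
  have "sample.prob Bad \<le> (sample.prob A1 + sample.prob (gap z1)) + (sample.prob A2 + sample.prob (gap z2))"
    unfolding Bad_def using ev gapm
    by (intro order_trans[OF measure_Un_le] add_mono) (auto intro: measure_Un_le)
  also have "\<dots> \<le> (q * (2 * exp (- (3 / 262144 * real n * \<theta>))) + q * (real n * exp (- (3 / 262144 * real n * \<theta>))))
      + (exp (- x) / 2 + exp (- x) / 4)"
    by (intro add_mono P1 P2 P3 P4)
  also have "\<dots> \<le> 9 * exp (- (3 / 524288 * real n * \<theta>)) + exp (- x)"
  proof (intro add_mono)
    define E where "E = exp (- (3 / 524288 * real n * \<theta>))"
    have "exp (- (3 / 262144 * real n * \<theta>)) = E * E" unfolding E_def exp_add[symmetric] by simp
    then have "q * (2 * exp (- (3 / 262144 * real n * \<theta>))) + q * (real n * exp (- (3 / 262144 * real n * \<theta>)))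
        = (q * (2 + real n) * E) * E" by (simp add: algebra_simps)
    also have "\<dots> \<le> 9 * E" using n_exp by (intro mult_right_mono) (auto simp: q_def E_def)
    finally show "q * (2 * exp (- (3 / 262144 * real n * \<theta>))) + q * (real n * exp (- (3 / 262144 * real n * \<theta>)))
        \<le> 9 * exp (- (3 / 524288 * real n * \<theta>))" by (simp add: E_def)
  qed simp
  finally have PBad: "sample.prob Bad \<le> 9 * exp (- (3 / 524288 * real n * \<theta>)) + exp (- x)" .
  have Bm: "Bad \<in> sample.events" unfolding Bad_def using ev gapm by auto
  have Evm: "?Ev \<in> sample.events"
  proof -
    have L: "Qn \<in> measurable \<Omega> (ball_measure_space d R M)"
      unfolding Qn_def[abs_def]
      by (intro measurable_empirical_mean sample.n measurable_measure_space_ofD[OF sample.Y_measurable])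
    have Dm: "(\<lambda>\<omega>. distortion d k \<mu> ((lloyd_step d k (Qn \<omega>) ^^ T) (c0 \<omega>))) \<in> borel_measurable \<Omega>"
      by (rule measurable_distortion[OF \<mu> measurable_lloyd_iterates[OF L M c0] k1])
    have le: "{\<omega> \<in> space \<Omega>. distortion d k \<mu> ((lloyd_step d k (Qn \<omega>) ^^ T) (c0 \<omega>)) - min_distortion d k \<mu> \<le> t} \<in> sample.events" for t
      by (intro borel_measurable_le borel_measurable_diff Dm borel_measurable_const)
    have start: "{\<omega> \<in> space \<Omega>. c0 \<omega> \<in> codebook_neighbourhood d k C R0} \<in> sample.events"
      using measurable_sets[OF c0 sets_codebook_neighbourhood[OF finite_C_opt, of d k R0]] in_codebooks
      by (simp add: vimage_def Int_def conj_commute subset_iff)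
    show ?thesis by (rule sets.sets_Collect_imp[OF le start])
  qed
  have "space \<Omega> - Bad \<subseteq> ?Ev"
  proof (intro subsetI CollectI conjI impI)
    fix \<omega> assume \<omega>B: "\<omega> \<in> space \<Omega> - Bad"
    then show \<omega>: "\<omega> \<in> space \<Omega>" by simp
    assume "c0 \<omega> \<in> codebook_neighbourhood d k C R0"
    then obtain a where a: "a \<in> C" "codebook_dist d k a (c0 \<omega>) \<le> R0"
      by (auto simp: codebook_neighbourhood_def)
    define e where "e = L2_set (\<lambda>p. cell_moments d k R a (Qn \<omega>) p - cell_moments d k R a \<mu> p) I"
    have dev: "dev a \<omega> = real n * e" unfolding dev_def e_def by (rule deviation_moments[OF \<omega>])
    have "\<omega> \<notin> A1" using \<omega>B by (simp add: Bad_def)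
    then have "dev a \<omega> \<le> \<tau>1" using \<omega> a(1) by (auto simp: A1_def not_less)
    then have e1: "e \<le> p * R0 / 64" using n_pos by (simp add: dev \<tau>1_def)
    have "\<omega> \<notin> A2" using \<omega>B by (simp add: Bad_def)
    then have "dev a \<omega> \<le> \<tau>2" using \<omega> a(1) by (auto simp: A2_def not_less)
    then have "(real n * e)\<^sup>2 \<le> \<tau>2\<^sup>2" unfolding dev by (intro power_mono) (auto simp: e_def)
    also have "\<tau>2\<^sup>2 = 1024 * R\<^sup>2 * M\<^sup>2 * (real n * (66 * W + x))"
      using W_ge_1 x by (simp add: \<tau>2_def power_mult_distrib)
    also have "\<dots> \<le> 1024 * R\<^sup>2 * M\<^sup>2 * (real n * (66 * (W * (1 + x))))"
    proof -
      have "1 * x \<le> W * x" using W_ge_1 x by (intro mult_right_mono) auto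
      then have "66 * W + x \<le> 66 * (W * (1 + x))" using x by (simp add: distrib_left)
      then show ?thesis by (intro mult_left_mono) auto
    qed
    finally have "(real n)\<^sup>2 * e\<^sup>2 \<le> (real n)\<^sup>2 * (67584 * (R\<^sup>2 * M\<^sup>2 * W * (1 + x) / real n))"
      using n_pos by (simp add: power_mult_distrib power2_eq_square mult_ac)
    then have e2: "e\<^sup>2 \<le> 67584 * (R\<^sup>2 * M\<^sup>2 * W * (1 + x) / real n)"
      by (rule mult_left_le_imp_le) (use n_pos in simp)
    \<comment> \<open>\<open>z1\<close> keeps the trajectory near \<open>a\<close> and is the better bound when \<open>x > n\<close>; \<open>z2\<close> is sharp for \<open>x \<le> n\<close>.\<close>
    define Z where "Z = min z1 z2"
    have ng: "\<omega> \<notin> gap z1" "\<omega> \<notin> gap z2" using \<omega>B by (auto simp: Bad_def)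
    have Zs: "measure (Qn \<omega>) (strip d k a (real s * r0 / real n))
        \<le> 2 * measure \<mu> (strip d k a (real s * r0 / real n)) + Z" if "s \<in> {1..n}" for s
    proof -
      have "\<not> 2 * measure \<mu> (strip d k a (real s * r0 / real n)) + z < measure (Qn \<omega>) (strip d k a (real s * r0 / real n))"
        if "\<omega> \<notin> gap z" for z
        using that \<omega> a(1) \<open>s \<in> {1..n}\<close> unfolding gap_def by blast
      then show ?thesis using ng unfolding Z_def min_def by (auto simp: not_less)
    qed
    have "Z\<^sup>2 \<le> 2 * (M\<^sup>2 * (1 + x) / real n)"
    proof (cases "x \<le> real n")
      case True
      have "y\<^sup>2 \<le> 2 * x\<^sup>2 + 2 * (ln (4 * real n * q))\<^sup>2"
        unfolding y_def using sum_squares_bound[of x "ln (4 * real n * q)"] by (simp add: power2_sum)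
      also have "\<dots> \<le> 2 * (real n * x) + 2 * real n"
        using n_log True x by (intro add_mono) (auto simp: q_def power2_eq_square)
      finally have "y\<^sup>2 \<le> 2 * (1 + x) * real n" by (simp add: algebra_simps)
      then have "M\<^sup>2 / (real n)\<^sup>2 * y\<^sup>2 \<le> M\<^sup>2 / (real n)\<^sup>2 * (2 * (1 + x) * real n)" by (intro mult_left_mono) auto
      moreover have "Z\<^sup>2 \<le> z2\<^sup>2" using z0 by (intro power_mono) (auto simp: Z_def)
      moreover have "z2\<^sup>2 = M\<^sup>2 / (real n)\<^sup>2 * y\<^sup>2" by (simp add: z2_def power_mult_distrib power_divide)
      moreover have "M\<^sup>2 / (real n)\<^sup>2 * (2 * (1 + x) * real n) = 2 * (M\<^sup>2 * (1 + x) / real n)"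
        using n_pos by (simp add: power2_eq_square)
      ultimately show ?thesis by linarith
    next
      case False
      have "p * R0 \<le> M * R" using p_le_mass mass_le p_pos R0_le R0_pos R by (intro mult_mono) auto
      then have "p * R0 \<le> M * (128 * R)" using mult_pos_pos[OF M R] by linarith
      then have "z1 \<le> M" using R by (simp add: z1_def pos_divide_le_eq)
      then have "Z\<^sup>2 \<le> M\<^sup>2" using z0 by (intro power_mono) (auto simp: Z_def)
      also have "\<dots> = M\<^sup>2 * 1" by simp
      also have "\<dots> \<le> M\<^sup>2 * (2 * (1 + x) / real n)"
        using False n_pos by (intro mult_left_mono) (auto simp: field_simps)
      also have "\<dots> = 2 * (M\<^sup>2 * (1 + x) / real n)" by (simp add: algebra_simps)
      finally show ?thesis .
    qed
    also have "\<dots> \<le> 2 * (M\<^sup>2 * W * (1 + x) / real n)"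
    proof -
      have "M\<^sup>2 * 1 \<le> M\<^sup>2 * W" by (intro mult_left_mono W_ge_1) simp
      then show ?thesis using x n_pos by (intro mult_left_mono divide_right_mono mult_right_mono) auto
    qed
    finally have Z2: "Z\<^sup>2 \<le> 2 * (M\<^sup>2 * W * (1 + x) / real n)" .
    have Z1: "0 \<le> Z" "Z \<le> p * R0 / (128 * R)" using z0 by (auto simp: Z_def z1_def)
    show "distortion d k \<mu> ((lloyd_step d k (Qn \<omega>) ^^ T) (c0 \<omega>)) - min_distortion d k \<mu>
      \<le> measure \<mu> (space \<mu>) * (B\<^sup>2 * r0\<^sup>2 / (512 * R\<^sup>2 * real n)
       + 10 ^ 8 * (M\<^sup>2 * R\<^sup>2 * (real k)\<^sup>2 * real d * ln (real k) / (real n * p\<^sup>2)) * (1 + x))"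
      using x by (intro lloyd_excess_le[OF Qn_ball[OF \<omega>] a(1) n100 _ e1 Zs Z1 a(2) T _ e2 Z2]) (auto simp: e_def)
  qed
  then have "sample.prob (space \<Omega> - Bad) \<le> sample.prob ?Ev" using Evm by (rule sample.finite_measure_mono)
  then show ?thesis using PBad sample.prob_compl[OF Bm] by linarith
qed

end

text \<open>
  All requirements on the sample size hold eventually, because the number of optimal codebooks
  does not depend on \<open>n\<close>.
\<close>

lemma (in margin_setting) eventually_sample_large:
  assumes \<theta>: "0 < \<theta>"
  shows "\<forall>\<^sub>F n in sequentially. 100 \<le> n \<and> a \<le> real n \<and> (ln (4 * real n * real (card C)))\<^sup>2 \<le> real n \<and>
    real (card C) * (2 + real n) * exp (- (3 / 524288 * real n * \<theta>)) \<le> 9"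
proof (intro eventually_conj)
  define q where "q = real (card C)"
  have q: "0 < q" using C_opt_nonempty finite_C_opt by (simp add: q_def card_gt_0_iff)
  show "\<forall>\<^sub>F n in sequentially. 100 \<le> n" by (rule eventually_ge_at_top)
  show "\<forall>\<^sub>F n in sequentially. a \<le> real n" by real_asymp
  have "\<forall>\<^sub>F n in sequentially. (ln (4 * real n * q))\<^sup>2 \<le> real n" using q by real_asymp
  then show "\<forall>\<^sub>F n in sequentially. (ln (4 * real n * real (card C)))\<^sup>2 \<le> real n" by (simp add: q_def)
  have "\<forall>\<^sub>F n in sequentially. q * (2 + real n) * exp (- (3 / 524288 * real n * \<theta>)) \<le> 9" using q \<theta> by real_asymp
  then show "\<forall>\<^sub>F n in sequentially. real (card C) * (2 + real n) * exp (- (3 / 524288 * real n * \<theta>)) \<le> 9"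
    by (simp add: q_def)
qed

theorem theorem9:
  shows "\<exists>c1 > (0::real). \<exists>C > (0::real).
    \<forall>(d::nat) (k::nat) (N\<^sub>m\<^sub>a\<^sub>x::nat) (R::real) (M::real) (r0::real)
      (\<Omega>' :: 'v measure) (X :: 'v \<Rightarrow> (nat \<Rightarrow> real) measure) (\<mu> :: (nat \<Rightarrow> real) measure)
      (B::real) (p::real) (R0::real) (\<kappa>0::real).
      1 \<le> d \<longrightarrow> 2 \<le> k \<longrightarrow> 1 \<le> N\<^sub>m\<^sub>a\<^sub>x \<longrightarrow> 0 < R \<longrightarrow> 0 < M \<longrightarrow>
      prob_space \<Omega>' \<longrightarrow>
      X \<in> measurable \<Omega>' (measure_space_of d N\<^sub>m\<^sub>a\<^sub>x R M) \<longrightarrow>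
      \<mu> = mean_measure \<Omega>' (Rd d) X \<longrightarrow>
      \<not> supported_by_at_most k \<mu> \<longrightarrow>
      0 < r0 \<longrightarrow> margin_condition d k R \<mu> r0 \<longrightarrow>
      B = B_sep d k \<mu> \<longrightarrow> p = p_min d k \<mu> \<longrightarrow>
      R0 = B * r0 / (16 * sqrt 2 * R) \<longrightarrow> \<kappa>0 = R0 / R \<longrightarrow>
      (\<exists>n0. \<forall>n\<ge>n0. \<forall>x>(0::real).
        \<forall>(\<Omega> :: 'w measure) (Xs :: nat \<Rightarrow> 'w \<Rightarrow> (nat \<Rightarrow> real) measure)
          (c0 :: 'w \<Rightarrow> nat \<Rightarrow> nat \<Rightarrow> real) (T::nat) (cT :: 'w \<Rightarrow> nat \<Rightarrow> nat \<Rightarrow> real).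
          prob_space \<Omega> \<longrightarrow>
          prob_space.indep_vars \<Omega> (\<lambda>_. measure_space_of d N\<^sub>m\<^sub>a\<^sub>x R M) Xs {1..n} \<longrightarrow>
          (\<forall>i\<in>{1..n}. distr \<Omega> (measure_space_of d N\<^sub>m\<^sub>a\<^sub>x R M) (Xs i)
                     = distr \<Omega>' (measure_space_of d N\<^sub>m\<^sub>a\<^sub>x R M) X) \<longrightarrow>
          c0 \<in> measurable \<Omega> (codebook_space d k) \<longrightarrow>
          T = nat \<lceil>ln (real n) / ln (4 / 3)\<rceil> \<longrightarrow>
          cT = (\<lambda>\<omega>. (lloyd_step d k (empirical_mean (Rd d) n (\<lambda>i. Xs i \<omega>)) ^^ T) (c0 \<omega>)) \<longrightarrow>
          measure \<Omega> {\<omega> \<in> space \<Omega>.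
              c0 \<omega> \<in> codebook_neighbourhood d k (C_opt d k \<mu>) R0 \<longrightarrow>
              distortion d k \<mu> (cT \<omega>) - min_distortion d k \<mu>
                \<le> measure \<mu> (space \<mu>) *
                    (B\<^sup>2 * r0\<^sup>2 / (512 * R\<^sup>2 * real n)
                     + C * (M\<^sup>2 * R\<^sup>2 * (real k)\<^sup>2 * real d * ln (real k) / (real n * p\<^sup>2)) * (1 + x))}
            \<ge> 1 - 9 * exp (- c1 * real n * p\<^sup>2 * \<kappa>0\<^sup>2 / M\<^sup>2) - exp (- x))"

proof (rule exI[of _ "3 / 524288"], rule conjI, simp, rule exI[of _ "10 ^ 8"], intro conjI allI impI)
  fix d k N :: nat and R M r0 :: real and \<Omega>' :: "'v measure" and X :: "'v \<Rightarrow> (nat \<Rightarrow> real) measure"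
    and \<mu> :: "(nat \<Rightarrow> real) measure" and B p R0 \<kappa>0 :: real
  assume d: "1 \<le> d" and k: "2 \<le> k" and R: "0 < R" and M: "0 < M" and \<Omega>': "prob_space \<Omega>'"
    and X: "X \<in> measurable \<Omega>' (measure_space_of d N R M)" and \<mu>_eq: "\<mu> = mean_measure \<Omega>' (Rd d) X"
    and r0: "0 < r0" and margin: "margin_condition d k R \<mu> r0"
    and B: "B = B_sep d k \<mu>" and p: "p = p_min d k \<mu>"
    and R0: "R0 = B * r0 / (16 * sqrt 2 * R)" and \<kappa>0: "\<kappa>0 = R0 / R"
  let ?goal = "\<lambda>n x (\<Omega> :: 'w measure) Xs c0 T. 1 - 9 * exp (- (3 / 524288) * real n * p\<^sup>2 * \<kappa>0\<^sup>2 / M\<^sup>2) - exp (- x)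
    \<le> measure \<Omega> {\<omega> \<in> space \<Omega>. c0 \<omega> \<in> codebook_neighbourhood d k (C_opt d k \<mu>) R0 \<longrightarrow>
              distortion d k \<mu> ((lloyd_step d k (empirical_mean (Rd d) n (\<lambda>i. Xs i \<omega>)) ^^ T) (c0 \<omega>)) - min_distortion d k \<mu>
                \<le> measure \<mu> (space \<mu>) *
                    (B\<^sup>2 * r0\<^sup>2 / (512 * R\<^sup>2 * real n)
                     + 10 ^ 8 * (M\<^sup>2 * R\<^sup>2 * (real k)\<^sup>2 * real d * ln (real k) / (real n * p\<^sup>2)) * (1 + x))}"
  have X': "X \<in> measurable \<Omega>' (ball_measure_space d R M)" using X by (rule measurable_measure_space_ofD)
  have \<mu>: "\<mu> \<in> ball_measures d R M" unfolding \<mu>_eq by (rule mean_measure_ball(3)[OF X' \<Omega>'])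
  have "\<exists>n0. \<forall>n\<ge>n0. \<forall>x>0. \<forall>(\<Omega> :: 'w measure) Xs c0 T.
      prob_space \<Omega> \<longrightarrow>
      prob_space.indep_vars \<Omega> (\<lambda>_. measure_space_of d N R M) Xs {1..n} \<longrightarrow>
      (\<forall>i\<in>{1..n}. distr \<Omega> (measure_space_of d N R M) (Xs i) = distr \<Omega>' (measure_space_of d N R M) X) \<longrightarrow>
      c0 \<in> measurable \<Omega> (codebook_space d k) \<longrightarrow>
      T = nat \<lceil>ln (real n) / ln (4 / 3)\<rceil> \<longrightarrow> ?goal n x \<Omega> Xs c0 T"
  proof (cases "C_opt d k \<mu> = {}")
    case True
    \<comment> \<open>Without optimal codebooks no initial codebook is close to one, and the claim is vacuous.\<close>
    have "?goal n x \<Omega> Xs c0 T" if "prob_space \<Omega>" for n x and \<Omega> :: "'w measure" and Xs c0 T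
    proof -
      have le: "1 - 9 * exp u - exp v \<le> 1" for u v :: real
        using exp_ge_zero[of u] exp_ge_zero[of v] by linarith
      show ?thesis using True le by (simp add: codebook_neighbourhood_def prob_space.prob_space[OF that])
    qed
    then show ?thesis by blast
  next
    case nonempty: False
    \<comment> \<open>If \<open>B\<close> or \<open>p\<close> vanishes, then the exponent vanishes and the claimed probability is negative.\<close>
    have B0: "0 \<le> B"
    proof -
      obtain c where "c \<in> C_opt d k \<mu>" using nonempty by blast
      moreover have "(1 :: nat) \<in> {1..k}" "2 \<in> {1..k}" using k by auto
      ultimately have "edist d (c 1) (c 2) \<in> {edist d (c i) (c j) | c i j. c \<in> C_opt d k \<mu> \<and> i \<in> {1..k} \<and> j \<in> {1..k} \<and> i \<noteq> j}"
        by force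
      then show ?thesis unfolding B B_sep_def by (intro cInf_greatest) auto
    qed
    have p0: "0 \<le> p"
    proof -
      obtain c where "c \<in> C_opt d k \<mu>" using nonempty by blast
      moreover have "(1 :: nat) \<in> {1..k}" using k by auto
      ultimately have "measure \<mu> (cell d k c 1) \<in> {measure \<mu> (cell d k c j) | c j. c \<in> C_opt d k \<mu> \<and> j \<in> {1..k}}"
        by blast
      then show ?thesis unfolding p p_min_def by (intro cInf_greatest) auto
    qed
    show ?thesis
    proof (cases "0 < B \<and> 0 < p")
      case False
      then have "p\<^sup>2 * \<kappa>0\<^sup>2 = 0" using B0 p0 by (auto simp: \<kappa>0 R0)
      then have exponent: "- (3 / 524288) * real n * p\<^sup>2 * \<kappa>0\<^sup>2 / M\<^sup>2 = 0" for n :: nat by auto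
      have le: "1 - 9 * exp 0 - exp v \<le> measure M' A" for v :: real and M' :: "'w measure" and A
        using exp_ge_zero[of v] measure_nonneg[of M' A] unfolding exp_zero by linarith
      have "?goal n x \<Omega> Xs c0 T" for n x and \<Omega> :: "'w measure" and Xs c0 T
        unfolding exponent by (rule le)
      then show ?thesis by blast
    next
      case True
      interpret margin_setting d k R M r0 \<mu>
        using d k R M \<mu> r0 margin nonempty True by unfold_locales (auto simp: B p)
      have R0': "R0 = margin_setting.R0 d k R r0 \<mu>" using R0_def by (simp add: R0 B)
      define \<theta> where "\<theta> = p\<^sup>2 * (R0 / R)\<^sup>2 / M\<^sup>2"
      have \<theta>: "0 < \<theta>" using True R0_pos R M by (simp add: \<theta>_def R0')
      obtain S where S: "\<forall>c\<in>C. \<forall>c'\<in>C. c \<noteq> c' \<longrightarrow> 1 / 4 ^ S \<le> \<rho> c c'" using ex_separation_C_opt by blast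
      obtain n0 where n0: "\<And>n. n0 \<le> n \<Longrightarrow> 100 \<le> n \<and>
          4 * 4 ^ S * ((22 * W + 2) * real (Suc S) + ln (4 * real (card C))) \<le> real n \<and>
          (ln (4 * real n * real (card C)))\<^sup>2 \<le> real n \<and>
          real (card C) * (2 + real n) * exp (- (3 / 524288 * real n * \<theta>)) \<le> 9"
        using eventually_sample_large[OF \<theta>] unfolding eventually_sequentially by blast
      show ?thesis
      proof (intro exI[of _ n0] allI impI)
        fix n and x :: real and \<Omega> :: "'w measure" and Xs and c0 and T
        assume n: "n0 \<le> n" and x: "0 < x" and \<Omega>: "prob_space \<Omega>"
          and ind: "prob_space.indep_vars \<Omega> (\<lambda>_. measure_space_of d N R M) Xs {1..n}"
          and distr: "\<forall>i\<in>{1..n}. distr \<Omega> (measure_space_of d N R M) (Xs i) = distr \<Omega>' (measure_space_of d N R M) X"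
          and c0: "c0 \<in> measurable \<Omega> (codebook_space d k)"
          and T: "T = nat \<lceil>ln (real n) / ln (4 / 3)\<rceil>"
        interpret sampled_setting d k R M r0 \<mu> \<Omega> N "distr \<Omega>' (measure_space_of d N R M) X" Xs n
        proof (intro sampled_setting.intro margin_setting_axioms iid_sample.intro \<Omega> iid_sample_axioms.intro sampled_setting_axioms.intro)
          show "prob_space.indep_vars \<Omega> (\<lambda>_. measure_space_of d N R M) Xs {1..n}" by (rule ind)
          show "prob_space (distr \<Omega>' (measure_space_of d N R M) X)" by (rule prob_space.prob_space_distr[OF \<Omega>' X])
          show "distr \<Omega> (measure_space_of d N R M) (Xs i) = distr \<Omega>' (measure_space_of d N R M) X" if "i \<in> {1..n}" for i
            using distr that by blast
          show "1 \<le> n" using n0[OF n] by simp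
          fix f :: "(nat \<Rightarrow> real) \<Rightarrow> real" and c :: real
          assume f: "f \<in> borel_measurable (Rd d)" "\<And>u. u \<in> ball0 d R \<Longrightarrow> \<bar>f u\<bar> \<le> c"
          have "(\<lambda>y. \<integral>u. f u \<partial>y) \<in> borel_measurable (measure_space_of d N R M)"
            using f by (intro borel_measurable_integral_kernel[OF measure_space_of_measurable_ident M])
              (simp_all add: case_prod_beta')
          then have "(\<integral>y. (\<integral>u. f u \<partial>y) \<partial>distr \<Omega>' (measure_space_of d N R M) X) = (\<integral>\<omega>. \<integral>u. f u \<partial>X \<omega> \<partial>\<Omega>')"
            by (rule integral_distr[OF X])
          also have "\<dots> = (\<integral>u. f u \<partial>\<mu>)"
            unfolding \<mu>_eq by (rule integral_mean_measure(1)[OF X' \<Omega>' M f, symmetric])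
          finally show "(\<integral>y. (\<integral>u. f u \<partial>y) \<partial>distr \<Omega>' (measure_space_of d N R M) X) = (\<integral>u. f u \<partial>\<mu>)" .
        qed simp
        have big: "100 \<le> n" "4 * 4 ^ S * ((22 * W + 2) * real (Suc S) + ln (4 * real (card C))) \<le> real n"
          "(ln (4 * real n * real (card C)))\<^sup>2 \<le> real n"
          "real (card C) * (2 + real n) * exp (- (3 / 524288 * real n * \<theta>)) \<le> 9"
          using n0[OF n] by auto
        have exponent: "- (3 / 524288) * real n * p\<^sup>2 * \<kappa>0\<^sup>2 / M\<^sup>2 = - (3 / 524288 * real n * (p\<^sup>2 * (R0 / R)\<^sup>2 / M\<^sup>2))"
          by (simp add: \<kappa>0)
        show "?goal n x \<Omega> Xs c0 T"
          unfolding exponent unfolding R0' B p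
          using prob_lloyd_excess[OF S x big(1,2,3) big(4)[unfolded \<theta>_def R0' p] c0 T] unfolding Qn_def .
      qed
    qed
  qed
  then show "\<exists>n0. \<forall>n\<ge>n0. \<forall>x>(0::real).
        \<forall>(\<Omega> :: 'w measure) (Xs :: nat \<Rightarrow> 'w \<Rightarrow> (nat \<Rightarrow> real) measure)
          (c0 :: 'w \<Rightarrow> nat \<Rightarrow> nat \<Rightarrow> real) (T::nat) (cT :: 'w \<Rightarrow> nat \<Rightarrow> nat \<Rightarrow> real).
          prob_space \<Omega> \<longrightarrow>
          prob_space.indep_vars \<Omega> (\<lambda>_. measure_space_of d N R M) Xs {1..n} \<longrightarrow>
          (\<forall>i\<in>{1..n}. distr \<Omega> (measure_space_of d N R M) (Xs i)
                     = distr \<Omega>' (measure_space_of d N R M) X) \<longrightarrow>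
          c0 \<in> measurable \<Omega> (codebook_space d k) \<longrightarrow>
          T = nat \<lceil>ln (real n) / ln (4 / 3)\<rceil> \<longrightarrow>
          cT = (\<lambda>\<omega>. (lloyd_step d k (empirical_mean (Rd d) n (\<lambda>i. Xs i \<omega>)) ^^ T) (c0 \<omega>)) \<longrightarrow>
          measure \<Omega> {\<omega> \<in> space \<Omega>.
              c0 \<omega> \<in> codebook_neighbourhood d k (C_opt d k \<mu>) R0 \<longrightarrow>
              distortion d k \<mu> (cT \<omega>) - min_distortion d k \<mu>
                \<le> measure \<mu> (space \<mu>) *
                    (B\<^sup>2 * r0\<^sup>2 / (512 * R\<^sup>2 * real n)
                     + 10 ^ 8 * (M\<^sup>2 * R\<^sup>2 * (real k)\<^sup>2 * real d * ln (real k) / (real n * p\<^sup>2)) * (1 + x))}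
            \<ge> 1 - 9 * exp (- (3 / 524288) * real n * p\<^sup>2 * \<kappa>0\<^sup>2 / M\<^sup>2) - exp (- x)"
    by meson
qed simp_all

end
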